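(* Let $\theta>0$, and let $\lambda_{\tilde L,\tilde R}:[-\theta,\theta]\to\mathbb{Y}$ be the Poissonized RS process of parameter $\theta$. Fix times $t_1<\dots<t_n$ in $[-\theta,0)$ and $s_1<\dots<s_m$ in $(0,\theta]$. Let $\lambda^{(1)}\subset\dots\subset\lambda^{(n)}$ be an increasing list of Young diagrams, $\mu^{(1)}\supset\dots\supset\mu^{(m)}$ a decreasing list of Young diagrams, and $\nu$ a Young diagram with $\nu\supset\lambda^{(n)}$ and $\nu\supset\mu^{(1)}$. Put $\lambda^{(0)}=\emptyset$, $\lambda^{(n+1)}=\nu$, $\mu^{(0)}=\nu$, $\mu^{(m+1)}=\emptyset$, $t_0=-\theta$, $t_{n+1}=0$, $s_0=0$, $s_{m+1}=\theta$. Then $$\mathbf{P}\left(\bigcap_{i=1}^{n}\{\lambda_{\tilde L,\tilde R}(t_i)=\lambda^{(i)}\}\cap\{\lambda_{\tilde L,\tilde R}(0)=\nu\}\cap\bigcap_{j=1}^{m}\{\lambda_{\tilde L,\tilde R}(s_j)=\mu^{(j)}\}\right)$$ $$=e^{-\theta^2}\left(\prod_{i=0}^{n}\dim(\lambda^{(i+1)}/\lambda^{(i)})\frac{(t_{i+1}-t_i)^{|\lambda^{(i+1)}/\lambda^{(i)}|}}{|\lambda^{(i+1)}/\lambda^{(i)}|!}\right)\cdot\left(\prod_{j=0}^{m}\dim(\mu^{(j)}/\mu^{(j+1)})\frac{(s_{j+1}-s_j)^{|\mu^{(j)}/\mu^{(j+1)}|}}{|\mu^{(j)}/\mu^{(j+1)}|!}\right),$$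 where $\dim(\lambda/\mu)$ is the number of standard Young tableaux of skew shape $\lambda/\mu$.
   Context: $\mathbb{Y}$ is the set of Young diagrams (partitions $\lambda=(\lambda_1\ge\lambda_2\ge\dots)$ with finitely many non-zero entries), identified with sets of boxes: $(i,j)\in\lambda$ iff $j\le\lambda_i$. $|\lambda|$ is the number of boxes; for $\mu\subset\lambda$, $\lambda/\mu$ is the skew diagram of boxes in $\lambda$ not in $\mu$, and $|\lambda/\mu|=|\lambda|-|\mu|$. $\mathrm{sh}(T)$ is the shape of a tableau $T$, and $T(i,j)$ its entry in box $(i,j)$. The empty skew shape has $\dim=1$, and $0^0=1$. Robinson–Schensted (RS) correspondence: the bijection from $S_n$ to pairs $(L,R)$ of standard Young tableaux of the same shape and size $n$, where $L$ is the insertion tableau obtained by row-inserting $\sigma(1),\dots,\sigma(n)$ and $R$ is the recording tableau. Decorated RS: let $\mathcal{C}^\theta$ be the set of finite point configurations $\Pi\subset[0,\theta]^2$ with no two points on a common horizontal or vertical line. Given $\Pi\in\mathcal{C}^\theta$ with $n$ points, let $r_1<\dots<r_n$ be the sorted $x$-coordinates, $\ell_1<\dots<\ell_n$ the sorted $y$-coordinates, and $\sigma\in S_n$ the associated permutation, i.e. the unique one with $\Pi=\{(r_i,\ell_{\sigma(i)})\}_{i=1}^n$. Let $(L,R)$ be the RS pair of $\sigma$. The pair of decorated tableaux associated with $\Pi$ is $\tilde L=(L,(\ell_1,\dots,\ell_n))$, $\tilde R=(R,(r_1,\dots,r_n))$; the lists $(\ell_i)$, $(r_i)$ are called the decorations.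 Young diagram process: put $\lambda_{\tilde L}(u)=\{(i,j):\ell_{L(i,j)}\le u\}$ and $\lambda_{\tilde R}(u)=\{(i,j):r_{R(i,j)}\le u\}$ for $u\geq 0$, and for $t\in[-\theta,\theta]$ put $\lambda_{\tilde L,\tilde R}(t)=\lambda_{\tilde L}(\theta+t)$ if $t\le0$, $\lambda_{\tilde L,\tilde R}(t)=\lambda_{\tilde R}(\theta-t)$ if $t\ge0$ (the definitions agree at $t=0$). Poissonized RS process: take $\Pi$ to be a rate 1 Poisson point process in $[0,\theta]\times[0,\theta]$ (almost surely in $\mathcal{C}^\theta$); the resulting random $(\tilde L,\tilde R)$ is the Poissonized RS tableaux of parameter $\theta$, and $\lambda_{\tilde L,\tilde R}$ is the Poissonized RS process. *)

theory Defs
  imports "HOL-Probability.Probability" "HOL-Combinatorics.Permutations"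
begin

section \<open>Young diagrams and standard Young tableaux\<close>

text \<open>Boxes are pairs (row, column), both counted from 1; the value \<open>p 0\<close> is irrelevant.\<close>

type_synonym box = "nat \<times> nat"

definition young_diagrams :: "box set set" where
  "young_diagrams =
     {{(i, j). 1 \<le> i \<and> 1 \<le> j \<and> j \<le> p i} | p :: nat \<Rightarrow> nat.
        (\<forall>i\<ge>1. p (Suc i) \<le> p i) \<and> finite {i. 1 \<le> i \<and> p i \<noteq> 0}}"

text \<open>Tableaux on a set of boxes are extensional functions, so that each filling is counted once.
  A skew shape \<open>lam/mu\<close> is given as the set difference \<open>lam - mu\<close>.\<close>

definition standard_tableaux :: "box set \<Rightarrow> (box \<Rightarrow> nat) set" where
  "standard_tableaux D =
     {T \<in> extensional D. bij_betw T D {1..card D} \<and>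
        (\<forall>i j j'. (i, j) \<in> D \<and> (i, j') \<in> D \<and> j < j' \<longrightarrow> T (i, j) < T (i, j')) \<and>
        (\<forall>i i' j. (i, j) \<in> D \<and> (i', j) \<in> D \<and> i < i' \<longrightarrow> T (i, j) < T (i', j))}"

definition skew_dim :: "box set \<Rightarrow> nat" where
  "skew_dim D = card (standard_tableaux D)"


section \<open>The Robinson--Schensted correspondence\<close>

text \<open>The tableaux produced by the algorithm are lists of rows.\<close>

type_synonym tableau = "nat list list"

definition shape :: "tableau \<Rightarrow> box set" where
  "shape T = {(i, j). 1 \<le> i \<and> i \<le> length T \<and> 1 \<le> j \<and> j \<le> length (T ! (i - 1))}"

definition entry :: "tableau \<Rightarrow> box \<Rightarrow> nat" where
  "entry T b = T ! (fst b - 1) ! (snd b - 1)"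

text \<open>The second component is the bumped entry, if any.\<close>

fun row_insert :: "nat \<Rightarrow> nat list \<Rightarrow> nat list \<times> nat option" where
  "row_insert x [] = ([x], None)"
| "row_insert x (y # ys) =
     (if x < y then (x # ys, Some y)
      else (let (zs, b) = row_insert x ys in (y # zs, b)))"

text \<open>The second component is the (0-based) row in which the new box appears.\<close>

fun tableau_insert :: "nat \<Rightarrow> tableau \<Rightarrow> tableau \<times> nat" where
  "tableau_insert x [] = ([[x]], 0)"
| "tableau_insert x (r # T) =
     (case row_insert x r of
        (r', None) \<Rightarrow> (r' # T, 0)
      | (r', Some y) \<Rightarrow> (let (T', k) = tableau_insert y T in (r' # T', Suc k)))"

definition append_to_row :: "nat \<Rightarrow> nat \<Rightarrow> tableau \<Rightarrow> tableau" where
  "append_to_row k x T = (if k < length T then T[k := T ! k @ [x]] else T @ [[x]])"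

primrec RS :: "(nat \<Rightarrow> nat) \<Rightarrow> nat \<Rightarrow> tableau \<times> tableau" where
  "RS \<sigma> 0 = ([], [])"
| "RS \<sigma> (Suc n) =
     (let (L, R) = RS \<sigma> n; (L', k) = tableau_insert (\<sigma> (Suc n)) L
      in (L', append_to_row k (Suc n) R))"


section \<open>Decorated tableaux of a point configuration\<close>

definition configurations :: "real \<Rightarrow> (real \<times> real) set set" where
  "configurations \<theta> =
     {P. finite P \<and> P \<subseteq> {0..\<theta>} \<times> {0..\<theta>} \<and> inj_on fst P \<and> inj_on snd P}"

definition x_coords :: "(real \<times> real) set \<Rightarrow> real list" where
  "x_coords P = sorted_list_of_set (fst ` P)"

definition y_coords :: "(real \<times> real) set \<Rightarrow> real list" where
  "y_coords P = sorted_list_of_set (snd ` P)"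

definition config_perm :: "(real \<times> real) set \<Rightarrow> nat \<Rightarrow> nat" where
  "config_perm P =
     (THE \<sigma>. \<sigma> permutes {1..card P} \<and>
        P = (\<lambda>i. (x_coords P ! (i - 1), y_coords P ! (\<sigma> i - 1))) ` {1..card P})"

type_synonym decorated_tableau = "tableau \<times> real list"

definition decorated_L :: "(real \<times> real) set \<Rightarrow> decorated_tableau" where
  "decorated_L P = (fst (RS (config_perm P) (card P)), y_coords P)"

definition decorated_R :: "(real \<times> real) set \<Rightarrow> decorated_tableau" where
  "decorated_R P = (snd (RS (config_perm P) (card P)), x_coords P)"

definition subdiagram :: "decorated_tableau \<Rightarrow> real \<Rightarrow> box set" where
  "subdiagram = (\<lambda>(T, d) u. {b \<in> shape T. d ! (entry T b - 1) \<le> u})"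

text \<open>The decorated tableaux are meaningful only for \<open>P \<in> configurations \<theta>\<close>. A Poisson process
  lies in this set almost surely; on the exceptional null event the diagram process is set to be
  constantly empty.\<close>

definition diagram_process :: "real \<Rightarrow> (real \<times> real) set \<Rightarrow> real \<Rightarrow> box set" where
  "diagram_process \<theta> P t =
     (if P \<in> configurations \<theta>
      then if t \<le> 0 then subdiagram (decorated_L P) (\<theta> + t)
           else subdiagram (decorated_R P) (\<theta> - t)
      else {})"


section \<open>Poisson point processes\<close>

text \<open>Realisations are finite sets of points, which is adequate for finite diffuse intensity
  measures (almost surely no point is multiple).\<close>

locale poisson_point_process =
  prob_space M + intensity: finite_measure \<mu>
  for M :: "'w measure" and \<mu> :: "'a measure" +
  fixes X :: "'w \<Rightarrow> 'a set"
  assumes finite_points: "\<omega> \<in> space M \<Longrightarrow> finite (X \<omega>)"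
    and points_in_space: "\<omega> \<in> space M \<Longrightarrow> X \<omega> \<subseteq> space \<mu>"
    and count_measurable:
      "A \<in> sets \<mu> \<Longrightarrow> (\<lambda>\<omega>. card (X \<omega> \<inter> A)) \<in> measurable M (count_space UNIV)"
    and count_poisson:
      "A \<in> sets \<mu> \<Longrightarrow>
         prob {\<omega> \<in> space M. card (X \<omega> \<inter> A) = k} = exp (- measure \<mu> A) * measure \<mu> A ^ k / fact k"
    and count_indep:
      "(\<And>i. i < N \<Longrightarrow> B i \<in> sets \<mu>) \<Longrightarrow> disjoint_family_on B {..<N} \<Longrightarrow>
         indep_vars (\<lambda>_. count_space UNIV) (\<lambda>i \<omega>. card (X \<omega> \<inter> B i)) {..<N::nat}"

abbreviation rate_one_on_square :: "real \<Rightarrow> (real \<times> real) measure" where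
  "rate_one_on_square \<theta> \<equiv> restrict_space lborel ({0..\<theta>} \<times> {0..\<theta>})"

end

theory Submission imports Defs begin

text \<open>At time \<open>t \<le> 0\<close> the process is the set of boxes of the insertion tableau whose entry is at
  most the number of points with ordinate at most \<open>\<theta> + t\<close>, and symmetrically for the recording
  tableau. The event therefore says that the numbers of points in the horizontal and vertical
  strips are prescribed and that the permutation of the configuration lies in a finite set \<open>G\<close>. By
  the Robinson--Schensted bijection, \<open>G\<close> is counted by pairs of standard tableaux of shape \<open>nu\<close> that
  restrict to the given chains of subdiagrams, that is, by products of skew dimensions.

  For a single permutation the strip counts have probability
  \<open>exp (- \<theta>\<^sup>2)\<close> times a product of factors \<open>width ^ count / fact count\<close>. To see this without
  integration, cut every strip into \<open>N\<close> equal pieces. The points occupy a prescribed set of cells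
  once each, and no other cell, with probability exactly \<open>exp (- \<theta>\<^sup>2)\<close> times the product of the
  areas of these cells; summing over all rook placements with the right pattern gives binomial
  coefficients, and \<open>N \<longlonglongrightarrow> \<infinity>\<close> gives the claim, because a configuration eventually has its points in
  distinct rows and columns of the grid.\<close>

section \<open>Row insertion\<close>

text \<open>The hypotheses offer only the joint law of the counts in finitely many disjoint sets;
  neither independent uniform positions nor a conditional law given the number of points is at hand.
  The permutation of a configuration is not a function of such counts, and this gap forces the limit
  over grids. On a fixed grid the rook pattern is a sufficient but not a necessary witness of the
  event, and grids for different \<open>N\<close> need not be nested, so the approximating events
  converge pointwise without being known to be monotone.

  Two further points shape the statements. Realisations outside
  \<open>configurations \<theta>\<close> count as constantly empty paths, so they belong to the
  event when all prescribed diagrams are empty; that they are negligible is derived from the same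
  counts. And the Robinson-Schensted bijection is proved for injective words with an arbitrary set
  \<open>A\<close> of letters, because removing the last letter of a permutation leaves a word whose
  letters need not form an initial segment.\<close>

definition first_row :: "tableau \<Rightarrow> nat list" where
  "first_row T = (case T of [] \<Rightarrow> [] | r # _ \<Rightarrow> r)"

definition row_above :: "nat list \<Rightarrow> nat list \<Rightarrow> bool" where
  "row_above r q \<longleftrightarrow> length q \<le> length r \<and> (\<forall>j<length q. r ! j < q ! j)"

fun is_tableau :: "tableau \<Rightarrow> bool" where
  "is_tableau [] \<longleftrightarrow> True"
| "is_tableau (r # T) \<longleftrightarrow>
     r \<noteq> [] \<and> sorted_wrt (<) r \<and> row_above r (first_row T) \<and> is_tableau T"

abbreviation entries :: "tableau \<Rightarrow> nat set" where
  "entries T \<equiv> set (concat T)"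

lemma first_row_simps [simp]: "first_row [] = []" "first_row (r # T) = r"
  by (simp_all add: first_row_def)

lemma row_above_Nil [simp]: "row_above r []"
  by (simp add: row_above_def)

lemma sorted_first_row: "is_tableau T \<Longrightarrow> sorted_wrt (<) (first_row T)"
  by (cases T) auto

lemma set_first_row_subset: "set (first_row T) \<subseteq> entries T"
  by (cases T) auto

lemma first_row_eq_Nil_iff: "is_tableau T \<Longrightarrow> first_row T = [] \<longleftrightarrow> T = []"
  by (cases T) auto

lemma row_insert_append:
  "\<forall>y\<in>set r. y < x \<Longrightarrow> row_insert x r = (r @ [x], None)"
  by (induction r) auto

lemma row_insert_update:
  "p < length r \<Longrightarrow> x < r ! p \<Longrightarrow> \<forall>j<p. r ! j < x \<Longrightarrow> row_insert x r = (r[p := x], Some (r ! p))"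
proof (induction r arbitrary: p)
  case (Cons y r)
  show ?case
  proof (cases p)
    case 0
    with Cons.prems show ?thesis by simp
  next
    case (Suc p')
    have "y < x" using Cons.prems(3) Suc by force
    moreover have "row_insert x r = (r[p' := x], Some (r ! p'))"
      using Cons.prems Suc by (intro Cons.IH) auto
    ultimately show ?thesis using Suc by simp
  qed
qed simp

text \<open>For a letter not in the row the recursion has exactly two outcomes: the letter is
  appended, or it replaces the leftmost larger entry. Most later arguments about rows use this case
  split instead of the recursion.\<close>

lemma row_insert_cases:
  assumes "x \<notin> set r"
  obtains (append) "row_insert x r = (r @ [x], None)" "\<forall>y\<in>set r. y < x"
  | (bump) p where "row_insert x r = (r[p := x], Some (r ! p))" "p < length r" "x < r ! p"
      "\<forall>j<p. r ! j < x"
proof (cases "\<exists>p. p < length r \<and> x < r ! p")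
  case True
  define p where "p = (LEAST p. p < length r \<and> x < r ! p)"
  have p: "p < length r" "x < r ! p"
    using LeastI_ex[OF True] by (auto simp: p_def)
  have "r ! j < x" if "j < p" for j
  proof -
    have "\<not> x < r ! j" using not_less_Least[of j] that p(1) unfolding p_def by force
    moreover have "r ! j \<noteq> x" using that p(1) assms by force
    ultimately show ?thesis by simp
  qed
  with p show ?thesis using bump row_insert_update by blast
next
  case False
  then have "\<forall>y\<in>set r. y < x" using assms by (metis in_set_conv_nth nat_neq_iff)
  then show ?thesis using append row_insert_append by blast
qed

lemma sorted_wrt_row_bump:
  fixes r :: "nat list"
  assumes "sorted_wrt (<) r" "p < length r" "x < r ! p" "\<forall>j<p. r ! j < x"
  shows "sorted_wrt (<) (r[p := x])"
  unfolding sorted_wrt_iff_nth_less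
proof (intro allI impI)
  fix i j assume ij: "i < j" "j < length (r[p := x])"
  then have "r ! i < r ! j" using assms(1) by (simp add: sorted_wrt_nth_less)
  then show "r[p := x] ! i < r[p := x] ! j"
    using assms ij by (cases "i = p"; cases "j = p") auto
qed

lemma sorted_wrt_row_unbump:
  fixes r :: "nat list"
  assumes "sorted_wrt (<) r" "p < length r" "r ! p < y" "\<forall>j. p < j \<and> j < length r \<longrightarrow> y < r ! j"
  shows "sorted_wrt (<) (r[p := y])"
  unfolding sorted_wrt_iff_nth_less
proof (intro allI impI)
  fix i j assume ij: "i < j" "j < length (r[p := y])"
  then have "r ! i < r ! j" using assms(1) by (simp add: sorted_wrt_nth_less)
  then show "r[p := y] ! i < r[p := y] ! j"
    using assms ij by (cases "i = p"; cases "j = p") auto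
qed

lemma sorted_wrt_row_append:
  fixes r :: "nat list"
  assumes "sorted_wrt (<) r" "\<forall>y\<in>set r. y < x"
  shows "sorted_wrt (<) (r @ [x])"
  using assms by (simp add: sorted_wrt_append)

lemma row_above_append: "row_above r q \<Longrightarrow> row_above (r @ [x]) q"
  by (auto simp: row_above_def nth_append)

text \<open>A bumped entry moves weakly to the left: as \<open>r ! p < q ! p\<close> wherever
  \<open>q\<close> reaches column \<open>p\<close>, it lands in a column at most \<open>p\<close>.
  The entry above its new place is then \<open>x\<close> or an entry of \<open>r\<close> left of
  column \<open>p\<close>, hence smaller.\<close>

lemma row_above_bump:
  assumes ab: "row_above r q" and r: "sorted_wrt (<) r"
    and p: "p < length r" "x < r ! p" "\<forall>j<p. r ! j < x" and y: "r ! p \<notin> set q"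
  shows "row_above (r[p := x]) (fst (row_insert (r ! p) q))"
  using y
proof (cases rule: row_insert_cases)
  case append
  have "length q \<le> p"
  proof (rule ccontr)
    assume "\<not> length q \<le> p"
    then have "r ! p < q ! p" "q ! p < r ! p" using ab append(2) by (auto simp: row_above_def)
    then show False by simp
  qed
  have "r[p := x] ! j < r ! p" if "j \<le> p" for j
    using that p r by (cases "j = p") (auto simp: sorted_wrt_nth_less)
  with append(1) \<open>length q \<le> p\<close> ab p show ?thesis
    by (auto simp: row_above_def nth_append less_Suc_eq)
next
  case (bump p')
  have "p' \<le> p"
  proof (rule ccontr)
    assume "\<not> p' \<le> p"
    then have "r ! p < q ! p" "q ! p < r ! p" using ab bump by (auto simp: row_above_def)
    then show False by simp
  qed
  have "r[p := x] ! j < q[p' := r ! p] ! j" if "j < length q" for j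
  proof (cases "j = p'")
    case True
    then show ?thesis using that p r \<open>p' \<le> p\<close> bump
      by (cases "p' = p") (auto simp: sorted_wrt_nth_less)
  next
    case False
    have "r[p := x] ! j \<le> r ! j" using p by (cases "j = p") auto
    moreover have "r ! j < q ! j" using ab that by (auto simp: row_above_def)
    ultimately show ?thesis using False by simp
  qed
  with bump(1) ab show ?thesis by (auto simp: row_above_def)
qed

text \<open>Reverse form of the leftward motion: inserting \<open>y\<close> into \<open>q\<close>
  puts it below an entry of \<open>r\<close> smaller than \<open>y\<close>, and \<open>p\<close> is
  the rightmost column with such an entry. So \<open>y\<close> landed at or left of column
  \<open>p\<close>, and whatever \<open>q\<close> has in column \<open>p\<close> exceeds
  \<open>y\<close>.\<close>

lemma row_above_unbump:
  assumes ab: "row_above r (fst (row_insert y q))" and r: "sorted_wrt (<) r"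
    and q: "sorted_wrt (<) q" "y \<notin> set q"
    and p: "p < length r" "r ! p < y" "\<forall>j. p < j \<and> j < length r \<longrightarrow> y < r ! j"
  shows "row_above (r[p := y]) q"
  using q(2)
proof (cases rule: row_insert_cases)
  case append
  have *: "r ! length q < y" "length q < length r" using ab append(1) by (auto simp: row_above_def)
  then have "length q \<le> p" using p by (meson not_le_imp_less order.asym)
  moreover have "r ! j < q ! j" if "j < length q" for j
    using ab append(1) that by (auto simp: row_above_def nth_append dest: spec[of _ j])
  ultimately show ?thesis using * by (auto simp: row_above_def)
next
  case (bump p')
  have *: "r ! p' < y" "p' < length r"
    using ab bump by (auto simp: row_above_def dest: spec[of _ p'])
  then have "p' \<le> p" using p by (meson not_le_imp_less order.asym)
  have "r[p := y] ! j < q ! j" if j: "j < length q" for j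
  proof (cases "j = p")
    case True
    have "y < q ! p" using bump j q True \<open>p' \<le> p\<close>
      by (cases "p' = p") (auto intro: less_trans simp: sorted_wrt_nth_less)
    then show ?thesis using True p by simp
  next
    case False
    have "r ! j < q[p' := y] ! j" using ab bump j by (auto simp: row_above_def)
    also have "\<dots> \<le> q ! j" using bump by (cases "j = p'") auto
    finally show ?thesis using False by simp
  qed
  then show ?thesis using ab bump by (auto simp: row_above_def)
qed

section \<open>Tableau insertion and its inverse\<close>

text \<open>The end of row \<open>k\<close> (counted from 0) is a removable box of the shape.
  Together with the tableau this is all that reverse insertion starts from.\<close>

fun corner :: "nat \<Rightarrow> tableau \<Rightarrow> bool" where
  "corner _ [] \<longleftrightarrow> False"
| "corner 0 (r # T) \<longleftrightarrow> length (first_row T) < length r"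
| "corner (Suc k) (r # T) \<longleftrightarrow> corner k T"

text \<open>Serves to carry a corner from the recording tableau, where the largest entry marks it,
  over to the insertion tableau of the same shape.\<close>

lemma corner_cong: "map length T = map length T' \<Longrightarrow> corner k T = corner k T'"
proof (induction k T arbitrary: T' rule: corner.induct)
  case (2 r T)
  then obtain r' U where U: "T' = r' # U" "length r = length r'" "map length T = map length U"
    by (cases T') auto
  then have "length (first_row T) = length (first_row U)"
    by (cases T; cases U) auto
  with U show ?case by simp
next
  case (3 k r T)
  then obtain r' U where U: "T' = r' # U" "length r = length r'" "map length T = map length U"
    by (cases T') auto
  with 3 show ?case by simp
qed auto

lemma append_to_row_simps [simp]:
  "append_to_row k x [] = [[x]]"
  "append_to_row 0 x (r # T) = (r @ [x]) # T"
  "append_to_row (Suc k) x (r # T) = r # append_to_row k x T"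
  by (simp_all add: append_to_row_def)

lemma first_row_tableau_insert:
  "first_row (fst (tableau_insert x T)) = fst (row_insert x (first_row T))"
  by (cases T) (auto split: prod.splits option.splits)

lemma mset_row_bump: "p < length r \<Longrightarrow> add_mset (r ! p) (mset (r[p := x])) = add_mset x (mset r)"
  by (simp add: mset_update)

text \<open>Because of this, reverse bumping is never stuck: an entry expelled upwards from the
  lower rows finds a smaller entry to displace, for instance the one in its own column.\<close>

lemma entry_above:
  "is_tableau T \<Longrightarrow> row_above r (first_row T) \<Longrightarrow> y \<in> entries T \<Longrightarrow> \<exists>x\<in>set r. x < y"
proof (induction T arbitrary: r)
  case (Cons q T)
  have hd: "\<exists>x\<in>set r. x < z" if "z \<in> set q" for z
  proof -
    obtain j where "j < length q" "z = q ! j" using \<open>z \<in> set q\<close> by (auto simp: in_set_conv_nth)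
    then show ?thesis using Cons.prems(2)
      by (intro bexI[of _ "r ! j"]) (auto simp: row_above_def)
  qed
  show ?case
  proof (cases "y \<in> set q")
    case False
    then obtain z where "z \<in> set q" "z < y" using Cons.IH[of q] Cons.prems by auto
    with hd[of z] show ?thesis by (meson less_trans)
  qed (rule hd)
qed simp

text \<open>The multiset form of the content yields both the entry set and the distinctness of the
  result. The letter \<open>y\<close> is arbitrary because only row lengths are compared: the shape
  grows by one box at the end of row \<open>k\<close>, and \<open>RS_standard\<close> takes the
  recording letter for \<open>y\<close>.\<close>

lemma tableau_insert_invariants:
  assumes "is_tableau T" "distinct (concat T)" "x \<notin> entries T" "tableau_insert x T = (T', k)"
  shows "is_tableau T' \<and> mset (concat T') = add_mset x (mset (concat T)) \<and> k \<le> length T \<and>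
    map length T' = map length (append_to_row k y T)"
  using assms
proof (induction x T arbitrary: T' k rule: tableau_insert.induct)
  case (1 x)
  then show ?case by auto
next
  case (2 x r T)
  from 2 have r: "r \<noteq> []" "sorted_wrt (<) r" "row_above r (first_row T)" "is_tableau T"
    "distinct (concat T)" "x \<notin> set r" by auto
  from r(6) show ?case
  proof (cases rule: row_insert_cases)
    case append
    with 2 r show ?thesis
      by (auto intro: sorted_wrt_row_append row_above_append)
  next
    case (bump p)
    obtain U l where U: "tableau_insert (r ! p) T = (U, l)" by fastforce
    have notin: "r ! p \<notin> entries T"
      using 2(3) bump(2) by (auto dest: nth_mem)
    have IH: "is_tableau U" "mset (concat U) = add_mset (r ! p) (mset (concat T))" "l \<le> length T"
      "map length U = map length (append_to_row l y T)"
      using "2.IH"[OF bump(1)[symmetric] refl r(4,5) notin U] bump by auto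
    have res: "T' = r[p := x] # U" "k = Suc l" using 2(5) bump(1) U by auto
    \<comment> \<open>Insertion below changes the first row of \<open>T\<close> exactly by row
      insertion of the bumped entry, so the two-row lemma applies.\<close>
    have "row_above (r[p := x]) (first_row U)"
      using row_above_bump[OF r(3,2) bump(2-4)] first_row_tableau_insert[of "r ! p" T] U
        notin set_first_row_subset[of T] by auto
    moreover have "sorted_wrt (<) (r[p := x])"
      using sorted_wrt_row_bump r bump by blast
    moreover have "mset (r[p := x]) + mset (concat U) = add_mset x (mset r + mset (concat T))"
      using IH(2) mset_row_bump[OF bump(2), of x]
      by (metis add_mset_add_single union_mset_add_mset_left union_mset_add_mset_right)
    ultimately show ?thesis using IH res r bump by auto
  qed
qed

text \<open>Suppose \<open>p1 < p2\<close>. Column \<open>p2\<close> of \<open>r1\<close> is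
  untouched by its own update and so holds \<open>x2\<close>, which is below the common bumped
  entry; yet it stands to the right of that entry in the increasing row \<open>r1\<close>.\<close>

lemma row_bump_cancel:
  fixes r1 r2 :: "nat list"
  assumes "sorted_wrt (<) r1" "sorted_wrt (<) r2" "r1[p1 := x1] = r2[p2 := x2]" "r1 ! p1 = r2 ! p2"
    "p1 < length r1" "p2 < length r2" "x1 < r1 ! p1" "x2 < r2 ! p2"
  shows "r1 = r2 \<and> x1 = x2"
proof -
  have *: "\<not> p < p'" if "sorted_wrt (<) r" "r[p := x] = r'[p' := x']" "r ! p = r' ! p'"
    "p' < length r'" "x' < r' ! p'" for r r' :: "nat list" and p p' x x'
  proof
    assume "p < p'"
    have len: "length r = length r'" using that(2) by (metis length_list_update)
    have "r ! p' = x'" using that(2,4) \<open>p < p'\<close> len by (metis nth_list_update_eq nth_list_update_neq nat_neq_iff)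
    moreover have "r ! p < r ! p'" using that(1,4) \<open>p < p'\<close> len by (simp add: sorted_wrt_nth_less)
    ultimately show False using that(3,5) by simp
  qed
  have "p1 = p2" using *[of r1 p1 x1 r2 p2 x2] *[of r2 p2 x2 r1 p1 x1] assms by force
  moreover have "r1[p1 := x1] ! p1 = r2[p1 := x2] ! p1" using assms(3) \<open>p1 = p2\<close> by simp
  moreover have "length r1 = length r2" using assms(3) by (metis length_list_update)
  ultimately show ?thesis using assms by (metis list_update_id list_update_overwrite nth_list_update_eq)
qed

text \<open>The row index \<open>k\<close> tells whether the first row was extended
  (\<open>k = 0\<close>) or bumped, so both runs take the same branch. In the bumping branch the
  lower rows determine the bumped entry by induction, and \<open>row_bump_cancel\<close> then
  determines the first row.\<close>

lemma tableau_insert_inj: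
  assumes "is_tableau T1" "distinct (concat T1)" "x1 \<notin> entries T1"
    "is_tableau T2" "distinct (concat T2)" "x2 \<notin> entries T2"
    "tableau_insert x1 T1 = (T', k)" "tableau_insert x2 T2 = (T', k)"
  shows "T1 = T2 \<and> x1 = x2"
  using assms
proof (induction x1 T1 arbitrary: x2 T2 T' k rule: tableau_insert.induct)
  case (1 x1)
  then have T': "T' = [[x1]]" "k = 0" by auto
  show ?case
  proof (cases T2)
    case Nil
    then show ?thesis using 1 by auto
  next
    case (Cons r T)
    have "x2 \<notin> set r" using 1 Cons by auto
    then show ?thesis using 1 T' Cons by (cases rule: row_insert_cases) (auto split: prod.splits)
  qed
next
  case (2 x1 r1 U1)
  have x1: "x1 \<notin> set r1" using 2 by auto
  show ?case
  proof (cases T2)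
    case Nil
    from x1 show ?thesis using 2 Nil by (cases rule: row_insert_cases) (auto split: prod.splits)
  next
    case (Cons r2 U2)
    have x2: "x2 \<notin> set r2" using 2 Cons by auto
    from x1 show ?thesis
    proof (cases rule: row_insert_cases)
      case append
      note a1 = this
      from x2 show ?thesis
        using 2 Cons a1 by (cases rule: row_insert_cases) (auto split: prod.splits)
    next
      case (bump p1)
      note b1 = this
      from x2 show ?thesis
      proof (cases rule: row_insert_cases)
        case append
        then show ?thesis using 2 Cons b1 by (auto split: prod.splits)
      next
        case (bump p2)
        obtain V1 l1 where V1: "tableau_insert (r1 ! p1) U1 = (V1, l1)" by fastforce
        obtain V2 l2 where V2: "tableau_insert (r2 ! p2) U2 = (V2, l2)" by fastforce
        have eq: "r1[p1 := x1] = r2[p2 := x2]" "V1 = V2" "l1 = l2"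
          using 2 Cons V1 V2 b1 bump by auto
        have n1: "r1 ! p1 \<notin> entries U1" "r2 ! p2 \<notin> entries U2"
          using 2(3) 2(6) b1(2) bump(2) Cons by (auto dest: nth_mem)
        have "U1 = U2 \<and> r1 ! p1 = r2 ! p2"
          using "2.IH"[OF b1(1)[symmetric] refl, of U2 "r2 ! p2" V1 l1] 2 n1 V1 V2 eq Cons
          by auto
        then show ?thesis
          using row_bump_cancel[OF _ _ eq(1)] 2 Cons b1 bump by auto
      qed
    qed
  qed
qed

text \<open>Reverse insertion: in the row of the corner the last entry is removed; in each row
  above, the entry \<open>y\<close> returned from the lower rows replaces the rightmost smaller
  entry, which is passed on upwards.\<close>

lemma tableau_insert_surj:
  assumes "is_tableau T'" "distinct (concat T')" "corner k T'"
  shows "\<exists>T x. is_tableau T \<and> distinct (concat T) \<and> x \<notin> entries T \<and> tableau_insert x T = (T', k)"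
  using assms
proof (induction k T' rule: corner.induct)
  case (2 r U)
  then have r: "r \<noteq> []" by auto
  obtain s x where s: "r = s @ [x]" using r by (metis rev_exhaust)
  show ?case
  proof (cases "s = []")
    case True
    then have "length (first_row U) = 0" using 2 s by simp
    then have "U = []" using 2 by (simp add: first_row_eq_Nil_iff)
    then show ?thesis using True s by (intro exI[of _ "[]"] exI[of _ x]) auto
  next
    case False
    have "\<forall>y\<in>set s. y < x" using 2 s by (auto simp: sorted_wrt_append)
    then have "tableau_insert x (s # U) = (r # U, 0)" by (simp add: row_insert_append s)
    moreover have "row_above s (first_row U)"
      using 2 s by (auto simp: row_above_def nth_append less_Suc_eq_le)
    moreover have "sorted_wrt (<) s" using 2 s by (simp add: sorted_wrt_append)
    ultimately show ?thesis using False 2 s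
      by (intro exI[of _ "s # U"] exI[of _ x]) auto
  qed
next
  case (3 k r U)
  then obtain T y where T: "is_tableau T" "distinct (concat T)" "y \<notin> entries T"
    "tableau_insert y T = (U, k)" by auto
  note inv = tableau_insert_invariants[OF T]
  have yU: "y \<in> entries U"
    by (metis inv insertI1 set_mset_add_mset_insert set_mset_mset)
  have subU: "entries T \<subseteq> entries U"
    by (metis inv subset_insertI set_mset_add_mset_insert set_mset_mset)
  have ex: "\<exists>p. p < length r \<and> r ! p < y"
    using entry_above[of U r y] yU 3 by (auto simp: in_set_conv_nth)
  \<comment> \<open>The rightmost entry below \<open>y\<close> is the one to expel: inserted again
    into the changed row, it meets \<open>y\<close> as the leftmost larger entry and bumps exactly
    that.\<close>
  define p where "p = Max {p. p < length r \<and> r ! p < y}"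
  have fin: "finite {p. p < length r \<and> r ! p < y}" by simp
  have p: "p < length r" "r ! p < y"
    using Max_in[OF fin] ex unfolding p_def by blast+
  have yr: "y \<notin> set r" using yU 3 by auto
  have pmax: "\<forall>j. p < j \<and> j < length r \<longrightarrow> y < r ! j"
  proof (intro allI impI)
    fix j assume j: "p < j \<and> j < length r"
    have "\<not> r ! j < y"
    proof
      assume "r ! j < y"
      then have "j \<le> p" using Max_ge[OF fin, of j] j unfolding p_def by simp
      then show False using j by simp
    qed
    then show "y < r ! j" using yr j by (metis nat_neq_iff nth_mem)
  qed
  have r: "sorted_wrt (<) r" "row_above r (first_row U)" "distinct r" using 3 by auto
  have lower: "\<forall>j<p. r[p := y] ! j < r ! p"
    using r(1) p by (auto simp: sorted_wrt_nth_less)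
  have "row_insert (r ! p) (r[p := y]) = (r, Some y)"
    using row_insert_update[of p "r[p := y]" "r ! p"] p lower by auto
  then have ins: "tableau_insert (r ! p) (r[p := y] # T) = (r # U, Suc k)" using T by simp
  have "row_above (r[p := y]) (first_row T)"
    using row_above_unbump[of r y "first_row T" p] first_row_tableau_insert[of y T] T r p pmax
      sorted_first_row[OF T(1)] set_first_row_subset[of T] by auto
  moreover have "sorted_wrt (<) (r[p := y])" using sorted_wrt_row_unbump r p pmax by blast
  ultimately have tab: "is_tableau (r[p := y] # T)" using T p by auto
  have sub: "set (r[p := y]) \<subseteq> insert y (set r)" by (rule set_update_subset_insert)
  have disj: "set r \<inter> entries U = {}" using 3 by auto
  have "distinct (concat (r[p := y] # T))"
  proof -
    have "set (r[p := y]) \<inter> entries T = {}" using sub subU disj T(3) by blast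
    moreover have "distinct (r[p := y])" using distinct_list_update[OF r(3)] yr by simp
    ultimately show ?thesis using T(2) by simp
  qed
  moreover have "r ! p \<notin> entries (r[p := y] # T)"
  proof -
    have "r ! p \<notin> set (r[p := y])"
    proof
      assume "r ! p \<in> set (r[p := y])"
      then obtain j where "j < length r" "r[p := y] ! j = r ! p" by (auto simp: in_set_conv_nth)
      then show False using r(3) p by (cases "j = p") (auto simp: nth_eq_iff_index_eq)
    qed
    moreover have "r ! p \<notin> entries T" using disj subU nth_mem[OF p(1)] by blast
    ultimately show ?thesis by simp
  qed
  ultimately show ?case using tab ins by blast
qed auto

section \<open>The Robinson--Schensted bijection\<close>

text \<open>Arbitrary entry sets are allowed because the insertion tableau of a prefix of a
  permutation contains just the letters read so far.\<close>

definition standard :: "nat set \<Rightarrow> tableau \<Rightarrow> bool" where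
  "standard A T \<longleftrightarrow> is_tableau T \<and> distinct (concat T) \<and> entries T = A"

section \<open>Adding and removing the largest entry of a recording tableau\<close>

lemma row_above_appendD: "row_above r (q @ [x]) \<Longrightarrow> row_above r q"
  unfolding row_above_def by (metis Suc_leD length_append_singleton less_SucI nth_append_left)

lemma sorted_lengths: "is_tableau T \<Longrightarrow> sorted_wrt (\<ge>) (map length T)"
proof (induction T)
  case (Cons r T)
  then show ?case by (cases T) (auto simp: row_above_def intro: order_trans)
qed simp

lemma set_append_to_row: "entries (append_to_row k x T) = insert x (entries T)"
  by (induction k T rule: corner.induct) auto

lemma distinct_append_to_row:
  "distinct (concat T) \<Longrightarrow> x \<notin> entries T \<Longrightarrow> distinct (concat (append_to_row k x T))"
proof (induction k T rule: corner.induct)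
  case (3 k r T)
  then show ?case using set_append_to_row[of k x T] by auto
qed auto

lemma corner_append_to_row: "is_tableau T \<Longrightarrow> k \<le> length T \<Longrightarrow> corner k (append_to_row k x T)"
proof (induction k T rule: corner.induct)
  case (1 k)
  then show ?case by simp
next
  case (2 r T)
  then show ?case by (auto simp: row_above_def)
qed auto

lemma row_above_append_to_row:
  assumes "row_above r (first_row T)" "length (first_row (append_to_row k x T)) \<le> length r"
    "\<forall>y\<in>set r. y < x"
  shows "row_above r (first_row (append_to_row k x T))"
proof -
  consider "first_row (append_to_row k x T) = first_row T"
    | "first_row (append_to_row k x T) = first_row T @ [x]"
    by (cases k; cases T) auto
  then show ?thesis
  proof cases
    case 2
    with assms show ?thesis by (auto simp: row_above_def nth_append less_Suc_eq)
  qed (use assms in simp)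
qed

text \<open>The appended letter exceeds all entries, so rows and columns stay increasing and only
  the shape could go wrong. Hence the assumption on row lengths, which \<open>RS_standard\<close>
  obtains from the insertion tableau of the same shape.\<close>

lemma is_tableau_append_to_row:
  assumes "is_tableau T" "\<forall>y\<in>entries T. y < x" "k \<le> length T"
    "sorted_wrt (\<ge>) (map length (append_to_row k x T))"
  shows "is_tableau (append_to_row k x T)"
  using assms
proof (induction k T rule: corner.induct)
  case (2 r T)
  then show ?case by (auto simp: row_above_append sorted_wrt_append)
next
  case (3 k r T)
  have "append_to_row k x T \<noteq> []" by (auto simp: append_to_row_def)
  then have "length (first_row (append_to_row k x T)) \<le> length r"
    using 3 by (cases "append_to_row k x T") auto
  with 3 show ?case by (auto intro: row_above_append_to_row)
qed auto

text \<open>The new letter marks the row it was added to, so the row index and the old tableau can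
  be read off. The bounds on \<open>k1\<close> and \<open>k2\<close> matter: every index beyond the
  length opens the same new row.\<close>

lemma append_to_row_inj:
  assumes "is_tableau T1" "x \<notin> entries T1" "k1 \<le> length T1"
    "is_tableau T2" "x \<notin> entries T2" "k2 \<le> length T2"
    "append_to_row k1 x T1 = append_to_row k2 x T2"
  shows "k1 = k2 \<and> T1 = T2"
  using assms
proof (induction k1 T1 arbitrary: k2 T2 rule: corner.induct)
  case (1 k)
  then show ?case by (cases T2; cases k2) auto
next
  case (2 r T)
  then show ?case by (cases T2; cases k2) auto
next
  case (3 k r T)
  show ?case
  proof (cases T2)
    case Nil
    then show ?thesis using 3 by auto
  next
    case (Cons r' T')
    then obtain k' where "k2 = Suc k'" using 3 by (cases k2) auto
    then show ?thesis using 3 Cons by auto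
  qed
qed

lemma map_length_append_to_row_cancel:
  assumes "is_tableau T" "k \<le> length T" "is_tableau U" "k \<le> length U"
    "map length (append_to_row k x T) = map length (append_to_row k y U)"
  shows "map length T = map length U"
  using assms
proof (induction k T arbitrary: U rule: corner.induct)
  case (1 k)
  then show ?case by (cases U; cases k) auto
next
  case (2 r T)
  then show ?case by (cases U) auto
next
  case (3 k r T)
  then show ?case by (cases U) auto
qed

text \<open>The largest entry sits at a corner: anything to its right or below it would be larger
  still. If it is alone in its row, that row is the last one and disappears with it.\<close>

lemma append_to_row_surj:
  assumes "is_tableau T" "distinct (concat T)" "x \<in> entries T" "\<forall>y\<in>entries T. y \<le> x"
  shows "\<exists>k U. T = append_to_row k x U \<and> is_tableau U \<and> k \<le> length U \<and> distinct (concat U) \<and>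
    x \<notin> entries U"
  using assms
proof (induction T)
  case (Cons r T)
  show ?case
  proof (cases "x \<in> set r")
    case True
    have "r \<noteq> []" using Cons.prems by simp
    then obtain s z where s: "r = s @ [z]" by (metis rev_exhaust)
    have "z = x"
    proof (rule ccontr)
      assume "z \<noteq> x"
      then have "x \<in> set s" using True s by auto
      then have "x < z" using Cons.prems(1) s by (auto simp: sorted_wrt_append)
      then show False using Cons.prems(4) s by auto
    qed
    have len: "length (first_row T) < length r"
    proof (rule ccontr)
      assume "\<not> length (first_row T) < length r"
      then have "length (first_row T) = length r" "r ! length s < first_row T ! length s"
        using Cons.prems(1) s by (auto simp: row_above_def)
      moreover from this have "first_row T ! length s \<in> set (first_row T)" using s by auto
      ultimately have "x < first_row T ! length s" "first_row T ! length s \<in> entries T"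
        using s \<open>z = x\<close> subsetD[OF set_first_row_subset[of T]] by (simp_all del: set_concat)
      moreover from this have "first_row T ! length s \<in> entries (r # T)" by simp
      then have "first_row T ! length s \<le> x" using Cons.prems(4) by blast
      ultimately show False by simp
    qed
    show ?thesis
    proof (cases "s = []")
      case True
      then have "T = []" using len s Cons.prems first_row_eq_Nil_iff[of T] by auto
      then show ?thesis using s \<open>z = x\<close> True by (intro exI[of _ 0] exI[of _ "[]"]) auto
    next
      case False
      have "row_above s (first_row T)"
        using Cons.prems(1) len s by (auto simp: row_above_def nth_append less_Suc_eq_le)
      then show ?thesis using Cons.prems s \<open>z = x\<close> False
        by (intro exI[of _ 0] exI[of _ "s # T"]) (auto simp: sorted_wrt_append)
    qed
  next
    case False
    then obtain k U where U: "T = append_to_row k x U" "is_tableau U" "k \<le> length U"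
      "distinct (concat U)" "x \<notin> entries U"
      using Cons by auto
    have "row_above r (first_row U)"
      using Cons.prems(1) U(1) by (cases k; cases U) (auto dest: row_above_appendD)
    moreover have "entries T = insert x (entries U)" using U(1) set_append_to_row by simp
    ultimately show ?thesis using U Cons.prems False
      by (intro exI[of _ "Suc k"] exI[of _ "r # U"]) auto
  qed
qed simp

section \<open>The correspondence for words with distinct letters\<close>

lemma RS_cong: "(\<And>i. i \<in> {1..n} \<Longrightarrow> \<sigma> i = \<tau> i) \<Longrightarrow> RS \<sigma> n = RS \<tau> n"
proof (induction n)
  case (Suc n)
  have "RS \<sigma> n = RS \<tau> n" using Suc by auto
  moreover have "\<sigma> (Suc n) = \<tau> (Suc n)" using Suc by auto
  ultimately show ?case by simp
qed simp

lemma RS_SucE: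
  obtains L R L' k where "RS \<sigma> n = (L, R)" "tableau_insert (\<sigma> (Suc n)) L = (L', k)"
    "RS \<sigma> (Suc n) = (L', append_to_row k (Suc n) R)"
proof -
  obtain L R where "RS \<sigma> n = (L, R)" by fastforce
  moreover obtain L' k where "tableau_insert (\<sigma> (Suc n)) L = (L', k)" by fastforce
  ultimately show ?thesis using that by simp
qed

lemma image_Suc_atLeastAtMost: "f ` {1..Suc n} = insert (f (Suc n)) (f ` {1..n})"
  by (simp add: atLeastAtMostSuc_conv)

lemma inj_on_Suc_notin: "inj_on f {1..Suc n} \<Longrightarrow> f (Suc n) \<notin> f ` {1..n}"
  by (simp add: atLeastAtMostSuc_conv)

lemma RS_standard:
  assumes "inj_on \<sigma> {1..n}" "RS \<sigma> n = (L, R)"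
  shows "standard (\<sigma> ` {1..n}) L \<and> standard {1..n} R \<and> map length L = map length R"
  using assms
proof (induction n arbitrary: L R)
  case 0
  then show ?case by (auto simp: standard_def)
next
  case (Suc n)
  obtain L0 R0 L' k where RS: "RS \<sigma> n = (L0, R0)" "tableau_insert (\<sigma> (Suc n)) L0 = (L', k)"
    "RS \<sigma> (Suc n) = (L', append_to_row k (Suc n) R0)"
    by (rule RS_SucE)
  have inj: "inj_on \<sigma> {1..n}" using Suc.prems(1) by (rule inj_on_subset) auto
  have IH: "standard (\<sigma> ` {1..n}) L0" "standard {1..n} R0" "map length L0 = map length R0"
    using Suc.IH[OF inj RS(1)] by auto
  have new: "\<sigma> (Suc n) \<notin> entries L0"
    using inj_on_Suc_notin[OF Suc.prems(1)] IH(1) by (simp add: standard_def)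
  have inv: "is_tableau L'" "mset (concat L') = add_mset (\<sigma> (Suc n)) (mset (concat L0))"
    "k \<le> length L0" "map length L' = map length (append_to_row k (Suc n) L0)"
    using tableau_insert_invariants[OF _ _ new RS(2)] IH(1) by (auto simp: standard_def)
  have set: "entries L' = insert (\<sigma> (Suc n)) (entries L0)"
    by (metis inv(2) set_mset_add_mset_insert set_mset_mset)
  have "distinct (concat (append_to_row k (\<sigma> (Suc n)) L0))"
    using distinct_append_to_row new IH(1) unfolding standard_def by blast
  have "distinct (\<sigma> (Suc n) # concat L0)" using new IH(1) by (auto simp: standard_def)
  then have "distinct (concat L')" by (metis inv(2) mset.simps(2) mset_eq_imp_distinct_iff)
  then have L': "standard (\<sigma> ` {1..Suc n}) L'"
    using inv set IH(1) unfolding standard_def image_Suc_atLeastAtMost by simp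
  have len: "map length (append_to_row k (Suc n) L0) = map length (append_to_row k (Suc n) R0)"
  proof -
    have "length L0 = length R0" using IH(3) by (metis length_map)
    moreover have "length (L0 ! i) = length (R0 ! i)" if "i < length L0" for i
      using IH(3) that by (metis length_map nth_map)
    ultimately show ?thesis using IH(3)
      by (auto simp: append_to_row_def map_update)
  qed
  have "is_tableau (append_to_row k (Suc n) R0)"
  proof (rule is_tableau_append_to_row)
    show "k \<le> length R0" using inv(3) IH(3) by (metis length_map)
    show "sorted_wrt (\<ge>) (map length (append_to_row k (Suc n) R0))"
      using sorted_lengths[OF inv(1)] inv(4) len by simp
  qed (use IH(2) in \<open>auto simp: standard_def\<close>)
  then have "standard {1..Suc n} (append_to_row k (Suc n) R0)"
    using IH(2) set_append_to_row[of k "Suc n" R0] distinct_append_to_row[of R0 "Suc n" k]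
    by (auto simp: standard_def)
  then show ?case using Suc.prems(2) RS(3) L' inv(4) len by simp
qed

text \<open>The place of the largest letter in the recording tableau gives the row of the last new
  box; with that row known, insertion of the last letter can be undone, and the rest follows by
  induction.\<close>

lemma RS_inj:
  assumes "inj_on \<sigma> {1..n}" "inj_on \<tau> {1..n}" "RS \<sigma> n = RS \<tau> n"
  shows "\<forall>i\<in>{1..n}. \<sigma> i = \<tau> i"
  using assms
proof (induction n)
  case (Suc n)
  obtain L R L' k where 1: "RS \<sigma> n = (L, R)" "tableau_insert (\<sigma> (Suc n)) L = (L', k)"
    "RS \<sigma> (Suc n) = (L', append_to_row k (Suc n) R)"
    by (rule RS_SucE)
  obtain L2 R2 L2' k2 where 2: "RS \<tau> n = (L2, R2)" "tableau_insert (\<tau> (Suc n)) L2 = (L2', k2)"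
    "RS \<tau> (Suc n) = (L2', append_to_row k2 (Suc n) R2)"
    by (rule RS_SucE)
  have inj: "inj_on \<sigma> {1..n}" "inj_on \<tau> {1..n}"
    by (rule inj_on_subset[OF Suc.prems(1)] inj_on_subset[OF Suc.prems(2)]; simp)+
  note st = RS_standard[OF inj(1) 1(1)] RS_standard[OF inj(2) 2(1)]
  have new: "\<sigma> (Suc n) \<notin> entries L" "\<tau> (Suc n) \<notin> entries L2"
    using inj_on_Suc_notin[OF Suc.prems(1)] inj_on_Suc_notin[OF Suc.prems(2)] st
    by (simp_all add: standard_def)
  have "k \<le> length L" "k2 \<le> length L2"
    using tableau_insert_invariants[OF _ _ new(1) 1(2)]
      tableau_insert_invariants[OF _ _ new(2) 2(2)] st
    by (auto simp: standard_def)
  then have "k \<le> length R" "k2 \<le> length R2" using st by (metis length_map)+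
  moreover have "append_to_row k (Suc n) R = append_to_row k2 (Suc n) R2"
    using 1(3) 2(3) Suc.prems(3) by (simp del: RS.simps)
  moreover have "is_tableau R" "Suc n \<notin> entries R" "is_tableau R2" "Suc n \<notin> entries R2"
    using st by (simp_all add: standard_def del: set_concat)
  ultimately have R: "k = k2 \<and> R = R2"
    using append_to_row_inj by blast
  moreover have "L' = L2'" using 1(3) 2(3) Suc.prems(3) by (simp del: RS.simps)
  ultimately have L: "L = L2 \<and> \<sigma> (Suc n) = \<tau> (Suc n)"
    using tableau_insert_inj[of L "\<sigma> (Suc n)" L2 "\<tau> (Suc n)" L' k] 1(2) 2(2) st new
    by (simp add: standard_def del: set_concat)
  then have "\<forall>i\<in>{1..n}. \<sigma> i = \<tau> i" using Suc.IH inj R 1 2 by simp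
  with L show ?case by (auto simp: atLeastAtMostSuc_conv)
qed simp

text \<open>The reverse algorithm: the largest recording letter marks a corner, reverse insertion
  there returns the last letter \<open>x\<close>, and both tableaux shrink alike. The letter set
  \<open>A\<close> has to vary in the induction, since it loses \<open>x\<close>.\<close>

lemma RS_surj:
  assumes "standard A L" "standard {1..n} R" "map length L = map length R"
  shows "\<exists>\<sigma>. inj_on \<sigma> {1..n} \<and> \<sigma> ` {1..n} = A \<and> RS \<sigma> n = (L, R)"
  using assms
proof (induction n arbitrary: A L R)
  case 0
  then have "R = []" by (cases R) (auto simp: standard_def)
  moreover from this have "L = []" using 0 by simp
  ultimately show ?case using 0(1) by (simp add: standard_def)
next
  case (Suc n)
  have "Suc n \<in> entries R" "\<forall>y\<in>entries R. y \<le> Suc n" "is_tableau R" "distinct (concat R)"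
    using Suc.prems(2) by (simp_all add: standard_def del: set_concat)
  then obtain k R0 where R0: "R = append_to_row k (Suc n) R0" "is_tableau R0" "k \<le> length R0"
    "distinct (concat R0)" "Suc n \<notin> entries R0"
    using append_to_row_surj by blast
  have "insert (Suc n) (entries R0) = {1..Suc n}"
    using Suc.prems(2) unfolding standard_def R0(1) set_append_to_row by blast
  then have "entries R0 = {1..Suc n} - {Suc n}" using R0(5) by (metis Diff_insert_absorb)
  moreover have "{1..Suc n} - {Suc n} = {1..n}" by auto
  ultimately have stR0: "standard {1..n} R0" using R0(2,4) by (simp add: standard_def del: set_concat)
  \<comment> \<open>\<open>L\<close> and \<open>R\<close> have the same row lengths, so the box
    freed in \<open>R\<close> is removable in \<open>L\<close> as well.\<close>
  have "corner k L"
    using corner_cong[OF Suc.prems(3)] corner_append_to_row[OF R0(2,3)] R0(1) by simp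
  then obtain L0 x where L0: "is_tableau L0" "distinct (concat L0)" "x \<notin> entries L0"
    "tableau_insert x L0 = (L, k)"
    using tableau_insert_surj[of L k] Suc.prems(1) unfolding standard_def by blast
  note inv = tableau_insert_invariants[OF L0]
  have "set_mset (mset (concat L)) = insert x (set_mset (mset (concat L0)))"
    using inv by simp
  then have A: "A = insert x (entries L0)"
    using Suc.prems(1) unfolding standard_def set_mset_mset by blast
  have "map length (append_to_row k x L0) = map length (append_to_row k (Suc n) R0)"
    using inv Suc.prems(3) R0(1) by simp
  then have len: "map length L0 = map length R0"
    using map_length_append_to_row_cancel inv L0(1) R0(2,3) by blast
  have "standard (entries L0) L0" using L0 by (simp add: standard_def)
  from Suc.IH[OF this stR0 len] obtain \<sigma> where \<sigma>: "inj_on \<sigma> {1..n}" "\<sigma> ` {1..n} = entries L0"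
    "RS \<sigma> n = (L0, R0)" by blast
  define \<tau> where "\<tau> = \<sigma>(Suc n := x)"
  have \<tau>: "\<tau> (Suc n) = x" "\<And>i. i \<in> {1..n} \<Longrightarrow> \<tau> i = \<sigma> i" by (simp_all add: \<tau>_def)
  have "RS \<tau> n = (L0, R0)" using RS_cong[of n \<tau> \<sigma>, OF \<tau>(2)] \<sigma>(3) by (rule trans)
  then have 1: "RS \<tau> (Suc n) = (L, R)" using L0(4) R0(1) \<tau>(1) by simp
  have im: "\<tau> ` {1..n} = entries L0"
    unfolding \<sigma>(2)[symmetric] by (rule image_cong[OF refl \<tau>(2)])
  then have 2: "\<tau> ` {1..Suc n} = A"
    unfolding image_Suc_atLeastAtMost \<tau>(1) A by (rule arg_cong)
  have "inj_on \<tau> {1..n}" using inj_on_cong[of "{1..n}" \<tau> \<sigma>, OF \<tau>(2)] \<sigma>(1) by (rule iffD2)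
  moreover have "\<tau> (Suc n) \<notin> \<tau> ` {1..n}" unfolding im \<tau>(1) by (rule L0(3))
  ultimately have "inj_on \<tau> (insert (Suc n) {1..n})"
    unfolding inj_on_insert by blast
  then have "inj_on \<tau> {1..Suc n}" by (simp add: atLeastAtMostSuc_conv)
  then show ?case using 1 2 by blast
qed

theorem RS_bij_betw:
  "bij_betw (\<lambda>\<sigma>. RS \<sigma> n) {\<sigma>. \<sigma> permutes {1..n}}
     {(L, R). standard {1..n} L \<and> standard {1..n} R \<and> map length L = map length R}"
proof (rule bij_betwI')
  fix \<sigma> \<tau> assume p: "\<sigma> \<in> {\<sigma>. \<sigma> permutes {1..n}}" "\<tau> \<in> {\<sigma>. \<sigma> permutes {1..n}}"
  show "RS \<sigma> n = RS \<tau> n \<longleftrightarrow> \<sigma> = \<tau>"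
  proof
    assume "RS \<sigma> n = RS \<tau> n"
    then have "\<sigma> i = \<tau> i" if "i \<in> {1..n}" for i
      using RS_inj p permutes_inj_on that by blast
    moreover have "\<sigma> i = \<tau> i" if "i \<notin> {1..n}" for i
      using p that by (simp add: permutes_not_in)
    ultimately show "\<sigma> = \<tau>" by blast
  qed simp
next
  fix \<sigma> assume "\<sigma> \<in> {\<sigma>. \<sigma> permutes {1..n}}"
  then show "RS \<sigma> n \<in> {(L, R). standard {1..n} L \<and> standard {1..n} R \<and> map length L = map length R}"
    using RS_standard[of \<sigma> n] by (cases "RS \<sigma> n") (auto simp: permutes_inj_on permutes_image)
next
  fix y assume "y \<in> {(L, R). standard {1..n} L \<and> standard {1..n} R \<and> map length L = map length R}"
  then obtain \<sigma> where \<sigma>: "inj_on \<sigma> {1..n}" "\<sigma> ` {1..n} = {1..n}" "RS \<sigma> n = y"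
    using RS_surj[of "{1..n}" "fst y" n "snd y"] by auto
  define \<tau> where "\<tau> i = (if i \<in> {1..n} then \<sigma> i else i)" for i
  have "bij_betw \<tau> {1..n} {1..n}"
    using \<sigma>(1,2) bij_betw_cong[of "{1..n}" \<tau> \<sigma>] by (auto simp: \<tau>_def bij_betw_def)
  then have "\<tau> permutes {1..n}" by (rule bij_imp_permutes) (auto simp: \<tau>_def)
  moreover have "RS \<tau> n = y" using RS_cong[of n \<tau> \<sigma>] \<sigma>(3) by (simp add: \<tau>_def)
  ultimately show "\<exists>\<sigma>\<in>{\<sigma>. \<sigma> permutes {1..n}}. y = RS \<sigma> n" by auto
qed

section \<open>Standard Young tableaux as functions on diagrams\<close>

lemma is_tableau_iff_nth:
  "is_tableau T \<longleftrightarrow> (\<forall>i<length T. T ! i \<noteq> [] \<and> sorted_wrt (<) (T ! i)) \<and>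
     (\<forall>i. Suc i < length T \<longrightarrow> row_above (T ! i) (T ! Suc i))"
proof (induction T)
  case (Cons r T)
  have "row_above r (first_row T) \<longleftrightarrow> (0 < length T \<longrightarrow> row_above r (T ! 0))"
    by (cases T) auto
  moreover have "(\<forall>i. Suc i < length (r # T) \<longrightarrow> row_above ((r # T) ! i) ((r # T) ! Suc i)) \<longleftrightarrow>
      (0 < length T \<longrightarrow> row_above r (T ! 0)) \<and>
      (\<forall>i. Suc i < length T \<longrightarrow> row_above (T ! i) (T ! Suc i))"
    by (cases T) (simp_all add: All_less_Suc2)
  ultimately show ?case using Cons by (simp add: All_less_Suc2) blast
qed simp

lemma shape_conv_Sigma: "shape T = (SIGMA i:{1..length T}. {1..length (T ! (i - 1))})"
  by (auto simp: shape_def)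

lemma card_shape: "card (shape T) = length (concat T)"
proof -
  have "card (shape T) = (\<Sum>i\<in>{1..length T}. length (T ! (i - 1)))"
    unfolding shape_conv_Sigma by simp
  also have "\<dots> = (\<Sum>i<length T. length (T ! i))"
    by (rule sum.reindex_bij_witness[of _ Suc "\<lambda>i. i - 1"]) auto
  also have "\<dots> = length (concat T)"
    by (simp add: length_concat sum_list_sum_nth atLeast0LessThan)
  finally show ?thesis .
qed

lemma entry_image_shape: "entry T ` shape T = entries T"
proof -
  have "entry T ` shape T \<subseteq> entries T"
  proof clarify
    fix i j assume "(i, j) \<in> shape T"
    then have "i - 1 < length T" "j - 1 < length (T ! (i - 1))" by (auto simp: shape_def)
    then show "entry T (i, j) \<in> entries T" by (auto simp: entry_def intro!: bexI[of _ "T ! (i - 1)"])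
  qed
  moreover have "x \<in> entry T ` shape T" if x: "x \<in> entries T" for x
  proof -
    obtain i j where ij: "i < length T" "j < length (T ! i)" "x = T ! i ! j"
      using x by (auto simp: in_set_conv_nth)
    then have "(Suc i, Suc j) \<in> shape T" "entry T (Suc i, Suc j) = x"
      by (auto simp: shape_def entry_def)
    then show ?thesis by blast
  qed
  ultimately show ?thesis by blast
qed

lemma bij_betw_entry: "distinct (concat T) \<Longrightarrow> bij_betw (entry T) (shape T) (entries T)"
  by (metis card_shape distinct_card entry_image_shape bij_betw_def eq_card_imp_inj_on
      finite_SigmaI finite_atLeastAtMost shape_conv_Sigma)

lemma shape_eq_iff:
  assumes "is_tableau T" "is_tableau U"
  shows "shape T = shape U \<longleftrightarrow> map length T = map length U"
proof
  assume eq: "shape T = shape U"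
  \<comment> \<open>Tableaux have no empty rows, so the first column of the shape counts all of
    them.\<close>
  have rows: "fst ` shape V = {1..length V}" if "is_tableau V" for V
  proof -
    have "i \<in> fst ` shape V" if "i \<in> {1..length V}" for i
    proof -
      have "V ! (i - 1) \<noteq> []" using that \<open>is_tableau V\<close> by (auto simp: is_tableau_iff_nth)
      then have "(i, 1) \<in> shape V" using that by (auto simp: shape_def Suc_le_eq)
      then show ?thesis by force
    qed
    then show ?thesis by (auto simp: shape_def)
  qed
  have "card (fst ` shape T) = length T" "card (fst ` shape U) = length U"
    unfolding rows[OF assms(1)] rows[OF assms(2)] by simp_all
  then have len: "length T = length U" using eq by simp
  have "length (T ! i) = length (U ! i)" if "i < length T" for i
  proof -
    have "{j. (Suc i, j) \<in> shape V} = {1..length (V ! i)}" if "i < length V" for V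
      using that by (auto simp: shape_def)
    then have "{1..length (T ! i)} = {1..length (U ! i)}" using eq that len by metis
    then show ?thesis by (metis card_atLeastAtMost diff_Suc_1)
  qed
  then show "map length T = map length U" using len by (simp add: list_eq_iff_nth_eq)
next
  assume eq: "map length T = map length U"
  then have "length T = length U" by (metis length_map)
  moreover have "length (T ! i) = length (U ! i)" if "i < length T" for i
    using eq that by (metis length_map nth_map)
  ultimately show "shape T = shape U" unfolding shape_conv_Sigma by (intro Sigma_cong) auto
qed

text \<open>Working form of a diagram: \<open>m\<close> is the number of non-empty rows, and row
  lengths are compared between any two rows instead of neighbours.\<close>

lemma young_diagramE:
  assumes "\<nu> \<in> young_diagrams"
  obtains p m where "\<nu> = {(i, j). 1 \<le> i \<and> 1 \<le> j \<and> j \<le> p i}"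
    "\<forall>i i'. 1 \<le> i \<longrightarrow> i \<le> i' \<longrightarrow> p i' \<le> p i" "\<forall>i\<ge>1. 0 < p i \<longleftrightarrow> i \<le> m"
proof -
  obtain p where p: "\<nu> = {(i, j). 1 \<le> i \<and> 1 \<le> j \<and> j \<le> p i}"
    "\<forall>i\<ge>1. p (Suc i) \<le> p i" "finite {i. 1 \<le> i \<and> p i \<noteq> 0}"
    using assms unfolding young_diagrams_def by blast
  have mono: "p i' \<le> p i" if "1 \<le> i" "i \<le> i'" for i i'
    using that(2) by (induction rule: dec_induct) (use p(2) that(1) in \<open>auto intro: le_trans\<close>)
  have "\<exists>m. p (Suc m) = 0"
  proof (rule ccontr)
    assume "\<nexists>m. p (Suc m) = 0"
    then have "range Suc \<subseteq> {i. 1 \<le> i \<and> p i \<noteq> 0}" by auto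
    then have "finite (range Suc)" using p(3) finite_subset by blast
    then show False using finite_imageD[of Suc UNIV] by simp
  qed
  define m where "m = (LEAST m. p (Suc m) = 0)"
  have "p (Suc m) = 0" unfolding m_def using \<open>\<exists>m. p (Suc m) = 0\<close> by (rule LeastI_ex)
  then have "0 < p i \<longleftrightarrow> i \<le> m" if "1 \<le> i" for i
    using mono[of "Suc m" i] that not_less_Least[of "i - 1" "\<lambda>m. p (Suc m) = 0"]
    by (cases "i \<le> m") (auto simp: m_def)
  with p(1) mono show ?thesis using that by blast
qed

lemma finite_young_diagram:
  assumes "\<nu> \<in> young_diagrams"
  shows "finite \<nu>"
proof -
  obtain p m where pm0: "\<nu> = {(i, j). 1 \<le> i \<and> 1 \<le> j \<and> j \<le> p i}"
    "\<forall>i i'. 1 \<le> i \<longrightarrow> i \<le> i' \<longrightarrow> p i' \<le> p i" "\<forall>i\<ge>1. 0 < p i \<longleftrightarrow> i \<le> m"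
    by (rule young_diagramE[OF assms])
  note pm = pm0(1) pm0(2,3)[rule_format]
  have "\<nu> \<subseteq> (SIGMA i:{1..m}. {1..p i})" using pm(3) by (fastforce simp: pm(1))
  then show ?thesis by (rule finite_subset) simp
qed

lemma young_diagram_down_closed:
  assumes "\<nu> \<in> young_diagrams" "(i, j) \<in> \<nu>" "1 \<le> i'" "i' \<le> i" "1 \<le> j'" "j' \<le> j"
  shows "(i', j') \<in> \<nu>"
proof -
  obtain p m where pm0: "\<nu> = {(i, j). 1 \<le> i \<and> 1 \<le> j \<and> j \<le> p i}"
    "\<forall>i i'. 1 \<le> i \<longrightarrow> i \<le> i' \<longrightarrow> p i' \<le> p i" "\<forall>i\<ge>1. 0 < p i \<longleftrightarrow> i \<le> m"
    by (rule young_diagramE[OF assms(1)])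
  note pm = pm0(1) pm0(2,3)[rule_format]
  then show ?thesis using assms(2-6) by (force intro: le_trans)
qed

lemma young_diagram_pos: "\<nu> \<in> young_diagrams \<Longrightarrow> (i, j) \<in> \<nu> \<Longrightarrow> 1 \<le> i \<and> 1 \<le> j"
  by (auto simp: young_diagrams_def)

lemma empty_young_diagram: "{} \<in> young_diagrams"
  unfolding young_diagrams_def by (intro CollectI exI[of _ "\<lambda>_. 0"]) auto

lemma nth_column_less:
  assumes "is_tableau T" "i < i'" "i' < length T" "j < length (T ! i')"
  shows "j < length (T ! i) \<and> T ! i ! j < T ! i' ! j"
  using assms(2,3,4)
proof (induction rule: strict_inc_induct)
  case (base i)
  then show ?case using assms(1) by (auto simp: is_tableau_iff_nth row_above_def)
next
  case (step i)
  then have "j < length (T ! Suc i)" "T ! Suc i ! j < T ! i' ! j" by auto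
  moreover have "row_above (T ! i) (T ! Suc i)"
    using step assms(1) by (auto simp: is_tableau_iff_nth)
  ultimately show ?case by (auto simp: row_above_def intro: less_trans)
qed

text \<open>Bridge between the lists of rows built by the algorithm and the extensional functions
  counted by \<open>skew_dim\<close>.\<close>

definition filling :: "tableau \<Rightarrow> box \<Rightarrow> nat" where
  "filling T = restrict (entry T) (shape T)"

lemma filling_in_standard_tableaux:
  assumes "standard {1..card (shape T)} T"
  shows "filling T \<in> standard_tableaux (shape T)"
proof -
  have T: "is_tableau T" "distinct (concat T)" "entries T = {1..card (shape T)}"
    using assms unfolding standard_def by blast+
  have "bij_betw (filling T) (shape T) {1..card (shape T)}"
    using bij_betw_entry[OF T(2)] T(3) bij_betw_cong[of "shape T" "filling T" "entry T"]
    by (simp add: filling_def)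
  moreover have "entry T (i, j) < entry T (i, j')"
    if "(i, j) \<in> shape T" "(i, j') \<in> shape T" "j < j'" for i j j'
  proof -
    have "sorted_wrt (<) (T ! (i - 1))" using T(1) that by (auto simp: is_tableau_iff_nth shape_def)
    then show ?thesis using that sorted_wrt_nth_less[of "(<)" "T ! (i - 1)" "j - 1" "j' - 1"]
      by (auto simp: entry_def shape_def)
  qed
  moreover have "entry T (i, j) < entry T (i', j)"
    if "(i, j) \<in> shape T" "(i', j) \<in> shape T" "i < i'" for i i' j
    using nth_column_less[OF T(1), of "i - 1" "i' - 1" "j - 1"] that
    by (auto simp: entry_def shape_def)
  ultimately show ?thesis by (auto simp: standard_tableaux_def filling_def)
qed

lemma standard_tableauxD:
  assumes "S \<in> standard_tableaux D"
  shows "bij_betw S D {1..card D}" "S \<in> extensional D"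
    "\<And>i j j'. (i, j) \<in> D \<Longrightarrow> (i, j') \<in> D \<Longrightarrow> j < j' \<Longrightarrow> S (i, j) < S (i, j')"
    "\<And>i i' j. (i, j) \<in> D \<Longrightarrow> (i', j) \<in> D \<Longrightarrow> i < i' \<Longrightarrow> S (i, j) < S (i', j)"
  using assms by (auto simp: standard_tableaux_def)

lemma filling_surj:
  assumes \<nu>: "\<nu> \<in> young_diagrams" and S: "S \<in> standard_tableaux \<nu>"
  shows "\<exists>T. standard {1..card \<nu>} T \<and> shape T = \<nu> \<and> filling T = S"
proof -
  obtain p m where pm0: "\<nu> = {(i, j). 1 \<le> i \<and> 1 \<le> j \<and> j \<le> p i}"
    "\<forall>i i'. 1 \<le> i \<longrightarrow> i \<le> i' \<longrightarrow> p i' \<le> p i" "\<forall>i\<ge>1. 0 < p i \<longleftrightarrow> i \<le> m"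
    by (rule young_diagramE[OF \<nu>])
  note pm = pm0(1) pm0(2,3)[rule_format]
  note S = standard_tableauxD[OF S]
  define T where "T = map (\<lambda>i. map (\<lambda>j. S (Suc i, Suc j)) [0..<p (Suc i)]) [0..<m]"
  have len: "length T = m" "\<And>i. i < m \<Longrightarrow> length (T ! i) = p (Suc i)"
    by (simp_all add: T_def)
  have nth: "T ! i ! j = S (Suc i, Suc j)" if "i < m" "j < p (Suc i)" for i j
    using that by (simp add: T_def)
  have shape: "shape T = \<nu>"
  proof -
    have "(i, j) \<in> shape T \<longleftrightarrow> (i, j) \<in> \<nu>" for i j
      using pm(3)[of i] len(2)[of "i - 1"] by (auto simp: shape_def len(1) pm(1))
    then show ?thesis by auto
  qed
  have fill: "filling T = S"
  proof (rule extensionalityI[of _ \<nu>])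
    fix b assume "b \<in> \<nu>"
    then obtain i j where b: "b = (i, j)" "1 \<le> i" "1 \<le> j" "j \<le> p i" by (auto simp: pm(1))
    then have "i \<le> m" using pm(3)[of i] by simp
    then show "filling T b = S b"
      using b \<open>b \<in> \<nu>\<close> nth[of "i - 1" "j - 1"] by (simp add: filling_def shape entry_def)
  qed (use S shape in \<open>auto simp: filling_def\<close>)
  have tab: "is_tableau T"
    unfolding is_tableau_iff_nth
  proof (intro conjI allI impI)
    fix i assume i: "i < length T"
    then show "T ! i \<noteq> []" using pm(3)[of "Suc i"] len by (metis Suc_le_eq le_add1 length_greater_0_conv plus_1_eq_Suc)
    show "sorted_wrt (<) (T ! i)"
      unfolding sorted_wrt_iff_nth_less
      using i len nth S(3)[of "Suc i"] by (auto simp: pm(1))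
  next
    fix i assume i: "Suc i < length T"
    then show "row_above (T ! i) (T ! Suc i)"
      using len nth S(4) pm(2)[of "Suc i" "Suc (Suc i)"] by (auto simp: row_above_def pm(1))
  qed
  have ent: "entries T = {1..card \<nu>}"
  proof -
    have "entries T = filling T ` \<nu>" unfolding entry_image_shape[symmetric] by (simp add: shape filling_def)
    then show ?thesis using S(1) fill by (simp add: bij_betw_def)
  qed
  have "distinct (concat T)"
    using card_shape[of T] ent shape by (intro card_distinct) simp
  then have "standard {1..card \<nu>} T" using tab ent by (simp add: standard_def)
  then show ?thesis using shape fill by blast
qed

lemma bij_betw_filling:
  assumes "\<nu> \<in> young_diagrams"
  shows "bij_betw filling {T. standard {1..card \<nu>} T \<and> shape T = \<nu>} (standard_tableaux \<nu>)"
proof (rule bij_betwI')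
  fix T U
  assume TU: "T \<in> {T. standard {1..card \<nu>} T \<and> shape T = \<nu>}"
    "U \<in> {T. standard {1..card \<nu>} T \<and> shape T = \<nu>}"
  show "filling T = filling U \<longleftrightarrow> T = U"
  proof
    assume eq: "filling T = filling U"
    have "is_tableau T" "is_tableau U" "shape T = shape U" using TU by (auto simp: standard_def)
    then have len: "map length T = map length U" using shape_eq_iff by blast
    show "T = U"
    proof (rule nth_equalityI)
      show l: "length T = length U" using len by (metis length_map)
      fix i assume i: "i < length T"
      have l': "length (T ! i) = length (U ! i)" using len i l by (metis nth_map)
      show "T ! i = U ! i"
      proof (rule nth_equalityI)
        fix j assume j: "j < length (T ! i)"
        have "(Suc i, Suc j) \<in> shape T" "(Suc i, Suc j) \<in> shape U"
          using i j l l' by (auto simp: shape_def)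
        then show "T ! i ! j = U ! i ! j"
          using fun_cong[OF eq, of "(Suc i, Suc j)"] by (simp add: filling_def entry_def)
      qed (rule l')
    qed
  qed simp
next
  fix T assume "T \<in> {T. standard {1..card \<nu>} T \<and> shape T = \<nu>}"
  then show "filling T \<in> standard_tableaux \<nu>" using filling_in_standard_tableaux by auto
next
  fix S assume "S \<in> standard_tableaux \<nu>"
  then show "\<exists>T\<in>{T. standard {1..card \<nu>} T \<and> shape T = \<nu>}. S = filling T"
    using filling_surj[OF assms] by blast
qed

lemma RS_shapes:
  assumes "\<sigma> permutes {1..n}" "RS \<sigma> n = (L, R)"
  shows "standard {1..n} L \<and> standard {1..n} R \<and> shape L = shape R \<and>
    card (shape L) = n \<and> shape L \<in> young_diagrams"
proof -
  have st: "standard {1..n} L" "standard {1..n} R" "map length L = map length R"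
    using RS_standard[OF permutes_inj_on[OF assms(1)] assms(2)] permutes_image[OF assms(1)] by simp_all
  then have tab: "is_tableau L" "is_tableau R" by (auto simp: standard_def)
  have "card (entries L) = length (concat L)" using st(1) unfolding standard_def by (metis distinct_card)
  then have "card (shape L) = n" using st(1) unfolding card_shape standard_def by simp
  moreover have "shape L \<in> young_diagrams"
  proof -
    define p where "p i = (if 1 \<le> i \<and> i \<le> length L then length (L ! (i - 1)) else 0)" for i
    have "p (Suc i) \<le> p i" if "1 \<le> i" for i
      using tab(1) that by (cases i) (auto simp: p_def is_tableau_iff_nth row_above_def)
    moreover have "finite {i. 1 \<le> i \<and> p i \<noteq> 0}"
      by (rule finite_subset[of _ "{1..length L}"]) (auto simp: p_def)
    moreover have "(i, j) \<in> shape L \<longleftrightarrow> 1 \<le> i \<and> 1 \<le> j \<and> j \<le> p i" for i j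
      by (cases "1 \<le> i \<and> i \<le> length L") (auto simp: shape_def p_def)
    then have "shape L = {(i, j). 1 \<le> i \<and> 1 \<le> j \<and> j \<le> p i}" by auto
    ultimately show ?thesis unfolding young_diagrams_def by blast
  qed
  ultimately show ?thesis using st shape_eq_iff[OF tab] by simp
qed

text \<open>Any two standard tableaux of the same shape occur as a pair, so conditions on the two
  can be imposed separately and the count factors. \<open>A\<close> and \<open>B\<close> will be the
  tableaux compatible with the two chains of diagrams.\<close>

theorem card_permutations_by_RS:
  assumes \<nu>: "\<nu> \<in> young_diagrams" and sub: "A \<subseteq> standard_tableaux \<nu>" "B \<subseteq> standard_tableaux \<nu>"
  shows "card {\<sigma>. \<sigma> permutes {1..card \<nu>} \<and> shape (fst (RS \<sigma> (card \<nu>))) = \<nu> \<and>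
      filling (fst (RS \<sigma> (card \<nu>))) \<in> A \<and> filling (snd (RS \<sigma> (card \<nu>))) \<in> B} = card A * card B"
proof -
  let ?n = "card \<nu>"
  let ?T = "\<lambda>C. {T. standard {1..?n} T \<and> shape T = \<nu> \<and> filling T \<in> C}"
  let ?P = "{\<sigma>. \<sigma> permutes {1..?n} \<and> shape (fst (RS \<sigma> ?n)) = \<nu> \<and>
      filling (fst (RS \<sigma> ?n)) \<in> A \<and> filling (snd (RS \<sigma> ?n)) \<in> B}"
  have card: "card (?T C) = card C" if "C \<subseteq> standard_tableaux \<nu>" for C
  proof -
    have "bij_betw filling (?T C) C"
    proof (rule bij_betw_subset[OF bij_betw_filling[OF \<nu>]])
      show "filling ` ?T C = C"
        using bij_betw_filling[OF \<nu>] that unfolding bij_betw_def by fast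
    qed blast
    then show ?thesis by (rule bij_betw_same_card)
  qed
  have "bij_betw (\<lambda>\<sigma>. RS \<sigma> ?n) ?P (?T A \<times> ?T B)"
  proof (rule bij_betw_subset[OF RS_bij_betw[of ?n]])
    show "(\<lambda>\<sigma>. RS \<sigma> ?n) ` ?P = ?T A \<times> ?T B"
    proof (intro set_eqI iffI)
      fix y assume "y \<in> (\<lambda>\<sigma>. RS \<sigma> ?n) ` ?P"
      then show "y \<in> ?T A \<times> ?T B"
        using RS_shapes[of _ ?n "fst y" "snd y"] by (auto simp: mem_Times_iff)
    next
      fix y assume y: "y \<in> ?T A \<times> ?T B"
      then have "y \<in> {(L, R). standard {1..?n} L \<and> standard {1..?n} R \<and> map length L = map length R}"
        using shape_eq_iff by (auto simp: standard_def)
      then obtain \<sigma> where "\<sigma> permutes {1..?n}" "y = RS \<sigma> ?n"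
        using RS_bij_betw[of ?n] by (auto simp: bij_betw_def)
      then show "y \<in> (\<lambda>\<sigma>. RS \<sigma> ?n) ` ?P" using y by auto
    qed
  qed auto
  then have "card ?P = card (?T A \<times> ?T B)" by (rule bij_betw_same_card)
  then show ?thesis using card sub by (simp add: card_cartesian_product)
qed

section \<open>Chains of diagrams\<close>

text \<open>A standard tableau builds up its shape box by box. Collected here are those that pass
  through every \<open>D i\<close>, necessarily at the moment when \<open>card (D i)\<close> boxes
  are present.\<close>

definition chain_tableaux :: "(nat \<Rightarrow> box set) \<Rightarrow> nat \<Rightarrow> (box \<Rightarrow> nat) set" where
  "chain_tableaux D n = {S \<in> standard_tableaux (D n). \<forall>i\<le>n. {b \<in> D n. S b \<le> card (D i)} = D i}"

lemma chain_mono: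
  assumes "\<And>i. i < n \<Longrightarrow> D i \<subseteq> (D (Suc i) :: 'a set)" "i \<le> j" "j \<le> n"
  shows "D i \<subseteq> D j"
  using assms(2,3) by (induction rule: dec_induct) (use assms(1) in \<open>auto simp: Suc_le_eq\<close>)

lemma standard_tableaux_empty: "standard_tableaux {} = {\<lambda>_. undefined}"
  by (auto simp: standard_tableaux_def bij_betw_def)

text \<open>A tableau through \<open>D n\<close> splits at the value \<open>c = card (D n)\<close>:
  the entries up to \<open>c\<close> fill \<open>D n\<close>, and the others, lowered by
  \<open>c\<close>, form a standard tableau of the skew shape \<open>D (Suc n) - D n\<close>. Any
  such pair can be glued, which gives one factor per step.\<close>

lemma card_chain_tableaux:
  assumes "D 0 = {}" "\<And>i. i \<le> n \<Longrightarrow> D i \<in> young_diagrams" "\<And>i. i < n \<Longrightarrow> D i \<subseteq> D (Suc i)"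
  shows "card (chain_tableaux D n) = (\<Prod>i<n. skew_dim (D (Suc i) - D i))"
  using assms(2,3)
proof (induction n)
  case 0
  have "chain_tableaux D 0 = {\<lambda>_. undefined}"
    by (auto simp: chain_tableaux_def assms(1) standard_tableaux_empty)
  then show ?case by simp
next
  case (Suc n)
  define A where "A = D n"
  define B where "B = D (Suc n)"
  define c where "c = card A"
  have AB: "A \<subseteq> B" "A \<in> young_diagrams" "B \<in> young_diagrams"
    using Suc.prems(2)[of n] Suc.prems(1)[of n] Suc.prems(1)[of "Suc n"] by (auto simp: A_def B_def)
  note fin = finite_young_diagram[OF AB(2)] finite_young_diagram[OF AB(3)]
  have card: "card (B - A) + c = card B" using fin AB(1)
    by (metis c_def card_mono card_Diff_subset le_add_diff_inverse2)
  have lower: "D i \<subseteq> A" "card (D i) \<le> c" if "i \<le> n" for i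
  proof -
    show "D i \<subseteq> A" unfolding A_def by (rule chain_mono[of n]) (use that Suc.prems(2) in auto)
    then show "card (D i) \<le> c" unfolding c_def by (rule card_mono[OF fin(1)])
  qed
  let ?\<phi> = "\<lambda>S. (restrict S A, \<lambda>b\<in>B - A. S b - c)"
  let ?\<psi> = "\<lambda>(S1, S2). \<lambda>b\<in>B. if b \<in> A then S1 b else S2 b + c"
  have up: "S b > c \<and> S b \<le> card B" if S: "S \<in> chain_tableaux D (Suc n)" and b: "b \<in> B - A" for S b
  proof -
    have "{b \<in> B. S b \<le> c} = A" using S by (auto simp: chain_tableaux_def A_def B_def c_def)
    moreover have "S b \<in> {1..card B}"
      using S b standard_tableauxD(1)[of S B] by (auto simp: chain_tableaux_def B_def bij_betw_def)
    ultimately show ?thesis using b by auto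
  qed
  have low: "S b \<le> c" if S: "S \<in> chain_tableaux D (Suc n)" and b: "b \<in> A" for S b
  proof -
    have "{b \<in> B. S b \<le> c} = A" using S by (auto simp: chain_tableaux_def A_def B_def c_def)
    then show ?thesis using b by auto
  qed
  have "bij_betw ?\<phi> (chain_tableaux D (Suc n)) (chain_tableaux D n \<times> standard_tableaux (B - A))"
  proof (rule bij_betw_byWitness[where f' = ?\<psi>])
    show "\<forall>S\<in>chain_tableaux D (Suc n). ?\<psi> (?\<phi> S) = S"
    proof
      fix S assume S: "S \<in> chain_tableaux D (Suc n)"
      then have "S \<in> extensional B" by (simp add: chain_tableaux_def standard_tableaux_def B_def)
      then show "?\<psi> (?\<phi> S) = S"
        using up[OF S] by (intro extensionalityI[of _ B]) (auto simp: less_imp_le)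
    qed
    show "\<forall>P\<in>chain_tableaux D n \<times> standard_tableaux (B - A). ?\<phi> (?\<psi> P) = P"
    proof
      fix P assume P: "P \<in> chain_tableaux D n \<times> standard_tableaux (B - A)"
      obtain S1 S2 where P': "P = (S1, S2)" by fastforce
      then have "S1 \<in> extensional A" "S2 \<in> extensional (B - A)"
        using P by (auto simp: chain_tableaux_def standard_tableaux_def A_def)
      moreover from this(1) have "restrict (?\<psi> P) A = S1"
        by (rule extensionalityI[rotated]) (use AB(1) P' in auto)
      moreover from calculation(2) have "(\<lambda>b\<in>B - A. ?\<psi> P b - c) = S2"
        by (rule extensionalityI[rotated]) (use AB(1) P' in auto)
      ultimately show "?\<phi> (?\<psi> P) = P" using P' by simp
    qed
    show "?\<phi> ` chain_tableaux D (Suc n) \<subseteq> chain_tableaux D n \<times> standard_tableaux (B - A)"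
    proof (rule image_subsetI)
      fix S assume S: "S \<in> chain_tableaux D (Suc n)"
      then have SB: "S \<in> standard_tableaux B"
        and levels: "\<And>i. i \<le> n \<Longrightarrow> {b \<in> B. S b \<le> card (D i)} = D i"
        by (auto simp: chain_tableaux_def B_def)
      note SB = standard_tableauxD[OF SB]
      have inj: "inj_on S B" using SB(1) by (simp add: bij_betw_def)
      have imA: "S ` A = {1..c}"
      proof (rule card_subset_eq)
        show "S ` A \<subseteq> {1..c}" using low[OF S] AB(1) bij_betwE[OF SB(1)] by fastforce
        show "card (S ` A) = card {1..c}"
          using inj AB(1) by (simp add: card_image inj_on_subset c_def)
      qed simp
      have bijA: "bij_betw (restrict S A) A {1..card A}"
        using imA inj AB(1) by (auto simp: bij_betw_def c_def inj_on_restrict_eq intro: inj_on_subset)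
      have "restrict S A \<in> standard_tableaux A"
        using bijA SB AB(1) by (auto simp: standard_tableaux_def subset_iff)
      moreover have "{b \<in> A. restrict S A b \<le> card (D i)} = D i" if "i \<le> n" for i
        using levels[OF that] lower[OF that] AB(1) by auto
      ultimately have 1: "restrict S A \<in> chain_tableaux D n" by (simp add: chain_tableaux_def A_def)
      have inj': "inj_on (\<lambda>b. S b - c) (B - A)"
      proof (rule inj_onI)
        fix b b' assume b: "b \<in> B - A" "b' \<in> B - A" "S b - c = S b' - c"
        have "S b = S b'" using b(3) up[OF S b(1)] up[OF S b(2)] by arith
        then show "b = b'" using inj b by (auto dest: inj_onD)
      qed
      have "(\<lambda>b. S b - c) ` (B - A) = {1..card (B - A)}"
      proof (rule card_subset_eq)
        show "(\<lambda>b. S b - c) ` (B - A) \<subseteq> {1..card (B - A)}"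
          using up[OF S] card by fastforce
        show "card ((\<lambda>b. S b - c) ` (B - A)) = card {1..card (B - A)}"
          using inj' by (simp add: card_image)
      qed simp
      then have "bij_betw (\<lambda>b\<in>B - A. S b - c) (B - A) {1..card (B - A)}"
        using inj' by (auto simp: bij_betw_def inj_on_restrict_eq)
      then have "(\<lambda>b\<in>B - A. S b - c) \<in> standard_tableaux (B - A)"
        using SB(3,4) up[OF S] by (auto simp: standard_tableaux_def intro!: diff_less_mono less_imp_le)
      with 1 show "?\<phi> S \<in> chain_tableaux D n \<times> standard_tableaux (B - A)" by simp
    qed
    show "?\<psi> ` (chain_tableaux D n \<times> standard_tableaux (B - A)) \<subseteq> chain_tableaux D (Suc n)"
    proof (rule image_subsetI)
      fix P assume "P \<in> chain_tableaux D n \<times> standard_tableaux (B - A)"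
      then obtain S1 S2 where P: "P = (S1, S2)" and S1: "S1 \<in> chain_tableaux D n"
        and S2: "S2 \<in> standard_tableaux (B - A)" by blast
      then have S1': "S1 \<in> standard_tableaux A"
        and levels: "\<And>i. i \<le> n \<Longrightarrow> {b \<in> A. S1 b \<le> card (D i)} = D i"
        by (auto simp: chain_tableaux_def A_def)
      note T1 = standard_tableauxD[OF S1'] and T2 = standard_tableauxD[OF S2]
      define S where "S = ?\<psi> (S1, S2)"
      have SA: "S b = S1 b" "1 \<le> S b" "S b \<le> c" if "b \<in> A" for b
        using that AB(1) T1(1) by (auto simp: S_def bij_betw_def c_def)
      have SBA: "S b = S2 b + c" "c < S b" "S b \<le> card B" if "b \<in> B - A" for b
      proof -
        show "S b = S2 b + c" using that by (auto simp: S_def)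
        moreover have "S2 b \<in> {1..card (B - A)}" using T2(1) that by (auto simp: bij_betw_def)
        ultimately show "c < S b" "S b \<le> card B" using card by auto
      qed
      \<comment> \<open>Gluing could only fail for a box outside \<open>A\<close> that precedes one
        inside, where a value above \<open>c\<close> would come before one at most \<open>c\<close>.
        The last premise excludes this; it holds along rows and columns because \<open>A\<close> is
        closed under moving left and up.\<close>
      have row: "S b < S b'" if "b \<in> B" "b' \<in> B"
        "b \<in> A \<Longrightarrow> b' \<in> A \<Longrightarrow> S1 b < S1 b'" "b \<in> B - A \<Longrightarrow> b' \<in> B - A \<Longrightarrow> S2 b < S2 b'"
        "b' \<in> A \<Longrightarrow> b \<in> A" for b b'
        using that SA[of b] SA[of b'] SBA[of b] SBA[of b']
        by (cases "b \<in> A"; cases "b' \<in> A") auto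
      have "inj_on S B"
      proof (rule inj_onI)
        fix b b' assume b: "b \<in> B" "b' \<in> B" "S b = S b'"
        show "b = b'"
        proof (cases "b \<in> A"; cases "b' \<in> A")
          assume "b \<in> A" "b' \<in> A"
          then show ?thesis using b SA T1(1) by (auto simp: bij_betw_def dest: inj_onD)
        next
          assume "b \<notin> A" "b' \<notin> A"
          then have "S2 b = S2 b'" "b \<in> B - A" "b' \<in> B - A" using b SBA[of b] SBA[of b'] by auto
          then show ?thesis using T2(1) by (auto simp: bij_betw_def dest: inj_onD)
        qed (use b SA[of b] SA[of b'] SBA[of b] SBA[of b'] in auto)
      qed
      moreover have "S ` B = {1..card B}"
      proof (rule card_subset_eq)
        show "S ` B \<subseteq> {1..card B}"
        proof clarify
          fix b assume "b \<in> B"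
          then show "S b \<in> {1..card B}" using SA[of b] SBA[of b] card by (cases "b \<in> A") auto
        qed
        show "card (S ` B) = card {1..card B}" using calculation by (simp add: card_image)
      qed simp
      ultimately have "bij_betw S B {1..card B}" by (simp add: bij_betw_def)
      moreover have "S (i, j) < S (i, j')" if "(i, j) \<in> B" "(i, j') \<in> B" "j < j'" for i j j'
      proof (rule row[OF that(1,2)])
        assume "(i, j') \<in> A"
        then show "(i, j) \<in> A"
          using young_diagram_down_closed[OF AB(2), of i j' i j] young_diagram_pos[OF AB(3) that(1)] that
          by simp
      qed (use T1 T2 that in auto)
      moreover have "S (i, j) < S (i', j)" if "(i, j) \<in> B" "(i', j) \<in> B" "i < i'" for i i' j
      proof (rule row[OF that(1,2)])
        assume "(i', j) \<in> A"
        then show "(i, j) \<in> A"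
          using young_diagram_down_closed[OF AB(2), of i' j i j] young_diagram_pos[OF AB(3) that(1)] that
          by simp
      qed (use T1 T2 that in auto)
      moreover have "S \<in> extensional B" by (simp add: S_def)
      ultimately have "S \<in> standard_tableaux B" by (auto simp: standard_tableaux_def)
      moreover have "{b \<in> B. S b \<le> card (D i)} = D i" if "i \<le> Suc n" for i
      proof (cases "i = Suc n")
        case True
        then show ?thesis using \<open>bij_betw S B {1..card B}\<close> by (auto simp: B_def[symmetric] bij_betw_def)
      next
        case False
        then have "i \<le> n" using that by simp
        have "b \<in> B \<and> S b \<le> card (D i) \<longleftrightarrow> b \<in> A \<and> S1 b \<le> card (D i)" for b
          using SA(1)[of b] SBA(2)[of b] lower(2)[OF \<open>i \<le> n\<close>] AB(1) by (cases "b \<in> A") auto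
        then have "{b \<in> B. S b \<le> card (D i)} = {b \<in> A. S1 b \<le> card (D i)}" by blast
        then show ?thesis using levels[OF \<open>i \<le> n\<close>] by simp
      qed
      ultimately have "S \<in> chain_tableaux D (Suc n)" by (simp add: chain_tableaux_def B_def)
      then show "?\<psi> P \<in> chain_tableaux D (Suc n)" by (simp add: S_def P)
    qed
  qed
  then have "card (chain_tableaux D (Suc n)) = card (chain_tableaux D n \<times> standard_tableaux (B - A))"
    by (rule bij_betw_same_card)
  also have "\<dots> = (\<Prod>i<n. skew_dim (D (Suc i) - D i)) * skew_dim (B - A)"
    using Suc.IH Suc.prems by (simp add: card_cartesian_product skew_dim_def)
  finally show ?case by (simp add: A_def B_def)
qed

section \<open>The permutation of a configuration\<close>

text \<open>The coordinate types are left open: the same construction describes configurations of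
  real points and placements of grid cells.\<close>

definition perm_graph :: "(nat \<Rightarrow> nat) \<Rightarrow> 'a list \<Rightarrow> 'b list \<Rightarrow> ('a \<times> 'b) set" where
  "perm_graph \<sigma> xs ys = (\<lambda>i. (xs ! (i - 1), ys ! (\<sigma> i - 1))) ` {1..length xs}"

lemma nth_image_atLeastAtMost: "(\<lambda>i. xs ! (i - 1)) ` {1..length xs} = set xs"
proof -
  have "x \<in> (\<lambda>i. xs ! (i - 1)) ` {1..length xs}" if x: "x \<in> set xs" for x
  proof -
    obtain i where "i < length xs" "xs ! i = x" using x by (auto simp: in_set_conv_nth)
    then show ?thesis by (intro image_eqI[of _ _ "Suc i"]) auto
  qed
  then show ?thesis by auto
qed

lemma fst_perm_graph: "fst ` perm_graph \<sigma> xs ys = set xs"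
  unfolding perm_graph_def image_image fst_conv by (rule nth_image_atLeastAtMost)

lemma snd_perm_graph:
  assumes "\<sigma> permutes {1..length ys}" "length xs = length ys"
  shows "snd ` perm_graph \<sigma> xs ys = set ys"
proof -
  have "snd ` perm_graph \<sigma> xs ys = (\<lambda>i. ys ! (i - 1)) ` \<sigma> ` {1..length ys}"
    unfolding perm_graph_def image_image snd_conv assms(2) by simp
  also have "\<sigma> ` {1..length ys} = {1..length ys}" by (rule permutes_image[OF assms(1)])
  finally show ?thesis by (simp only: nth_image_atLeastAtMost)
qed

lemma card_perm_graph:
  assumes "distinct xs"
  shows "card (perm_graph \<sigma> xs ys) = length xs"
proof (rule antisym)
  show "card (perm_graph \<sigma> xs ys) \<le> length xs"
    unfolding perm_graph_def by (rule card_image_le[THEN order_trans]) simp_all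
  have "card (fst ` perm_graph \<sigma> xs ys) = length xs"
    unfolding fst_perm_graph using assms by (rule distinct_card)
  moreover have "finite (perm_graph \<sigma> xs ys)" by (simp add: perm_graph_def)
  ultimately show "length xs \<le> card (perm_graph \<sigma> xs ys)" using card_image_le by metis
qed

text \<open>Relabelling coordinates leaves the permutation alone. This is how the permutation of a
  configuration is recognised in the cells that its points occupy.\<close>

lemma map_prod_perm_graph:
  assumes "\<sigma> permutes {1..length ys}" "length xs = length ys"
  shows "map_prod f g ` perm_graph \<sigma> xs ys = perm_graph \<sigma> (map f xs) (map g ys)"
proof -
  have "\<sigma> i \<in> {1..length ys}" if "i \<in> {1..length ys}" for i
    using permutes_in_image[OF assms(1)] that by blast
  then show ?thesis unfolding perm_graph_def image_image using assms(2)
    by (intro image_cong) (force simp: Suc_le_eq)+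
qed

lemma perm_graph_inj:
  assumes "\<sigma> permutes {1..length ys}" "\<tau> permutes {1..length ys}" "length xs = length ys"
    "distinct xs" "distinct ys" "perm_graph \<sigma> xs ys = perm_graph \<tau> xs ys"
  shows "\<sigma> = \<tau>"
proof
  fix i
  show "\<sigma> i = \<tau> i"
  proof (cases "i \<in> {1..length ys}")
    case True
    then have "(xs ! (i - 1), ys ! (\<sigma> i - 1)) \<in> perm_graph \<sigma> xs ys"
      unfolding perm_graph_def using assms(3) by (intro image_eqI[of _ _ i]) simp_all
    then have "(xs ! (i - 1), ys ! (\<sigma> i - 1)) \<in> perm_graph \<tau> xs ys" by (simp only: assms(6))
    then obtain j where "j \<in> {1..length xs}"
      "(xs ! (i - 1), ys ! (\<sigma> i - 1)) = (xs ! (j - 1), ys ! (\<tau> j - 1))"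
      unfolding perm_graph_def by (rule imageE)
    then have j: "j \<in> {1..length ys}" "xs ! (i - 1) = xs ! (j - 1)" "ys ! (\<sigma> i - 1) = ys ! (\<tau> j - 1)"
      using assms(3) by (simp_all only: prod.inject)
    have "i = j" using j True assms(3,4) by (auto simp: nth_eq_iff_index_eq)
    moreover have "\<sigma> i \<in> {1..length ys}" "\<tau> j \<in> {1..length ys}"
      using permutes_in_image[OF assms(1)] permutes_in_image[OF assms(2)] True j(1) by blast+
    then have "\<sigma> i = \<tau> j" using j(3) assms(5) by (auto simp: nth_eq_iff_index_eq)
    ultimately show ?thesis by simp
  next
    case False
    then show ?thesis using assms(1,2) by (simp add: permutes_not_in)
  qed
qed

lemma length_x_coords: "P \<in> configurations \<theta> \<Longrightarrow> length (x_coords P) = card P"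
  by (simp add: x_coords_def configurations_def card_image)

lemma length_y_coords: "P \<in> configurations \<theta> \<Longrightarrow> length (y_coords P) = card P"
  by (simp add: y_coords_def configurations_def card_image)

lemma coords_simps:
  assumes "P \<in> configurations \<theta>"
  shows "set (x_coords P) = fst ` P" "set (y_coords P) = snd ` P"
    "distinct (x_coords P)" "distinct (y_coords P)" "sorted_wrt (<) (x_coords P)" "sorted_wrt (<) (y_coords P)"
  using assms by (simp_all add: x_coords_def y_coords_def configurations_def)

lemma card_coords:
  assumes "P \<in> configurations \<theta>"
  shows "card {x \<in> fst ` P. x \<le> a} = card {z \<in> P. fst z \<le> a}"
    "card {y \<in> snd ` P. y \<le> a} = card {z \<in> P. snd z \<le> a}"
proof -
  have inj: "inj_on fst P" "inj_on snd P" using assms by (auto simp: configurations_def)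
  have "{x \<in> fst ` P. x \<le> a} = fst ` {z \<in> P. fst z \<le> a}" "{y \<in> snd ` P. y \<le> a} = snd ` {z \<in> P. snd z \<le> a}"
    by auto
  then show "card {x \<in> fst ` P. x \<le> a} = card {z \<in> P. fst z \<le> a}"
    "card {y \<in> snd ` P. y \<le> a} = card {z \<in> P. snd z \<le> a}"
    using inj_on_subset[OF inj(1)] inj_on_subset[OF inj(2)] by (simp_all add: card_image)
qed

text \<open>The rank of an abscissa is sent to the rank of the ordinate of the same point. This is
  injective because ordinates determine points, and then surjective by finiteness.\<close>

lemma ex_perm_graph:
  assumes P: "P \<in> configurations \<theta>"
  shows "\<exists>\<sigma>. \<sigma> permutes {1..card P} \<and> P = perm_graph \<sigma> (x_coords P) (y_coords P)"
proof -
  let ?k = "card P" and ?xs = "x_coords P" and ?ys = "y_coords P"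
  note len = length_x_coords[OF P] length_y_coords[OF P] and co = coords_simps[OF P]
  have inj: "inj_on snd P" "finite P" using P by (auto simp: configurations_def)
  have "\<exists>j\<in>{1..?k}. (?xs ! (i - 1), ?ys ! (j - 1)) \<in> P" if i: "i \<in> {1..?k}" for i
  proof -
    have "?xs ! (i - 1) \<in> fst ` P" unfolding co(1)[symmetric] using i len by (auto intro!: nth_mem)
    then obtain p where p: "p \<in> P" "?xs ! (i - 1) = fst p" by blast
    then have "snd p \<in> (\<lambda>j. ?ys ! (j - 1)) ` {1..?k}"
      using nth_image_atLeastAtMost[of ?ys] len co(2) by simp
    then obtain j where "j \<in> {1..?k}" "snd p = ?ys ! (j - 1)" by blast
    moreover from this p have "(?xs ! (i - 1), ?ys ! (j - 1)) = p" by (simp only: prod_eq_iff fst_conv snd_conv)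
    ultimately show ?thesis using p(1) by (intro bexI[of _ j]) simp_all
  qed
  then obtain \<sigma>0 where \<sigma>0: "\<And>i. i \<in> {1..?k} \<Longrightarrow> \<sigma>0 i \<in> {1..?k}"
    "\<And>i. i \<in> {1..?k} \<Longrightarrow> (?xs ! (i - 1), ?ys ! (\<sigma>0 i - 1)) \<in> P" by metis
  have "inj_on \<sigma>0 {1..?k}"
  proof (rule inj_onI)
    fix i i' assume i: "i \<in> {1..?k}" "i' \<in> {1..?k}" "\<sigma>0 i = \<sigma>0 i'"
    have "(?xs ! (i - 1), ?ys ! (\<sigma>0 i - 1)) = (?xs ! (i' - 1), ?ys ! (\<sigma>0 i' - 1))"
      using inj_onD[OF inj(1) _ \<sigma>0(2)[OF i(1)] \<sigma>0(2)[OF i(2)]] i(3) by simp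
    then show "i = i'" using i co(3) len by (auto simp: nth_eq_iff_index_eq)
  qed
  moreover have "\<sigma>0 ` {1..?k} = {1..?k}"
    by (rule endo_inj_surj) (use calculation \<sigma>0(1) in auto)
  ultimately have bij: "bij_betw \<sigma>0 {1..?k} {1..?k}" by (simp add: bij_betw_def)
  define \<sigma> where "\<sigma> i = (if i \<in> {1..?k} then \<sigma>0 i else i)" for i
  have "bij_betw \<sigma> {1..?k} {1..?k}"
    using bij by (rule bij_betw_cong[THEN iffD1, rotated]) (simp add: \<sigma>_def)
  then have "\<sigma> permutes {1..?k}" by (rule bij_imp_permutes) (auto simp: \<sigma>_def)
  moreover have "perm_graph \<sigma> ?xs ?ys = P"
  proof (rule card_subset_eq)
    show "perm_graph \<sigma> ?xs ?ys \<subseteq> P" using \<sigma>0(2) by (auto simp: perm_graph_def \<sigma>_def len)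
    show "card (perm_graph \<sigma> ?xs ?ys) = card P" using card_perm_graph[OF co(3)] len by simp
  qed (use inj in simp)
  ultimately show ?thesis by metis
qed

lemma config_perm_eq:
  assumes P: "P \<in> configurations \<theta>" and \<sigma>: "\<sigma> permutes {1..card P}"
    and graph: "P = perm_graph \<sigma> (x_coords P) (y_coords P)"
  shows "config_perm P = \<sigma>"
  unfolding config_perm_def
proof (rule the_equality)
  show "\<sigma> permutes {1..card P} \<and>
    P = (\<lambda>i. (x_coords P ! (i - 1), y_coords P ! (\<sigma> i - 1))) ` {1..card P}"
    using \<sigma> graph length_x_coords[OF P] by (simp add: perm_graph_def)
  fix \<tau> assume \<tau>: "\<tau> permutes {1..card P} \<and>
    P = (\<lambda>i. (x_coords P ! (i - 1), y_coords P ! (\<tau> i - 1))) ` {1..card P}"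
  have "perm_graph \<tau> (x_coords P) (y_coords P) = P"
    unfolding perm_graph_def length_x_coords[OF P] using \<tau> by blast
  then show "\<tau> = \<sigma>"
    using perm_graph_inj[of \<tau> "y_coords P" \<sigma> "x_coords P"] \<tau> \<sigma> graph length_x_coords[OF P]
      length_y_coords[OF P] coords_simps[OF P] by metis
qed

lemma config_perm_graph:
  assumes "P \<in> configurations \<theta>"
  shows "config_perm P permutes {1..card P}"
    "perm_graph (config_perm P) (x_coords P) (y_coords P) = P"
  using ex_perm_graph[OF assms] config_perm_eq[OF assms] by metis+

section \<open>Grids\<close>

text \<open>Consecutive cut points may coincide, since the extreme observation times may be
  \<open>-\<theta>\<close> and \<open>\<theta>\<close> themselves; the corresponding strips have
  width 0.\<close>

definition grid :: "real \<Rightarrow> (nat \<Rightarrow> real) \<Rightarrow> nat \<Rightarrow> bool" where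
  "grid \<theta> u K \<longleftrightarrow> 0 < K \<and> u 0 = 0 \<and> u K = \<theta> \<and> (\<forall>i<K. u i \<le> u (Suc i))"

text \<open>Cells are closed on the right, so that counting points in cells decides the events
  \<open>x \<le> u e\<close>; cell \<open>0\<close> also contains its left end.\<close>

definition cell_of :: "(nat \<Rightarrow> real) \<Rightarrow> real \<Rightarrow> nat" where
  "cell_of u x = (LEAST e. x \<le> u (Suc e))"

lemma grid_mono:
  assumes "grid \<theta> u K" "i \<le> j" "j \<le> K"
  shows "u i \<le> u j"
  using assms(2,3) by (induction rule: dec_induct) (use assms(1) in \<open>auto simp: grid_def Suc_le_eq intro: order_trans\<close>)

text \<open>The case \<open>e = 0\<close> must be excluded: the coordinate 0 satisfies
  \<open>x \<le> u 0\<close> but lies in cell 0.\<close>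

lemma cell_of_less_iff:
  assumes g: "grid \<theta> u K" and x: "x \<in> {0..\<theta>}" and e: "1 \<le> e" "e \<le> K"
  shows "cell_of u x < e \<longleftrightarrow> x \<le> u e"
proof
  assume "cell_of u x < e"
  moreover have "x \<le> u (Suc (K - 1))" using g x by (auto simp: grid_def)
  then have "x \<le> u (Suc (cell_of u x))" unfolding cell_of_def by (rule LeastI)
  ultimately show "x \<le> u e" using grid_mono[OF g, of "Suc (cell_of u x)" e] e by simp
next
  assume "x \<le> u e"
  then have "cell_of u x \<le> e - 1" unfolding cell_of_def using e by (intro Least_le) simp
  then show "cell_of u x < e" using e by simp
qed

lemma cell_of_less: "grid \<theta> u K \<Longrightarrow> x \<in> {0..\<theta>} \<Longrightarrow> cell_of u x < K"
  using cell_of_less_iff[of \<theta> u K x K] by (auto simp: grid_def Suc_le_eq)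

lemma cell_of_mono:
  assumes "grid \<theta> u K" "x \<in> {0..\<theta>}" "y \<in> {0..\<theta>}" "x \<le> y"
  shows "cell_of u x \<le> cell_of u y"
proof -
  have "cell_of u y < K" using assms cell_of_less by blast
  then have "y \<le> u (Suc (cell_of u y))"
    using cell_of_less_iff[OF assms(1,3), of "Suc (cell_of u y)"] by simp
  then show ?thesis using assms(4) unfolding cell_of_def[of u x] by (intro Least_le) simp
qed

lemma cell_eq:
  assumes g: "grid \<theta> u K" and e: "e < K"
  shows "{x \<in> {0..\<theta>}. cell_of u x = e} = (if e = 0 then {0..u 1} else {u e<..u (Suc e)})"
proof -
  have u: "0 \<le> u e" "u (Suc e) \<le> \<theta>"
    using grid_mono[OF g, of 0 e] grid_mono[OF g, of "Suc e" K] g e by (auto simp: grid_def)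
  have "cell_of u x = e \<longleftrightarrow> x \<le> u (Suc e) \<and> (e = 0 \<or> u e < x)" if x: "x \<in> {0..\<theta>}" for x
    using cell_of_less_iff[OF g x, of "Suc e"] cell_of_less_iff[OF g x, of e] e
    by (cases "e = 0") auto
  note iff = this
  show ?thesis
  proof (intro set_eqI)
    fix x
    show "x \<in> {x \<in> {0..\<theta>}. cell_of u x = e} \<longleftrightarrow> x \<in> (if e = 0 then {0..u 1} else {u e<..u (Suc e)})"
      using iff[of x] u by (cases "x \<in> {0..\<theta>}") (auto split: if_splits)
  qed
qed

lemma cell_in_borel: "grid \<theta> u K \<Longrightarrow> e < K \<Longrightarrow> {x \<in> {0..\<theta>}. cell_of u x = e} \<in> sets borel"
  unfolding cell_eq by simp

lemma emeasure_cell: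
  assumes "grid \<theta> u K" "e < K"
  shows "emeasure lborel {x \<in> {0..\<theta>}. cell_of u x = e} = ennreal (u (Suc e) - u e)"
proof -
  have "u e \<le> u (Suc e)" "u 0 = 0" using assms by (auto simp: grid_def)
  then show ?thesis unfolding cell_eq[OF assms] by (cases "e = 0") simp_all
qed

text \<open>Cells are fibres of the cell map, which makes them disjoint by construction.\<close>

definition box_cell :: "real \<Rightarrow> (nat \<Rightarrow> real) \<Rightarrow> (nat \<Rightarrow> real) \<Rightarrow> nat \<times> nat \<Rightarrow> (real \<times> real) set" where
  "box_cell \<theta> u v c = {p \<in> {0..\<theta>} \<times> {0..\<theta>}. map_prod (cell_of u) (cell_of v) p = c}"

lemma box_cell_eq:
  "box_cell \<theta> u v (e, f) = {x \<in> {0..\<theta>}. cell_of u x = e} \<times> {y \<in> {0..\<theta>}. cell_of v y = f}"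
  by (auto simp: box_cell_def)

lemma box_cell_measure:
  assumes "grid \<theta> u K" "grid \<theta> v L" "e < K" "f < L"
  shows "box_cell \<theta> u v (e, f) \<in> sets (rate_one_on_square \<theta>)"
    "measure (rate_one_on_square \<theta>) (box_cell \<theta> u v (e, f)) = (u (Suc e) - u e) * (v (Suc f) - v f)"
proof -
  let ?A = "{x \<in> {0..\<theta>}. cell_of u x = e}" and ?B = "{y \<in> {0..\<theta>}. cell_of v y = f}"
  have AB: "?A \<in> sets borel" "?B \<in> sets borel" using cell_in_borel assms by blast+
  have "{0..\<theta>} \<times> {0..\<theta>} \<in> sets (borel :: (real \<times> real) measure)"
    by (simp add: closed_Times borel_closed)
  then have sq: "{0..\<theta>} \<times> {0..\<theta>} \<inter> space lborel \<in> sets (lborel :: (real \<times> real) measure)" by simp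
  have "?A \<times> ?B \<in> sets (borel \<Otimes>\<^sub>M borel)" using AB by (rule pair_measureI)
  then have ABs: "?A \<times> ?B \<in> sets (lborel :: (real \<times> real) measure)" by (simp only: borel_prod sets_lborel)
  then show "box_cell \<theta> u v (e, f) \<in> sets (rate_one_on_square \<theta>)"
    unfolding box_cell_eq sets_restrict_space by (intro image_eqI[of _ _ "?A \<times> ?B"]) auto
  have nonneg: "0 \<le> u (Suc e) - u e" "0 \<le> v (Suc f) - v f" using assms by (auto simp: grid_def)
  have "emeasure lborel (?A \<times> ?B) = emeasure lborel ?A * emeasure lborel ?B"
    unfolding lborel_prod[symmetric] using AB by (intro lborel.emeasure_pair_measure_Times) simp_all
  also have "\<dots> = ennreal ((u (Suc e) - u e) * (v (Suc f) - v f))"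
    unfolding emeasure_cell[OF assms(1,3)] emeasure_cell[OF assms(2,4)]
    using nonneg by (simp add: ennreal_mult)
  finally have "measure lborel (?A \<times> ?B) = (u (Suc e) - u e) * (v (Suc f) - v f)"
    using nonneg by (simp add: measure_def)
  moreover have "measure (rate_one_on_square \<theta>) (?A \<times> ?B) = measure lborel (?A \<times> ?B)"
    by (rule measure_restrict_space[OF sq]) auto
  ultimately show "measure (rate_one_on_square \<theta>) (box_cell \<theta> u v (e, f)) =
      (u (Suc e) - u e) * (v (Suc f) - v f)"
    unfolding box_cell_eq by simp
qed

section \<open>Probability of an exact occupation pattern of the cells\<close>

lemma sum_grid: "grid \<theta> u K \<Longrightarrow> (\<Sum>e<K. u (Suc e) - u e) = \<theta>"
  by (simp add: sum_lessThan_telescope grid_def)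

text \<open>Trades a statement about the set of occupied cells for one about the counts in all
  cells, empty ones included, which is the form that Poisson independence can treat. Equality of
  cardinalities says that no cell is hit twice.\<close>

lemma map_prod_image_eq_iff:
  assumes "finite P" "finite C" "f ` P \<subseteq> S" "C \<subseteq> S" "finite S"
  shows "f ` P = C \<and> card P = card C \<longleftrightarrow>
    (\<forall>c\<in>S. card (P \<inter> {p. f p = c}) = (if c \<in> C then 1 else 0))"
proof
  assume *: "f ` P = C \<and> card P = card C"
  then have inj: "inj_on f P" using assms(1) by (intro eq_card_imp_inj_on) auto
  show "\<forall>c\<in>S. card (P \<inter> {p. f p = c}) = (if c \<in> C then 1 else 0)"
  proof
    fix c
    show "card (P \<inter> {p. f p = c}) = (if c \<in> C then 1 else 0)"
    proof (cases "c \<in> C")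
      case True
      then obtain p where p: "p \<in> P" "f p = c" using * by blast
      then have "P \<inter> {p. f p = c} = {p}" using inj by (auto dest: inj_onD)
      then show ?thesis using True by simp
    next
      case False
      then have "P \<inter> {p. f p = c} = {}" using * by blast
      then show ?thesis using False by simp
    qed
  qed
next
  assume *: "\<forall>c\<in>S. card (P \<inter> {p. f p = c}) = (if c \<in> C then 1 else 0)"
  have "f ` P = C"
  proof (intro set_eqI iffI)
    fix c assume "c \<in> f ` P"
    then have "P \<inter> {p. f p = c} \<noteq> {}" "c \<in> S" using assms(3) by auto
    then have "card (P \<inter> {p. f p = c}) \<noteq> 0" using assms(1) by simp
    then show "c \<in> C" using * \<open>c \<in> S\<close> by (metis (full_types))
  next
    fix c assume "c \<in> C"
    then have "card (P \<inter> {p. f p = c}) = 1" using * assms(4) by auto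
    then show "c \<in> f ` P" by (auto simp: card_1_singleton_iff)
  qed
  moreover have "card P = (\<Sum>c\<in>C. card (P \<inter> {p. f p = c}))"
  proof -
    have "P = (\<Union>c\<in>C. P \<inter> {p. f p = c})" using \<open>f ` P = C\<close> by auto
    then have "card P = card (\<Union>c\<in>C. P \<inter> {p. f p = c})" by simp
    also have "\<dots> = (\<Sum>c\<in>C. card (P \<inter> {p. f p = c}))"
      by (rule card_UN_disjoint) (use assms in auto)
    finally show ?thesis .
  qed
  moreover have "\<dots> = card C" using * assms(4) by (subst sum.cong[OF refl, where h = "\<lambda>_. 1"]) auto
  ultimately show "f ` P = C \<and> card P = card C" by simp
qed

text \<open>The pattern prescribes the count 0 or 1 in every cell of the grid. A cell of area
  \<open>w\<close> contributes \<open>exp (- w)\<close>, and these factors multiply to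
  \<open>exp (- (\<theta>\<^sup>2))\<close> because the cells fill the square; an occupied cell adds
  the factor \<open>w\<close>.\<close>

lemma prob_cells:
  assumes X: "poisson_point_process M (rate_one_on_square \<theta>) X"
    and u: "grid \<theta> u K" and v: "grid \<theta> v L" and C: "C \<subseteq> {..<K} \<times> {..<L}"
  defines "E \<equiv> {\<omega> \<in> space M. map_prod (cell_of u) (cell_of v) ` X \<omega> = C \<and> card (X \<omega>) = card C}"
  shows "E \<in> sets M"
    "measure M E = exp (- (\<theta>\<^sup>2)) *
       (\<Prod>c\<in>C. (u (Suc (fst c)) - u (fst c)) * (v (Suc (snd c)) - v (snd c)))"
proof -
  interpret poisson_point_process M "rate_one_on_square \<theta>" X by (rule X)
  let ?S = "{..<K} \<times> {..<L}" and ?f = "map_prod (cell_of u) (cell_of v)"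
  define w where "w c = (u (Suc (fst c)) - u (fst c)) * (v (Suc (snd c)) - v (snd c))" for c :: "nat \<times> nat"
  define k where "k c = (if c \<in> C then 1 else 0 :: nat)" for c
  have sub: "X \<omega> \<subseteq> {0..\<theta>} \<times> {0..\<theta>}" if "\<omega> \<in> space M" for \<omega>
    using points_in_space[OF that] by (simp add: space_restrict_space)
  have box: "box_cell \<theta> u v c \<in> sets (rate_one_on_square \<theta>)"
    "measure (rate_one_on_square \<theta>) (box_cell \<theta> u v c) = w c" if "c \<in> ?S" for c
    using box_cell_measure[OF u v] that by (auto simp: w_def)
  have fin: "finite C" using C by (rule finite_subset) simp
  define Ev where "Ev c = {\<omega> \<in> space M. card (X \<omega> \<inter> box_cell \<theta> u v c) = k c}" for c
  have Ev: "Ev c \<in> sets M" if "c \<in> ?S" for c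
    using measurable_sets[OF count_measurable[OF box(1)[OF that]], of "{k c}"]
    by (simp add: Ev_def vimage_def Int_def conj_commute)
  have "E = {\<omega> \<in> space M. \<forall>c\<in>?S. \<omega> \<in> Ev c}"
  proof -
    have "(?f ` X \<omega> = C \<and> card (X \<omega>) = card C) \<longleftrightarrow> (\<forall>c\<in>?S. \<omega> \<in> Ev c)" if \<omega>: "\<omega> \<in> space M" for \<omega>
    proof -
      have "?f ` X \<omega> \<subseteq> ?S"
      proof (rule image_subsetI)
        fix p assume "p \<in> X \<omega>"
        then have "fst p \<in> {0..\<theta>}" "snd p \<in> {0..\<theta>}" using sub[OF \<omega>] by (auto simp: mem_Times_iff)
        then show "?f p \<in> ?S"
          using cell_of_less[OF u] cell_of_less[OF v] by (cases p) simp
      qed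
      moreover have "X \<omega> \<inter> {p. ?f p = c} = X \<omega> \<inter> box_cell \<theta> u v c" for c
        using sub[OF \<omega>] by (auto simp: box_cell_def)
      ultimately show ?thesis
        using map_prod_image_eq_iff[OF finite_points[OF \<omega>] fin _ C, of ?f] \<omega>
        by (simp add: Ev_def k_def)
    qed
    note iff = this
    show ?thesis unfolding E_def by (rule Collect_cong, rule conj_cong[OF refl]) (erule iff)
  qed
  moreover have "?S \<noteq> {}" using u v by (auto simp: grid_def lessThan_empty_iff)
  ultimately have E: "E = (\<Inter>c\<in>?S. Ev c)" by (auto simp: Ev_def)
  show "E \<in> sets M" unfolding E by (rule sets.finite_INT) (use Ev \<open>?S \<noteq> {}\<close> in auto)
  \<comment> \<open>Independence is given for families indexed by an initial segment of the
    naturals, so the cells are enumerated.\<close>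
  obtain h where h: "bij_betw h {..<card ?S} ?S"
    using ex_bij_betw_nat_finite[of ?S] by (auto simp: atLeast0LessThan)
  have hS: "h i \<in> ?S" if "i < card ?S" for i using h that by (auto simp: bij_betw_def)
  have disj: "disjoint_family_on (\<lambda>i. box_cell \<theta> u v (h i)) {..<card ?S}"
    using h by (auto simp: disjoint_family_on_def box_cell_def bij_betw_def dest: inj_onD)
  have indep: "indep_vars (\<lambda>_. count_space UNIV) (\<lambda>i \<omega>. card (X \<omega> \<inter> box_cell \<theta> u v (h i))) {..<card ?S}"
    by (rule count_indep[OF box(1)[OF hS] disj])
  have ne: "{..<card ?S} \<noteq> {}" using \<open>?S \<noteq> {}\<close> by (simp add: lessThan_empty_iff)
  have Evh: "Ev (h i) = (\<lambda>\<omega>. card (X \<omega> \<inter> box_cell \<theta> u v (h i))) -` {k (h i)} \<inter> space M" for i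
    by (auto simp: Ev_def)
  have "E = (\<Inter>i\<in>{..<card ?S}. Ev (h i))"
    using bij_betw_imp_surj_on[OF h] unfolding E by (metis image_image)
  then have "prob E = (\<Prod>i\<in>{..<card ?S}. prob (Ev (h i)))"
    unfolding Evh using indep_varsD_finite[OF indep ne] by simp
  also have "\<dots> = (\<Prod>c\<in>?S. prob (Ev c))" by (rule prod.reindex_bij_betw[OF h])
  also have "\<dots> = (\<Prod>c\<in>?S. exp (- w c) * (if c \<in> C then w c else 1))"
    by (rule prod.cong[OF refl]) (auto simp: Ev_def count_poisson[OF box(1)] box(2) k_def)
  also have "\<dots> = exp (\<Sum>c\<in>?S. - w c) * (\<Prod>c\<in>?S. if c \<in> C then w c else 1)"
    by (simp add: prod.distrib exp_sum)
  also have "(\<Prod>c\<in>?S. if c \<in> C then w c else 1) = (\<Prod>c\<in>C. w c)"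
    using C by (subst prod.inter_restrict[symmetric]) (auto simp: Int_absorb1)
  also have "(\<Sum>c\<in>?S. - w c) = - (\<theta>\<^sup>2)"
  proof -
    have "(\<Sum>c\<in>?S. w c) = (\<Sum>e<K. u (Suc e) - u e) * (\<Sum>f<L. v (Suc f) - v f)"
      unfolding sum_product sum.cartesian_product by (rule sum.cong) (auto simp: w_def)
    then show ?thesis by (simp add: sum_grid[OF u] sum_grid[OF v] sum_negf power2_eq_square)
  qed
  finally show "measure M E = exp (- (\<theta>\<^sup>2)) *
       (\<Prod>c\<in>C. (u (Suc (fst c)) - u (fst c)) * (v (Suc (snd c)) - v (snd c)))"
    by (simp add: w_def)
qed

section \<open>Refining strips\<close>

text \<open>Linear interpolation between the cut points, with \<open>N\<close> steps per strip. At
  the right end of the grid \<open>c\<close> is evaluated one index too far, harmlessly: the factor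
  \<open>e mod N\<close> is 0 there.\<close>

definition refine :: "nat \<Rightarrow> (nat \<Rightarrow> real) \<Rightarrow> nat \<Rightarrow> real" where
  "refine N c e = c (e div N) + (c (Suc (e div N)) - c (e div N)) * real (e mod N) / real N"

lemma refine_mult: "0 < N \<Longrightarrow> refine N c (j * N) = c j"
  by (simp add: refine_def)

lemma refine_step:
  assumes "0 < N"
  shows "refine N c (Suc e) - refine N c e = (c (Suc (e div N)) - c (e div N)) / real N"
proof (cases "Suc (e mod N) = N")
  case True
  then have "Suc e div N = Suc (e div N)" "Suc e mod N = 0" by (simp_all add: div_Suc mod_Suc)
  moreover have "real (e mod N) = real N - 1" using True by linarith
  ultimately have "refine N c (Suc e) - refine N c e =
      c (Suc (e div N)) - (c (e div N) + (c (Suc (e div N)) - c (e div N)) * (real N - 1) / real N)"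
    by (simp only: refine_def)
  then show ?thesis using assms by (simp add: field_simps)
next
  case False
  then have "Suc e div N = e div N" "Suc e mod N = Suc (e mod N)"
    using assms by (simp_all add: div_Suc mod_Suc)
  then show ?thesis using assms by (simp add: refine_def field_simps)
qed

lemma grid_refine:
  assumes "grid \<theta> c q" "0 < N"
  shows "grid \<theta> (refine N c) (q * N)"
  unfolding grid_def
proof (intro conjI allI impI)
  show "refine N c 0 = 0" using refine_mult[OF assms(2), of c 0] assms(1) by (simp add: grid_def)
  show "refine N c (q * N) = \<theta>" using refine_mult[OF assms(2), of c q] assms(1) by (simp add: grid_def)
  fix e assume "e < q * N"
  then have "e div N < q" using assms(2) by (simp add: less_mult_imp_div_less)
  then have "0 \<le> c (Suc (e div N)) - c (e div N)" using assms(1) by (simp add: grid_def)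
  then have "0 \<le> refine N c (Suc e) - refine N c e" unfolding refine_step[OF assms(2)] by simp
  then show "refine N c e \<le> refine N c (Suc e)" by simp
qed (use assms in \<open>simp add: grid_def\<close>)

text \<open>Both points lie in one fine piece, whose width is that of a strip divided by
  \<open>N\<close>, and no strip is wider than \<theta>.\<close>

lemma refine_mesh:
  assumes g: "grid \<theta> c q" and N: "0 < N" and xy: "x \<in> {0..\<theta>}" "y \<in> {0..\<theta>}"
    and eq: "cell_of (refine N c) x = cell_of (refine N c) y"
  shows "\<bar>x - y\<bar> \<le> \<theta> / N"
proof -
  let ?u = "refine N c" and ?e = "cell_of (refine N c) x"
  note g' = grid_refine[OF g N]
  have e: "?e < q * N" using cell_of_less[OF g' xy(1)] .
  then have ed: "?e div N < q" using N by (simp add: less_mult_imp_div_less)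
  have "z \<in> {?u ?e..?u (Suc ?e)}" if "z \<in> {0..\<theta>}" "cell_of ?u z = ?e" for z
  proof -
    have "z \<in> {x \<in> {0..\<theta>}. cell_of ?u x = ?e}" using that by simp
    then show ?thesis using g' unfolding cell_eq[OF g' e] by (auto simp: grid_def split: if_splits)
  qed
  from this[OF xy(1) refl] this[OF xy(2) eq[symmetric]]
  have "\<bar>x - y\<bar> \<le> ?u (Suc ?e) - ?u ?e" by (simp add: abs_le_iff)
  also have "\<dots> \<le> \<theta> / N"
  proof -
    have "c (Suc (?e div N)) - c (?e div N) \<le> \<theta>"
      using grid_mono[OF g, of 0 "?e div N"] grid_mono[OF g, of "Suc (?e div N)" q] ed g
      by (simp add: grid_def)
    then show ?thesis unfolding refine_step[OF N] by (simp add: divide_right_mono)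
  qed
  finally show ?thesis .
qed

lemma eventually_inj_on_refine:
  assumes g: "grid \<theta> c q" and Z: "finite Z" "Z \<subseteq> {0..\<theta>}"
  shows "eventually (\<lambda>N. inj_on (cell_of (refine N c)) Z) sequentially"
proof -
  have *: "eventually (\<lambda>N. cell_of (refine N c) x = cell_of (refine N c) y \<longrightarrow> x = y) sequentially"
    if xy: "x \<in> Z" "y \<in> Z" for x y
  proof (cases "x = y")
    case False
    have "(\<lambda>N. \<theta> / real N) \<longlonglongrightarrow> 0" by (rule lim_const_over_n)
    then have "eventually (\<lambda>N. \<theta> / real N < \<bar>x - y\<bar>) sequentially"
      using False by (intro order_tendstoD) auto
    then show ?thesis using eventually_gt_at_top[of 0]
    proof eventually_elim
      case (elim N)
      then show ?case using refine_mesh[OF g, of N x y] xy Z(2) by force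
    qed
  qed simp
  have "eventually (\<lambda>N. \<forall>x\<in>Z. \<forall>y\<in>Z. cell_of (refine N c) x = cell_of (refine N c) y \<longrightarrow> x = y) sequentially"
    using * by (intro eventually_ball_finite ballI Z(1))
  then show ?thesis by (simp add: inj_on_def)
qed

text \<open>The possible sets of occupied fine rows or columns. The counts \<open>A j\<close> are
  cumulative, matching the events \<open>x \<le> c j\<close>; strip \<open>j\<close> itself receives
  \<open>A (Suc j) - A j\<close> indices.\<close>

definition index_sets :: "nat \<Rightarrow> (nat \<Rightarrow> nat) \<Rightarrow> nat \<Rightarrow> nat set set" where
  "index_sets N A q = {I. I \<subseteq> {..<q * N} \<and> (\<forall>j\<le>q. card (I \<inter> {..<j * N}) = A j)}"

lemma finite_index_sets: "finite (index_sets N A q)"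
  by (rule finite_subset[of _ "Pow {..<q * N}"]) (auto simp: index_sets_def)

text \<open>In the last strip any \<open>A (Suc q) - A q\<close> of the \<open>N\<close> pieces may
  be taken, whatever was chosen in the earlier strips.\<close>

lemma index_sets_Suc:
  assumes "A q \<le> A (Suc q)"
  shows "bij_betw (\<lambda>(I, I'). I \<union> I')
    (index_sets N A q \<times> {I'. I' \<subseteq> {q * N..<Suc q * N} \<and> card I' = A (Suc q) - A q})
    (index_sets N A (Suc q))"
proof (rule bij_betw_byWitness[where f' = "\<lambda>I. (I \<inter> {..<q * N}, I - {..<q * N})"])
  let ?T = "{I'. I' \<subseteq> {q * N..<Suc q * N} \<and> card I' = A (Suc q) - A q}"
  show "\<forall>P\<in>index_sets N A q \<times> ?T. (\<lambda>I. (I \<inter> {..<q * N}, I - {..<q * N})) ((\<lambda>(I, I'). I \<union> I') P) = P"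
    by (fastforce simp: index_sets_def)
  show "\<forall>I\<in>index_sets N A (Suc q). (\<lambda>(I, I'). I \<union> I') (I \<inter> {..<q * N}, I - {..<q * N}) = I"
    by auto
  show "(\<lambda>(I, I'). I \<union> I') ` (index_sets N A q \<times> ?T) \<subseteq> index_sets N A (Suc q)"
  proof (rule image_subsetI)
    fix P assume "P \<in> index_sets N A q \<times> ?T"
    then obtain I I' where P: "P = (I, I')" "I \<subseteq> {..<q * N}" "\<And>j. j \<le> q \<Longrightarrow> card (I \<inter> {..<j * N}) = A j"
      "I' \<subseteq> {q * N..<Suc q * N}" "card I' = A (Suc q) - A q"
      by (auto simp: index_sets_def)
    have fin: "finite I" "finite I'" using P(2,4) by (auto intro: finite_subset)
    have "card ((I \<union> I') \<inter> {..<j * N}) = A j" if "j \<le> Suc q" for j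
    proof (cases "j = Suc q")
      case True
      have "(I \<union> I') \<inter> {..<j * N} = I \<union> I'" using P(2,4) True by fastforce
      moreover have "I \<inter> I' = {}" using P(2,4) by fastforce
      moreover have "I \<inter> {..<q * N} = I" using P(2) by blast
      then have "card I = A q" using P(3)[of q] by simp
      ultimately show ?thesis using assms P(5) fin True by (simp add: card_Un_disjoint)
    next
      case False
      then have "j * N \<le> q * N" using that by simp
      then have "x \<notin> {..<j * N}" if "x \<in> {q * N..<Suc q * N}" for x
        using that unfolding atLeastLessThan_iff lessThan_iff by linarith
      then have "(I \<union> I') \<inter> {..<j * N} = I \<inter> {..<j * N}" using P(4) by blast
      then show ?thesis using P(3) False that by simp
    qed
    moreover have "I \<union> I' \<subseteq> {..<Suc q * N}" using P(2,4) by fastforce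
    ultimately show "(\<lambda>(I, I'). I \<union> I') P \<in> index_sets N A (Suc q)"
      using P(1) by (simp add: index_sets_def)
  qed
  show "(\<lambda>I. (I \<inter> {..<q * N}, I - {..<q * N})) ` index_sets N A (Suc q) \<subseteq> index_sets N A q \<times> ?T"
  proof (rule image_subsetI)
    fix I assume I: "I \<in> index_sets N A (Suc q)"
    then have sub: "I \<subseteq> {..<Suc q * N}" and count: "\<And>j. j \<le> Suc q \<Longrightarrow> card (I \<inter> {..<j * N}) = A j"
      by (simp_all add: index_sets_def)
    have "I \<inter> {..<Suc q * N} = I" using sub by blast
    then have "card I = A (Suc q)" using count[of "Suc q"] by simp
    moreover have "finite I" using sub by (rule finite_subset) simp
    ultimately have "card (I - {..<q * N}) = A (Suc q) - A q"
      using count[of q] by (simp add: card_Diff_subset_Int)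
    moreover have "I - {..<q * N} \<subseteq> {q * N..<Suc q * N}" using sub by auto
    moreover have "card (I \<inter> {..<q * N} \<inter> {..<j * N}) = A j" if "j \<le> q" for j
    proof -
      have "j * N \<le> q * N" using that by simp
      then have "{..<q * N} \<inter> {..<j * N} = {..<j * N}"
        by (simp only: Int_absorb1 lessThan_subset_iff)
      then show ?thesis using count[of j] that by (simp add: Int_assoc)
    qed
    ultimately show "(I \<inter> {..<q * N}, I - {..<q * N}) \<in> index_sets N A q \<times> ?T"
      by (simp add: index_sets_def)
  qed
qed

text \<open>The weight \<open>d (e div N)\<close> is constant on each strip, so a strip enters only
  through the number of choices in it, which is a binomial coefficient.\<close>

lemma sum_index_sets:
  fixes d :: "nat \<Rightarrow> real"
  assumes "0 < N" "A 0 = 0" "\<And>j. j < q \<Longrightarrow> A j \<le> A (Suc j)"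
  shows "(\<Sum>I\<in>index_sets N A q. \<Prod>e\<in>I. d (e div N)) =
    (\<Prod>j<q. real (N choose (A (Suc j) - A j)) * d j ^ (A (Suc j) - A j))"
  using assms(3)
proof (induction q)
  case 0
  have "index_sets N A 0 = {{}}" using assms(2) by (auto simp: index_sets_def)
  then show ?case by simp
next
  case (Suc q)
  let ?a = "A (Suc q) - A q"
  let ?T = "{I'. I' \<subseteq> {q * N..<Suc q * N} \<and> card I' = ?a}"
  have "(\<Sum>I\<in>index_sets N A (Suc q). \<Prod>e\<in>I. d (e div N)) =
      (\<Sum>P\<in>index_sets N A q \<times> ?T. \<Prod>e\<in>(\<lambda>(I, I'). I \<union> I') P. d (e div N))"
    using index_sets_Suc[of A q N] Suc.prems by (intro sum.reindex_bij_betw[symmetric]) simp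
  also have "\<dots> = (\<Sum>P\<in>index_sets N A q \<times> ?T. (\<Prod>e\<in>fst P. d (e div N)) * d q ^ ?a)"
  proof (rule sum.cong[OF refl])
    fix P assume "P \<in> index_sets N A q \<times> ?T"
    then obtain I I' where P: "P = (I, I')" "I \<subseteq> {..<q * N}" "I' \<subseteq> {q * N..<Suc q * N}" "card I' = ?a"
      by (auto simp: index_sets_def)
    have "finite I" "finite I'" using P(2,3) by (auto intro: finite_subset)
    moreover have "I \<inter> I' = {}" using P(2,3) by fastforce
    ultimately have "(\<Prod>e\<in>I \<union> I'. d (e div N)) = (\<Prod>e\<in>I. d (e div N)) * (\<Prod>e\<in>I'. d (e div N))"
      by (rule prod.union_disjoint)
    also have "(\<Prod>e\<in>I'. d (e div N)) = (\<Prod>e\<in>I'. d q)"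
    proof (rule prod.cong[OF refl])
      fix e assume "e \<in> I'"
      then have "q * N \<le> e" "e < Suc q * N" using P(3) by auto
      then have "e div N = q" by (intro div_nat_eqI) (simp_all add: mult.commute)
      then show "d (e div N) = d q" by simp
    qed
    finally show "(\<Prod>e\<in>(\<lambda>(I, I'). I \<union> I') P. d (e div N)) = (\<Prod>e\<in>fst P. d (e div N)) * d q ^ ?a"
      using P by simp
  qed
  also have "\<dots> = (\<Sum>I\<in>index_sets N A q. \<Sum>I'\<in>?T. (\<Prod>e\<in>I. d (e div N)) * d q ^ ?a)"
    unfolding sum.cartesian_product by (simp add: case_prod_beta)
  also have "\<dots> = (\<Sum>I\<in>index_sets N A q. \<Prod>e\<in>I. d (e div N)) * (real (card ?T) * d q ^ ?a)"
    unfolding sum_constant sum_distrib_right by (simp only: mult_ac)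
  also have "card ?T = N choose ?a" using n_subsets[of "{q * N..<Suc q * N}" ?a] by simp
  finally show ?case using Suc by simp
qed

lemma sum_Times_mult:
  fixes f :: "'a \<Rightarrow> 'c :: semiring_0"
  shows "(\<Sum>z\<in>S \<times> T. f (fst z) * g (snd z)) = sum f S * sum g T"
  unfolding sum_product sum.cartesian_product by (simp add: case_prod_beta)

text \<open>The numerator of the binomial has \<open>a\<close> factors \<open>N - i\<close>, and
  each \<open>(N - i) / N\<close> tends to 1. The factorials of the final formula arise
  here.\<close>

lemma binomial_over_power_tendsto:
  "(\<lambda>N. real (N choose a) * (x / real N) ^ a) \<longlonglongrightarrow> x ^ a / fact a"
proof -
  have "(\<lambda>N. (\<Prod>i<a. (1 - real i / real N) * x) / fact a) \<longlonglongrightarrow> (\<Prod>i<a. (1 - 0) * x) / fact a"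
    by (intro tendsto_intros lim_const_over_n) simp
  moreover have "eventually (\<lambda>N. (\<Prod>i<a. (1 - real i / real N) * x) / fact a =
      real (N choose a) * (x / real N) ^ a) sequentially"
    using eventually_gt_at_top[of 0]
  proof eventually_elim
    case (elim N)
    have "real (N choose a) = (\<Prod>i<a. real N - real i) / fact a"
      unfolding binomial_gbinomial gbinomial_prod_rev by (simp add: atLeast0LessThan)
    moreover have "(\<Prod>i<a. real N - real i) * (x / real N) ^ a = (\<Prod>i<a. (real N - real i) * (x / real N))"
      by (simp only: prod.distrib prod_constant card_lessThan)
    moreover have "(\<Prod>i<a. (real N - real i) * (x / real N)) = (\<Prod>i<a. (1 - real i / real N) * x)"
      using elim by (intro prod.cong) (simp_all add: field_simps)
    ultimately show ?case by simp
  qed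
  ultimately show ?thesis by (simp add: tendsto_cong)
qed

section \<open>Strip counts and ranks read off the occupied cells\<close>

lemma card_cells_below:
  assumes g: "grid \<theta> c q" and N: "0 < N" and Z: "finite Z" "Z \<subseteq> {0..\<theta>}"
    and inj: "inj_on (cell_of (refine N c)) Z" and j: "1 \<le> j" "j \<le> q"
  shows "card (cell_of (refine N c) ` Z \<inter> {..<j * N}) = card {x \<in> Z. x \<le> c j}"
proof -
  have "cell_of (refine N c) x < j * N \<longleftrightarrow> x \<le> c j" if "x \<in> Z" for x
    using cell_of_less_iff[OF grid_refine[OF g N], of x "j * N"] that Z(2) N j refine_mult[OF N, of c j]
    by (auto simp: Suc_le_eq)
  then have "cell_of (refine N c) ` Z \<inter> {..<j * N} = cell_of (refine N c) ` {x \<in> Z. x \<le> c j}" by auto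
  also have "card \<dots> = card {x \<in> Z. x \<le> c j}"
    by (rule card_image) (rule inj_on_subset[OF inj], blast)
  finally show ?thesis .
qed

text \<open>At \<open>j = 0\<close> the two kinds of count may differ: no cell has an index below 0,
  whereas a point with coordinate 0 satisfies \<open>x \<le> c 0\<close>. So the right side starts
  at 1, and \<open>A 0 = 0\<close> settles the left one.\<close>

lemma cells_in_index_sets_iff:
  assumes "grid \<theta> c q" "0 < N" "finite Z" "Z \<subseteq> {0..\<theta>}" "inj_on (cell_of (refine N c)) Z" "A 0 = 0"
  shows "cell_of (refine N c) ` Z \<in> index_sets N A q \<longleftrightarrow> (\<forall>j\<in>{1..q}. card {x \<in> Z. x \<le> c j} = A j)"
proof -
  have "cell_of (refine N c) ` Z \<subseteq> {..<q * N}"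
    using cell_of_less[OF grid_refine[OF assms(1,2)]] assms(4) by auto
  moreover have "(\<forall>j\<le>q. card (cell_of (refine N c) ` Z \<inter> {..<j * N}) = A j) \<longleftrightarrow>
      (\<forall>j\<in>{1..q}. card {x \<in> Z. x \<le> c j} = A j)" (is "?l \<longleftrightarrow> ?r")
  proof
    assume ?l
    then show ?r using card_cells_below[OF assms(1-5)] by auto
  next
    assume r: ?r
    show ?l
    proof (intro allI impI)
      fix j assume "j \<le> q"
      then show "card (cell_of (refine N c) ` Z \<inter> {..<j * N}) = A j"
        using r card_cells_below[OF assms(1-5), of j] assms(6) by (cases "j = 0") auto
    qed
  qed
  ultimately show ?thesis by (simp add: index_sets_def)
qed

text \<open>Strict order of coordinates becomes weak order of cells, and injectivity restores
  strictness, so ranks are preserved.\<close>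

lemma map_cell_of:
  assumes "grid \<theta> u K" "set xs \<subseteq> {0..\<theta>}" "sorted_wrt (<) xs" "inj_on (cell_of u) (set xs)"
  shows "map (cell_of u) xs = sorted_list_of_set (cell_of u ` set xs)"
proof -
  have "sorted (map (cell_of u) xs)"
    unfolding sorted_map
  proof (rule sorted_wrt_mono_rel[OF _ assms(3)])
    fix x y assume "x \<in> set xs" "y \<in> set xs" "x < y"
    then show "cell_of u x \<le> cell_of u y"
      using cell_of_mono[OF assms(1), of x y] subsetD[OF assms(2)] by simp
  qed
  moreover have "distinct xs" using assms(3) by (simp add: strict_sorted_iff)
  then have "distinct (map (cell_of u) xs)" using assms(4) by (simp add: distinct_map)
  ultimately show ?thesis using sorted_list_of_set.idem_if_sorted_distinct by force
qed

section \<open>The probability of a permutation with prescribed strip counts\<close>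

text \<open>\<open>c\<close> and \<open>A\<close> concern the abscissas, \<open>d\<close> and
  \<open>B\<close> the ordinates; \<open>A\<close> and \<open>B\<close> are cumulative counts. Both
  end in \<open>k\<close>, the total number of points, to match a permutation of
  \<open>{1..k}\<close>.\<close>

locale strip_event =
  fixes \<theta> :: real and \<sigma> :: "nat \<Rightarrow> nat" and k :: nat
    and c d :: "nat \<Rightarrow> real" and q p :: nat and A B :: "nat \<Rightarrow> nat"
  assumes c: "grid \<theta> c q" and d: "grid \<theta> d p"
    and A: "A 0 = 0" "\<And>j. j < q \<Longrightarrow> A j \<le> A (Suc j)" "A q = k"
    and B: "B 0 = 0" "\<And>j. j < p \<Longrightarrow> B j \<le> B (Suc j)" "B p = k"
    and \<sigma>: "\<sigma> permutes {1..k}"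
begin

definition event :: "(real \<times> real) set \<Rightarrow> bool" where
  "event P \<longleftrightarrow> P \<in> configurations \<theta> \<and> config_perm P = \<sigma> \<and>
     (\<forall>j\<in>{1..q}. card {z \<in> P. fst z \<le> c j} = A j) \<and> (\<forall>i\<in>{1..p}. card {z \<in> P. snd z \<le> d i} = B i)"

text \<open>Non-attacking rooks on the columns \<open>I\<close> and the rows \<open>J\<close>,
  arranged in the pattern of \<open>\<sigma>\<close>.\<close>

abbreviation rook :: "nat set \<Rightarrow> nat set \<Rightarrow> (nat \<times> nat) set" where
  "rook I J \<equiv> perm_graph \<sigma> (sorted_list_of_set I) (sorted_list_of_set J)"

abbreviation cells :: "nat \<Rightarrow> real \<times> real \<Rightarrow> nat \<times> nat" where
  "cells N \<equiv> map_prod (cell_of (refine N c)) (cell_of (refine N d))"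

lemma card_index: "I \<in> index_sets N A q \<Longrightarrow> card I = k" "J \<in> index_sets N B p \<Longrightarrow> card J = k"
  using A(3) B(3) by (force simp: index_sets_def Int_absorb2)+

lemma finite_index: "I \<in> index_sets N A' q' \<Longrightarrow> finite I"
  by (auto simp: index_sets_def intro: finite_subset)

lemma rook_facts:
  assumes "I \<in> index_sets N A q" "J \<in> index_sets N B p"
  shows "fst ` rook I J = I" "snd ` rook I J = J" "card (rook I J) = k" "finite (rook I J)"
    "inj_on fst (rook I J)" "inj_on snd (rook I J)"
proof -
  note fin = finite_index[OF assms(1)] finite_index[OF assms(2)] and card = card_index(1)[OF assms(1)] card_index(2)[OF assms(2)]
  show 1: "fst ` rook I J = I" using fin by (simp add: fst_perm_graph)
  show 2: "snd ` rook I J = J" using snd_perm_graph[of \<sigma> "sorted_list_of_set J" "sorted_list_of_set I"] fin card \<sigma> by simp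
  show 3: "card (rook I J) = k" using card_perm_graph[of "sorted_list_of_set I"] card by simp
  show 4: "finite (rook I J)" by (simp add: perm_graph_def)
  show "inj_on fst (rook I J)" by (rule eq_card_imp_inj_on) (use 1 3 4 card in simp_all)
  show "inj_on snd (rook I J)" by (rule eq_card_imp_inj_on) (use 2 3 4 card in simp_all)
qed

text \<open>As long as no two points share a row or a column of the grid, passing to cells preserves
  the order of the coordinates, so the occupied cells show the same permutation.\<close>

lemma cells_image:
  assumes P: "P \<in> configurations \<theta>" and N: "0 < N"
    and inj: "inj_on (cell_of (refine N c)) (fst ` P)" "inj_on (cell_of (refine N d)) (snd ` P)"
  shows "cells N ` P = perm_graph (config_perm P) (sorted_list_of_set (cell_of (refine N c) ` fst ` P))
    (sorted_list_of_set (cell_of (refine N d) ` snd ` P))"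
proof -
  have sub: "fst ` P \<subseteq> {0..\<theta>}" "snd ` P \<subseteq> {0..\<theta>}" using P by (auto simp: configurations_def)
  note len = length_x_coords[OF P] length_y_coords[OF P] and co = coords_simps[OF P]
  have "cells N ` P = cells N ` perm_graph (config_perm P) (x_coords P) (y_coords P)"
    by (simp only: config_perm_graph(2)[OF P])
  also have "\<dots> = perm_graph (config_perm P) (map (cell_of (refine N c)) (x_coords P))
      (map (cell_of (refine N d)) (y_coords P))"
    by (rule map_prod_perm_graph) (use config_perm_graph(1)[OF P] len in simp_all)
  also have "map (cell_of (refine N c)) (x_coords P) = sorted_list_of_set (cell_of (refine N c) ` fst ` P)"
    using map_cell_of[OF grid_refine[OF c N], of "x_coords P"] co sub inj by simp
  also have "map (cell_of (refine N d)) (y_coords P) = sorted_list_of_set (cell_of (refine N d) ` snd ` P)"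
    using map_cell_of[OF grid_refine[OF d N], of "y_coords P"] co sub inj by simp
  finally show ?thesis .
qed

text \<open>Points in distinct rows and columns of the grid have distinct coordinates, ranked like
  their cells. So seeing the pattern for a single \<open>N\<close> already decides the
  event.\<close>

lemma event_if_rook:
  assumes N: "0 < N" and P: "finite P" "P \<subseteq> {0..\<theta>} \<times> {0..\<theta>}" "card P = k"
    and I: "I \<in> index_sets N A q" and J: "J \<in> index_sets N B p" and eq: "cells N ` P = rook I J"
  shows "event P"
proof -
  note r = rook_facts[OF I J]
  have im: "cell_of (refine N c) ` fst ` P = I" "cell_of (refine N d) ` snd ` P = J"
    using arg_cong[OF eq, of "image fst"] arg_cong[OF eq, of "image snd"] r(1,2)
    by (simp_all add: image_image)
  have cardI: "card I = k" "card J = k" using card_index I J by blast+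
  \<comment> \<open>Each projection of \<open>P\<close> is squeezed between \<open>k\<close>
    occupied rows or columns and \<open>k\<close> points, which forces all maps involved to be
    injective.\<close>
  have le: "card (f ` P) \<le> k" for f :: "real \<times> real \<Rightarrow> real" using card_image_le[OF P(1)] P(3) by metis
  have le': "k \<le> card (fst ` P)" "k \<le> card (snd ` P)"
    using card_image_le[of "fst ` P" "cell_of (refine N c)"] card_image_le[of "snd ` P" "cell_of (refine N d)"]
      P(1) im cardI by simp_all
  have "card (fst ` P) = k" "card (snd ` P) = k" using le[of fst] le[of snd] le' by simp_all
  then have inj: "inj_on fst P" "inj_on snd P" "inj_on (cell_of (refine N c)) (fst ` P)"
    "inj_on (cell_of (refine N d)) (snd ` P)"
    using P(1,3) im cardI by (auto intro!: eq_card_imp_inj_on)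
  then have conf: "P \<in> configurations \<theta>" using P by (simp add: configurations_def)
  have sub: "fst ` P \<subseteq> {0..\<theta>}" "snd ` P \<subseteq> {0..\<theta>}" using P(2) by auto
  have "perm_graph (config_perm P) (sorted_list_of_set I) (sorted_list_of_set J) = rook I J"
    using cells_image[OF conf N inj(3,4)] eq im by simp
  then have "config_perm P = \<sigma>"
    using perm_graph_inj[of "config_perm P" "sorted_list_of_set J" \<sigma> "sorted_list_of_set I"]
      config_perm_graph(1)[OF conf] \<sigma> cardI P(3) by simp
  moreover have "\<forall>j\<in>{1..q}. card {x \<in> fst ` P. x \<le> c j} = A j"
    using cells_in_index_sets_iff[OF c N finite_imageI[OF P(1)] sub(1) inj(3), where A = A] A(1) I im by simp
  moreover have "\<forall>j\<in>{1..p}. card {x \<in> snd ` P. x \<le> d j} = B j"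
    using cells_in_index_sets_iff[OF d N finite_imageI[OF P(1)] sub(2) inj(4), where A = B] B(1) J im by simp
  ultimately show ?thesis using conf by (simp add: event_def card_coords)
qed

text \<open>Separation of the coordinates by the grid is assumed here; in \<open>prob_event\<close>
  it holds for all large \<open>N\<close>. The number of points comes from the last strip condition,
  since \<open>c q = \<theta>\<close>.\<close>

lemma rook_if_event:
  assumes N: "0 < N" and P: "event P"
    and inj: "inj_on (cell_of (refine N c)) (fst ` P)" "inj_on (cell_of (refine N d)) (snd ` P)"
  shows "card P = k" "\<exists>I\<in>index_sets N A q. \<exists>J\<in>index_sets N B p. cells N ` P = rook I J"
proof -
  have conf: "P \<in> configurations \<theta>" and \<sigma>P: "config_perm P = \<sigma>" using P by (auto simp: event_def)
  then have sub: "fst ` P \<subseteq> {0..\<theta>}" "snd ` P \<subseteq> {0..\<theta>}" and fin: "finite P"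
    by (auto simp: configurations_def)
  have "{z \<in> P. fst z \<le> c q} = P" using sub c by (auto simp: grid_def)
  moreover have "q \<in> {1..q}" using c by (auto simp: grid_def)
  then have "card {z \<in> P. fst z \<le> c q} = A q" using P unfolding event_def by blast
  ultimately show "card P = k" using A(3) by simp
  have "cell_of (refine N c) ` fst ` P \<in> index_sets N A q"
    using cells_in_index_sets_iff[OF c N finite_imageI[OF fin] sub(1) inj(1), where A = A] A(1) P conf
    by (simp add: event_def card_coords)
  moreover have "cell_of (refine N d) ` snd ` P \<in> index_sets N B p"
    using cells_in_index_sets_iff[OF d N finite_imageI[OF fin] sub(2) inj(2), where A = B] B(1) P conf
    by (simp add: event_def card_coords)
  moreover note cells_image[OF conf N inj, unfolded \<sigma>P]
  ultimately show "\<exists>I\<in>index_sets N A q. \<exists>J\<in>index_sets N B p. cells N ` P = rook I J" by blast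
qed

definition volume :: real where
  "volume = exp (- (\<theta>\<^sup>2)) *
     (\<Prod>j<q. (c (Suc j) - c j) ^ (A (Suc j) - A j) / fact (A (Suc j) - A j)) *
     (\<Prod>i<p. (d (Suc i) - d i) ^ (B (Suc i) - B i) / fact (B (Suc i) - B i))"

text \<open>\<open>G N\<close> is the event that the pattern is visible with \<open>N\<close> pieces
  per strip. It lies inside the event for every \<open>N > 0\<close>, and each outcome of the event
  is in \<open>G N\<close> for all large \<open>N\<close>. Hence the event is the union of the
  \<open>G N\<close>, therefore measurable, and the indicators converge pointwise.\<close>

theorem prob_event:
  assumes X: "poisson_point_process M (rate_one_on_square \<theta>) X"
  shows "{\<omega> \<in> space M. event (X \<omega>)} \<in> sets M" "measure M {\<omega> \<in> space M. event (X \<omega>)} = volume"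
proof -
  interpret poisson_point_process M "rate_one_on_square \<theta>" X by (rule X)
  let ?E = "{\<omega> \<in> space M. event (X \<omega>)}"
  let ?S = "\<lambda>N. index_sets N A q \<times> index_sets N B p"
  define F where "F N IJ = {\<omega> \<in> space M. cells N ` X \<omega> = rook (fst IJ) (snd IJ) \<and> card (X \<omega>) = k}" for N IJ
  define G where "G N = (\<Union>IJ\<in>?S N. F N IJ)" for N
  define \<delta> where "\<delta> N j = (c (Suc j) - c j) / real N" for N j
  define \<epsilon> where "\<epsilon> N j = (d (Suc j) - d j) / real N" for N j
  have sub: "X \<omega> \<subseteq> {0..\<theta>} \<times> {0..\<theta>}" if "\<omega> \<in> space M" for \<omega>
    using points_in_space[OF that] by (simp add: space_restrict_space)
  have F: "F N IJ \<in> sets M \<and> prob (F N IJ) = exp (- (\<theta>\<^sup>2)) *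
      ((\<Prod>e\<in>fst IJ. \<delta> N (e div N)) * (\<Prod>e\<in>snd IJ. \<epsilon> N (e div N)))"
    if N: "0 < N" and IJ: "IJ \<in> ?S N" for N IJ
  proof -
    obtain I J where IJ': "IJ = (I, J)" "I \<in> index_sets N A q" "J \<in> index_sets N B p" using IJ by auto
    note r = rook_facts[OF IJ'(2,3)]
    have subC: "rook I J \<subseteq> {..<q * N} \<times> {..<p * N}"
    proof
      fix z assume "z \<in> rook I J"
      then have "fst z \<in> I" "snd z \<in> J" using r(1,2) by blast+
      then show "z \<in> {..<q * N} \<times> {..<p * N}" using IJ'(2,3) by (auto simp: index_sets_def mem_Times_iff)
    qed
    note pc = prob_cells[OF X grid_refine[OF c N] grid_refine[OF d N] subC]
    have "(\<Prod>z\<in>rook I J. \<delta> N (fst z div N) * \<epsilon> N (snd z div N)) =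
        (\<Prod>e\<in>I. \<delta> N (e div N)) * (\<Prod>e\<in>J. \<epsilon> N (e div N))"
      using prod.reindex[OF r(5), of "\<lambda>e. \<delta> N (e div N)"] prod.reindex[OF r(6), of "\<lambda>e. \<epsilon> N (e div N)"] r(1,2)
      by (simp add: prod.distrib)
    then show ?thesis using pc by (simp add: F_def IJ'(1) r(3) refine_step[OF N] \<delta>_def \<epsilon>_def)
  qed
  have G: "G N \<in> sets M \<and> prob (G N) = exp (- (\<theta>\<^sup>2)) *
      ((\<Prod>j<q. real (N choose (A (Suc j) - A j)) * ((c (Suc j) - c j) / real N) ^ (A (Suc j) - A j)) *
       (\<Prod>i<p. real (N choose (B (Suc i) - B i)) * ((d (Suc i) - d i) / real N) ^ (B (Suc i) - B i)))"
    if N: "0 < N" for N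
  proof -
    have fin: "finite (?S N)" by (simp add: finite_index_sets)
    \<comment> \<open>A rook placement determines \<open>I\<close> and \<open>J\<close> as its two
      projections, so different index pairs exclude each other.\<close>
    have disj: "disjoint_family_on (F N) (?S N)"
    proof (unfold disjoint_family_on_def, intro ballI impI)
      fix IJ IJ' assume IJ: "IJ \<in> ?S N" "IJ' \<in> ?S N" "IJ \<noteq> IJ'"
      have "rook (fst IJ) (snd IJ) \<noteq> rook (fst IJ') (snd IJ')"
      proof
        assume eq: "rook (fst IJ) (snd IJ) = rook (fst IJ') (snd IJ')"
        have "fst IJ = fst IJ'" "snd IJ = snd IJ'"
          using rook_facts(1,2)[of "fst IJ" N "snd IJ"] rook_facts(1,2)[of "fst IJ'" N "snd IJ'"] IJ(1,2) eq
          by (metis mem_Times_iff)+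
        then show False using IJ(3) by (simp add: prod_eq_iff)
      qed
      then show "F N IJ \<inter> F N IJ' = {}" by (auto simp: F_def)
    qed
    have "prob (G N) = (\<Sum>IJ\<in>?S N. prob (F N IJ))"
      unfolding G_def using F[OF N] by (intro finite_measure_finite_Union fin disj) auto
    also have "\<dots> = (\<Sum>IJ\<in>?S N. exp (- (\<theta>\<^sup>2)) *
        ((\<Prod>e\<in>fst IJ. \<delta> N (e div N)) * (\<Prod>e\<in>snd IJ. \<epsilon> N (e div N))))"
      using F[OF N] by (intro sum.cong) auto
    also have "\<dots> = exp (- (\<theta>\<^sup>2)) * ((\<Sum>I\<in>index_sets N A q. \<Prod>e\<in>I. \<delta> N (e div N)) *
        (\<Sum>J\<in>index_sets N B p. \<Prod>e\<in>J. \<epsilon> N (e div N)))"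
      by (simp only: sum_distrib_left[symmetric] sum_Times_mult)
    finally have "prob (G N) = exp (- (\<theta>\<^sup>2)) *
      ((\<Prod>j<q. real (N choose (A (Suc j) - A j)) * \<delta> N j ^ (A (Suc j) - A j)) *
       (\<Prod>i<p. real (N choose (B (Suc i) - B i)) * \<epsilon> N i ^ (B (Suc i) - B i)))"
      using sum_index_sets[OF N A(1,2), of q "\<delta> N"] sum_index_sets[OF N B(1,2), of p "\<epsilon> N"] by simp
    moreover have "G N \<in> sets M" unfolding G_def using F[OF N] fin by (intro sets.finite_UN) auto
    ultimately show ?thesis by (simp add: \<delta>_def \<epsilon>_def)
  qed
  have mem: "\<omega> \<in> G N \<longleftrightarrow> card (X \<omega>) = k \<and>
      (\<exists>I\<in>index_sets N A q. \<exists>J\<in>index_sets N B p. cells N ` X \<omega> = rook I J)"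
    if "\<omega> \<in> space M" for \<omega> N using that by (auto simp: G_def F_def)
  have GE: "\<omega> \<in> ?E" if "\<omega> \<in> G N" "0 < N" for \<omega> N
  proof -
    have \<omega>: "\<omega> \<in> space M" using that(1) by (auto simp: G_def F_def)
    then show ?thesis
      using event_if_rook[OF that(2) finite_points[OF \<omega>] sub[OF \<omega>]] mem[OF \<omega>] that(1) by blast
  qed
  have EG: "eventually (\<lambda>N. \<omega> \<in> G N) sequentially" if "\<omega> \<in> ?E" for \<omega>
  proof -
    have \<omega>: "\<omega> \<in> space M" "event (X \<omega>)" using that by auto
    have Z: "finite (fst ` X \<omega>)" "finite (snd ` X \<omega>)" "fst ` X \<omega> \<subseteq> {0..\<theta>}" "snd ` X \<omega> \<subseteq> {0..\<theta>}"
      using finite_points[OF \<omega>(1)] sub[OF \<omega>(1)] by auto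
    show ?thesis
      using eventually_inj_on_refine[OF c Z(1,3)] eventually_inj_on_refine[OF d Z(2,4)]
        eventually_gt_at_top[of 0]
    proof eventually_elim
      case (elim N)
      then show ?case using rook_if_event[OF elim(3) \<omega>(2) elim(1,2)] mem[OF \<omega>(1)] by blast
    qed
  qed
  have "?E = (\<Union>N\<in>{0<..}. G N)"
  proof (intro set_eqI iffI)
    fix \<omega> assume "\<omega> \<in> ?E"
    then have "eventually (\<lambda>N. \<omega> \<in> G N \<and> 0 < N) sequentially"
      using EG eventually_gt_at_top[of 0] by (intro eventually_conj) auto
    then show "\<omega> \<in> (\<Union>N\<in>{0<..}. G N)" using eventually_happens'[OF sequentially_bot] by force
  next
    fix \<omega> assume "\<omega> \<in> (\<Union>N\<in>{0<..}. G N)"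
    then show "\<omega> \<in> ?E" using GE by blast
  qed
  moreover have "(\<Union>N\<in>{0<..}. G N) \<in> sets M" using G by (intro sets.countable_UN') auto
  ultimately show E: "?E \<in> sets M" by simp
  \<comment> \<open>With no monotonicity in \<open>N\<close> at hand, dominated convergence of the
    indicators takes the place of continuity along increasing events; the shift to
    \<open>Suc N\<close> avoids the meaningless grid for \<open>N = 0\<close>.\<close>
  have "(\<lambda>N. \<integral>\<omega>. indicat_real (G (Suc N)) \<omega> \<partial>M) \<longlonglongrightarrow> (\<integral>\<omega>. indicat_real ?E \<omega> \<partial>M)"
  proof (rule integral_dominated_convergence[where w = "\<lambda>_. 1"])
    show "AE \<omega> in M. (\<lambda>N. indicat_real (G (Suc N)) \<omega>) \<longlonglongrightarrow> indicat_real ?E \<omega>"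
    proof (rule AE_I2)
      fix \<omega> assume "\<omega> \<in> space M"
      show "(\<lambda>N. indicat_real (G (Suc N)) \<omega>) \<longlonglongrightarrow> indicat_real ?E \<omega>"
      proof (cases "\<omega> \<in> ?E")
        case True
        have "eventually (\<lambda>N. \<omega> \<in> G (Suc N)) sequentially"
          using EG[OF True] by (rule eventually_sequentially_Suc[of "\<lambda>N. \<omega> \<in> G N", THEN iffD2])
        then have "eventually (\<lambda>N. indicat_real (G (Suc N)) \<omega> = indicat_real ?E \<omega>) sequentially"
          by eventually_elim (use True in simp)
        then show ?thesis by (rule tendsto_eventually)
      next
        case False
        then have "\<omega> \<notin> G (Suc N)" for N using GE by blast
        then show ?thesis using False by simp
      qed
    qed
  qed (use G E in \<open>auto intro!: borel_measurable_indicator\<close>)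
  then have "(\<lambda>N. prob (G (Suc N))) \<longlonglongrightarrow> prob ?E" using G E by simp
  then have lim: "(\<lambda>N. prob (G N)) \<longlonglongrightarrow> prob ?E" by (rule LIMSEQ_imp_Suc)
  let ?f = "\<lambda>N. exp (- (\<theta>\<^sup>2)) *
      ((\<Prod>j<q. real (N choose (A (Suc j) - A j)) * ((c (Suc j) - c j) / real N) ^ (A (Suc j) - A j)) *
       (\<Prod>i<p. real (N choose (B (Suc i) - B i)) * ((d (Suc i) - d i) / real N) ^ (B (Suc i) - B i)))"
  have "?f \<longlonglongrightarrow> volume"
    unfolding volume_def mult.assoc
    by (intro tendsto_mult tendsto_const tendsto_prod binomial_over_power_tendsto)
  moreover have "eventually (\<lambda>N. ?f N = prob (G N)) sequentially"
    using eventually_gt_at_top[of 0] by eventually_elim (use G in simp)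
  ultimately have "(\<lambda>N. prob (G N)) \<longlonglongrightarrow> volume" by (rule Lim_transform_eventually)
  with lim show "prob ?E = volume" by (rule LIMSEQ_unique)
qed

end

section \<open>The diagram process of a configuration\<close>

text \<open>Turns a comparison of decorations into one between a position and a number of points, so
  that the diagrams depend on the configuration only through its permutation and the strip
  counts.\<close>

lemma nth_le_iff_card:
  fixes xs :: "'a :: linorder list"
  assumes "sorted_wrt (<) xs" "j < length xs"
  shows "xs ! j \<le> u \<longleftrightarrow> j < card {x \<in> set xs. x \<le> u}"
proof
  have inj: "inj_on ((!) xs) {..<length xs}"
    using assms(1) by (intro inj_on_nth) (auto simp: strict_sorted_iff)
  {
    assume u: "xs ! j \<le> u"
    have "xs ! i \<le> u" if "i \<le> j" for i
    proof -
      have "xs ! i \<le> xs ! j" using assms that by (cases "i = j") (auto simp: sorted_wrt_nth_less less_imp_le)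
      then show ?thesis using u by simp
    qed
    then have "(!) xs ` {..j} \<subseteq> {x \<in> set xs. x \<le> u}" using assms(2) by auto
    then have "card ((!) xs ` {..j}) \<le> card {x \<in> set xs. x \<le> u}" by (rule card_mono[rotated]) simp
    moreover have "card ((!) xs ` {..j}) = Suc j"
      using inj_on_subset[OF inj, of "{..j}"] assms(2) by (simp add: card_image subset_iff)
    ultimately show "j < card {x \<in> set xs. x \<le> u}" by simp
  }
  {
    assume j: "j < card {x \<in> set xs. x \<le> u}"
    show "xs ! j \<le> u"
    proof (rule ccontr)
      assume "\<not> xs ! j \<le> u"
      then have less: "u < xs ! j" by simp
      have "{x \<in> set xs. x \<le> u} \<subseteq> (!) xs ` {..<j}"
      proof
        fix x assume "x \<in> {x \<in> set xs. x \<le> u}"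
        then obtain i where i: "i < length xs" "x = xs ! i" "xs ! i \<le> u" by (auto simp: in_set_conv_nth)
        have "i < j"
        proof (rule ccontr)
          assume "\<not> i < j"
          then have "xs ! j \<le> xs ! i"
            using assms(1) i(1) by (cases "i = j") (auto simp: sorted_wrt_nth_less less_imp_le)
          then show False using less i(3) by simp
        qed
        then show "x \<in> (!) xs ` {..<j}" using i by simp
      qed
      then have "card {x \<in> set xs. x \<le> u} \<le> card ((!) xs ` {..<j})" by (rule card_mono[rotated]) simp
      also have "\<dots> \<le> j" using card_image_le[of "{..<j}" "(!) xs"] by simp
      finally show False using j by simp
    qed
  }
qed

text \<open>Entries count from 1 and list positions from 0: entry \<open>e\<close> carries the
  decoration \<open>ds ! (e - 1)\<close>, which is at most \<open>u\<close> iff at least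
  \<open>e\<close> decorations are.\<close>

lemma subdiagram_eq:
  assumes T: "filling T \<in> standard_tableaux (shape T)" "card (shape T) = length ds"
    and ds: "sorted_wrt (<) ds"
  shows "subdiagram (T, ds) u = {b \<in> shape T. filling T b \<le> card {y \<in> set ds. y \<le> u}}"
proof -
  have "ds ! (entry T b - 1) \<le> u \<longleftrightarrow> filling T b \<le> card {y \<in> set ds. y \<le> u}" if b: "b \<in> shape T" for b
  proof -
    have "filling T b \<in> {1..length ds}"
      using bij_betwE[OF standard_tableauxD(1)[OF T(1)]] b T(2) by simp
    then have "1 \<le> entry T b" "entry T b \<le> length ds" using b by (auto simp: filling_def)
    then show ?thesis
      using nth_le_iff_card[OF ds, of "entry T b - 1" u] b by (auto simp: filling_def)
  qed
  then show ?thesis by (auto simp: subdiagram_def)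
qed

lemma diagram_process_eq:
  assumes P: "P \<in> configurations \<theta>" and RS: "RS (config_perm P) (card P) = (L, R)"
  shows "t \<le> 0 \<Longrightarrow> diagram_process \<theta> P t = {b \<in> shape L. filling L b \<le> card {z \<in> P. snd z \<le> \<theta> + t}}"
    "0 < t \<Longrightarrow> diagram_process \<theta> P t = {b \<in> shape L. filling R b \<le> card {z \<in> P. fst z \<le> \<theta> - t}}"
proof -
  have st: "standard {1..card P} L" "standard {1..card P} R" "shape L = shape R" "card (shape L) = card P"
    using RS_shapes[OF config_perm_graph(1)[OF P] RS] by blast+
  have fill: "filling L \<in> standard_tableaux (shape L)" "filling R \<in> standard_tableaux (shape R)"
    using filling_in_standard_tableaux st by metis+
  note card = card_coords[OF P]
  note co = coords_simps[OF P]
  have dec: "decorated_L P = (L, y_coords P)" "decorated_R P = (R, x_coords P)"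
    by (simp_all add: decorated_L_def decorated_R_def RS)
  show "diagram_process \<theta> P t = {b \<in> shape L. filling L b \<le> card {z \<in> P. snd z \<le> \<theta> + t}}" if "t \<le> 0"
    using subdiagram_eq[OF fill(1) _ co(6)] st(4) length_y_coords[OF P] P that
    by (simp add: diagram_process_def dec co(2) card)
  show "diagram_process \<theta> P t = {b \<in> shape L. filling R b \<le> card {z \<in> P. fst z \<le> \<theta> - t}}" if "0 < t"
    using subdiagram_eq[OF fill(2) _ co(5)] st(3,4) length_x_coords[OF P] P that
    by (simp add: diagram_process_def dec co(1) card)
qed

lemma card_sublevel:
  assumes "S \<in> standard_tableaux D" "a \<le> card D"
  shows "card {b \<in> D. S b \<le> a} = a"
proof -
  note S = standard_tableauxD(1)[OF assms(1)]
  have "S ` {b \<in> D. S b \<le> a} = {1..a}"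
  proof
    show "S ` {b \<in> D. S b \<le> a} \<subseteq> {1..a}" using bij_betwE[OF S] by auto
    show "{1..a} \<subseteq> S ` {b \<in> D. S b \<le> a}"
    proof
      fix i assume i: "i \<in> {1..a}"
      then have "i \<in> S ` D" using bij_betw_imp_surj_on[OF S] assms(2) by simp
      then show "i \<in> S ` {b \<in> D. S b \<le> a}" using i by auto
    qed
  qed
  moreover have "card (S ` {b \<in> D. S b \<le> a}) = card {b \<in> D. S b \<le> a}"
    by (rule card_image, rule inj_on_subset[OF bij_betw_imp_inj_on[OF S]]) blast
  ultimately show ?thesis by simp
qed

text \<open>A sublevel set at \<open>a i\<close> has exactly \<open>a i\<close> boxes, so requiring
  it to be \<open>D i\<close> fixes the count \<open>a i\<close>; what remains is a condition on the
  tableau alone. The two extra levels in \<open>chain_tableaux\<close> hold automatically, as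
  entries range from 1 to the number of boxes.\<close>

lemma sublevels_iff_chain_tableaux:
  assumes S: "S \<in> standard_tableaux (D (Suc n))" and D: "D 0 = {}" and a: "\<And>i. a i \<le> card (D (Suc n))"
  shows "(\<forall>i\<in>{1..n}. {b \<in> D (Suc n). S b \<le> a i} = D i) \<longleftrightarrow>
    (\<forall>i\<in>{1..n}. a i = card (D i)) \<and> S \<in> chain_tableaux D (Suc n)" (is "?l \<longleftrightarrow> ?r")
proof
  assume l: ?l
  have a': "a i = card (D i)" if "i \<in> {1..n}" for i
    using card_sublevel[OF S a] l that by metis
  have range: "S b \<in> {1..card (D (Suc n))}" if "b \<in> D (Suc n)" for b
    using bij_betwE[OF standard_tableauxD(1)[OF S]] that by blast
  have "{b \<in> D (Suc n). S b \<le> card (D i)} = D i" if i: "i \<le> Suc n" for i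
  proof -
    consider "i = 0" | "i = Suc n" | "i \<in> {1..n}" using i by force
    then show ?thesis
    proof cases
      case 1
      then show ?thesis using range D by fastforce
    next
      case 2
      then show ?thesis using range by fastforce
    next
      case 3
      then show ?thesis using l a' by simp
    qed
  qed
  then show ?r using a' S by (simp add: chain_tableaux_def)
next
  assume r: ?r
  then show ?l by (simp add: chain_tableaux_def)
qed

section \<open>Summing over permutations\<close>

text \<open>Different permutations give disjoint events, and all of these have the same probability,
  which depends only on the strips and their counts.\<close>

lemma prob_event_Union:
  assumes X: "poisson_point_process M (rate_one_on_square \<theta>) X"
    and G: "finite G" and se: "\<And>\<sigma>. \<sigma> \<in> G \<Longrightarrow> strip_event \<theta> \<sigma> k c d q p A B"
  shows "{\<omega> \<in> space M. \<exists>\<sigma>\<in>G. strip_event.event \<theta> \<sigma> c d q p A B (X \<omega>)} \<in> sets M"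
    "measure M {\<omega> \<in> space M. \<exists>\<sigma>\<in>G. strip_event.event \<theta> \<sigma> c d q p A B (X \<omega>)} =
      real (card G) * (exp (- (\<theta>\<^sup>2)) *
       (\<Prod>j<q. (c (Suc j) - c j) ^ (A (Suc j) - A j) / fact (A (Suc j) - A j)) *
       (\<Prod>i<p. (d (Suc i) - d i) ^ (B (Suc i) - B i) / fact (B (Suc i) - B i)))" (is "_ = _ * ?v")
proof -
  interpret poisson_point_process M "rate_one_on_square \<theta>" X by (rule X)
  define F where "F \<sigma> = {\<omega> \<in> space M. strip_event.event \<theta> \<sigma> c d q p A B (X \<omega>)}" for \<sigma>
  have F: "F \<sigma> \<in> sets M" "prob (F \<sigma>) = ?v" if "\<sigma> \<in> G" for \<sigma>
    using strip_event.prob_event[OF se[OF that] X] strip_event.volume_def[OF se[OF that]]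
    by (simp_all add: F_def)
  have eq: "{\<omega> \<in> space M. \<exists>\<sigma>\<in>G. strip_event.event \<theta> \<sigma> c d q p A B (X \<omega>)} = (\<Union>\<sigma>\<in>G. F \<sigma>)"
    by (auto simp: F_def)
  show "{\<omega> \<in> space M. \<exists>\<sigma>\<in>G. strip_event.event \<theta> \<sigma> c d q p A B (X \<omega>)} \<in> sets M"
    unfolding eq using F(1) G by (intro sets.finite_UN) auto
  have "disjoint_family_on F G"
    unfolding disjoint_family_on_def F_def using strip_event.event_def[OF se] by fastforce
  then have "prob (\<Union>\<sigma>\<in>G. F \<sigma>) = (\<Sum>\<sigma>\<in>G. prob (F \<sigma>))"
    using F(1) G by (intro finite_measure_finite_Union) auto
  also have "\<dots> = real (card G) * ?v" using F(2) by simp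
  finally show "prob {\<omega> \<in> space M. \<exists>\<sigma>\<in>G. strip_event.event \<theta> \<sigma> c d q p A B (X \<omega>)} = real (card G) * ?v"
    unfolding eq .
qed

text \<open>The grid with a single strip. The type is left open because the same function, at type
  \<open>nat\<close>, also serves as the cumulative count that jumps from 0 to
  \<open>k\<close>.\<close>

definition trivial_grid :: "'a :: zero \<Rightarrow> nat \<Rightarrow> 'a" where
  "trivial_grid a j = (if j = 0 then 0 else a)"

lemma grid_trivial_grid: "0 \<le> \<theta> \<Longrightarrow> grid \<theta> (trivial_grid \<theta>) 1"
  by (simp add: grid_def trivial_grid_def)

lemma measure_square:
  assumes "0 \<le> \<theta>"
  shows "measure (rate_one_on_square \<theta>) (space (rate_one_on_square \<theta>)) = \<theta>\<^sup>2"
proof -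
  note g = grid_trivial_grid[OF assms]
  have "box_cell \<theta> (trivial_grid \<theta>) (trivial_grid \<theta>) (0, 0) = space (rate_one_on_square \<theta>)"
    using cell_of_less[OF g] by (fastforce simp: box_cell_def space_restrict_space)
  then show ?thesis
    using box_cell_measure(2)[OF g g, of 0 0] by (simp add: trivial_grid_def power2_eq_square)
qed

text \<open>Summing the probabilities of all \<open>k!\<close> permutations already gives the Poisson probability of
  having \<open>k\<close> points, so no mass is left for degenerate configurations.\<close>

lemma almost_surely_configuration:
  assumes "0 \<le> \<theta>" and X: "poisson_point_process M (rate_one_on_square \<theta>) X"
  shows "{\<omega> \<in> space M. X \<omega> \<notin> configurations \<theta>} \<in> null_sets M"
proof -
  interpret poisson_point_process M "rate_one_on_square \<theta>" X by (rule X)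
  have null: "{\<omega> \<in> space M. card (X \<omega>) = k \<and> X \<omega> \<notin> configurations \<theta>} \<in> null_sets M" for k
  proof -
    let ?G = "{\<sigma>. \<sigma> permutes {1..k}}" and ?c = "trivial_grid \<theta>" and ?A = "trivial_grid k"
    have se: "strip_event \<theta> \<sigma> k ?c ?c 1 1 ?A ?A" if "\<sigma> \<in> ?G" for \<sigma>
      using grid_trivial_grid[OF assms(1)] that by unfold_locales (simp_all add: trivial_grid_def)
    let ?C = "{\<omega> \<in> space M. card (X \<omega>) = k \<and> X \<omega> \<in> configurations \<theta>}"
    have C: "?C = {\<omega> \<in> space M. \<exists>\<sigma>\<in>?G. strip_event.event \<theta> \<sigma> ?c ?c 1 1 ?A ?A (X \<omega>)}"
    proof -
      have "(card P = k \<and> P \<in> configurations \<theta>) \<longleftrightarrow>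
          (\<exists>\<sigma>\<in>?G. strip_event.event \<theta> \<sigma> ?c ?c 1 1 ?A ?A P)" for P
      proof (cases "P \<in> configurations \<theta>")
        case True
        then have "{z \<in> P. fst z \<le> \<theta>} = P" "{z \<in> P. snd z \<le> \<theta>} = P" by (auto simp: configurations_def)
        then have "strip_event.event \<theta> \<sigma> ?c ?c 1 1 ?A ?A P \<longleftrightarrow> config_perm P = \<sigma> \<and> card P = k"
          if "\<sigma> \<in> ?G" for \<sigma>
          unfolding strip_event.event_def[OF se[OF that]] using True by (auto simp: trivial_grid_def)
        then show ?thesis using True config_perm_graph(1)[OF True] by auto
      next
        case False
        then show ?thesis using strip_event.event_def[OF se] by blast
      qed
      then show ?thesis by simp
    qed
    have finG: "finite ?G" by (simp add: finite_permutations)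
    note Union = prob_event_Union[OF X finG se]
    have cardG: "card ?G = fact k" by (rule card_permutations) simp_all
    have pC1: "?C \<in> sets M" unfolding C by (rule Union(1))
    have pC2: "prob ?C = fact k * (exp (- (\<theta>\<^sup>2)) * (\<theta> ^ k / fact k) * (\<theta> ^ k / fact k))"
    proof -
      have "(\<Prod>j<1. (?c (Suc j) - ?c j) ^ (?A (Suc j) - ?A j) / fact (?A (Suc j) - ?A j)) = \<theta> ^ k / fact k"
        by (simp add: trivial_grid_def)
      then show ?thesis using Union(2) unfolding C cardG of_nat_fact by simp
    qed
    let ?D = "{\<omega> \<in> space M. card (X \<omega> \<inter> space (rate_one_on_square \<theta>)) = k}"
    have "prob ?D = exp (- (\<theta>\<^sup>2)) * (\<theta>\<^sup>2) ^ k / fact k"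
      unfolding count_poisson[OF sets.top] measure_square[OF assms(1)] ..
    also have "\<dots> = prob ?C" unfolding pC2 by (simp add: power2_eq_square power_mult_distrib)
    finally have eq: "prob ?D = prob ?C" .
    have D: "?D \<in> sets M"
      using measurable_sets[OF count_measurable[OF sets.top], of "{k}"]
      by (simp add: vimage_def Int_def conj_commute)
    have Deq: "?D = {\<omega> \<in> space M. card (X \<omega>) = k}" using points_in_space by (auto simp: Int_absorb2)
    have "prob (?D - ?C) = prob ?D - prob ?C"
      by (rule finite_measure_Diff[OF D pC1]) (auto simp: Deq)
    then have "?D - ?C \<in> null_sets M"
      using eq D pC1 by (intro null_setsI) (auto simp: emeasure_eq_measure)
    moreover have "?D - ?C = {\<omega> \<in> space M. card (X \<omega>) = k \<and> X \<omega> \<notin> configurations \<theta>}"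
      unfolding Deq by auto
    ultimately show ?thesis by simp
  qed
  have "{\<omega> \<in> space M. X \<omega> \<notin> configurations \<theta>} =
      (\<Union>k. {\<omega> \<in> space M. card (X \<omega>) = k \<and> X \<omega> \<notin> configurations \<theta>})" by auto
  then show ?thesis using null by (simp add: null_sets_UN)
qed

section \<open>Finite-dimensional distributions of the diagram process\<close>

theorem theorem3p2:
  fixes \<theta> :: real
    and M :: "'w measure"
    and X :: "'w \<Rightarrow> (real \<times> real) set"
    and n m :: nat
    and t s :: "nat \<Rightarrow> real"
    and lam mu :: "nat \<Rightarrow> box set"
    and nu :: "box set"
  assumes "\<theta> > 0"
    and "poisson_point_process M (rate_one_on_square \<theta>) X"
    and "\<forall>i\<in>{1..n}. t i \<in> {-\<theta>..<0}" and "strict_mono_on {1..n} t"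
    and "\<forall>j\<in>{1..m}. s j \<in> {0<..\<theta>}" and "strict_mono_on {1..m} s"
    and "\<forall>i\<in>{1..n}. lam i \<in> young_diagrams"
    and "\<forall>i\<in>{1..<n}. lam i \<subseteq> lam (i + 1)"
    and "\<forall>j\<in>{1..m}. mu j \<in> young_diagrams"
    and "\<forall>j\<in>{1..<m}. mu (j + 1) \<subseteq> mu j"
    and "nu \<in> young_diagrams" and "lam n \<subseteq> nu" and "mu 1 \<subseteq> nu"
    and "lam 0 = {}" and "lam (n + 1) = nu"
    and "mu 0 = nu" and "mu (m + 1) = {}"
    and "t 0 = -\<theta>" and "t (n + 1) = 0"
    and "s 0 = 0" and "s (m + 1) = \<theta>"
  defines "E \<equiv> {\<omega> \<in> space M.
      (\<forall>i\<in>{1..n}. diagram_process \<theta> (X \<omega>) (t i) = lam i) \<and>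
      diagram_process \<theta> (X \<omega>) 0 = nu \<and>
      (\<forall>j\<in>{1..m}. diagram_process \<theta> (X \<omega>) (s j) = mu j)}"
  shows "E \<in> sets M \<and>
    measure M E =
      exp (- (\<theta>\<^sup>2)) *
      (\<Prod>i=0..n. skew_dim (lam (i + 1) - lam i) *
         ((t (i + 1) - t i) ^ card (lam (i + 1) - lam i) / fact (card (lam (i + 1) - lam i)))) *
      (\<Prod>j=0..m. skew_dim (mu j - mu (j + 1)) *
         ((s (j + 1) - s j) ^ card (mu j - mu (j + 1)) / fact (card (mu j - mu (j + 1)))))"
proof -
  interpret poisson_point_process M "rate_one_on_square \<theta>" X by (rule assms(2))
  define k where "k = card nu"
  \<comment> \<open>At time \<open>t i\<close> the ordinates up to \<open>\<theta> + t i\<close>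
    count, at time \<open>s j\<close> the abscissas up to \<open>\<theta> - s j\<close>. On the
    right half time runs against the coordinate, so \<open>c\<close>, \<open>K\<close> and
    \<open>A\<close> list the data backwards, from \<open>s (m + 1) = \<theta>\<close> down to
    \<open>s 0 = 0\<close>.\<close>
  define d where "d i = \<theta> + t i" for i
  define c where "c j = \<theta> - s (m + 1 - j)" for j
  define K where "K j = mu (m + 1 - j)" for j
  define A where "A j = card (K j)" for j
  define B where "B i = card (lam i)" for i
  have lam_young: "lam i \<in> young_diagrams" if i: "i \<le> Suc n" for i
  proof -
    consider "i = 0" | "i = Suc n" | "i \<in> {1..n}" using i by force
    then show ?thesis by cases (use assms empty_young_diagram in auto)
  qed
  have mu_young: "mu j \<in> young_diagrams" if j: "j \<le> Suc m" for j
  proof -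
    consider "j = 0" | "j = Suc m" | "j \<in> {1..m}" using j by force
    then show ?thesis by cases (use assms empty_young_diagram in auto)
  qed
  have K_young: "K j \<in> young_diagrams" for j unfolding K_def by (rule mu_young) simp
  \<comment> \<open>Order and inclusion are assumed between genuine times only; the steps from and
    to the added end values are split off, and they are one and the same step when
    \<open>n = 0\<close>.\<close>
  have lam_step: "lam i \<subseteq> lam (Suc i) \<and> t i \<le> t (Suc i)" if i: "i \<le> n" for i
  proof -
    consider "i = 0" "n = 0" | "i = 0" "0 < n" | "i = n" "0 < n" | "i \<in> {1..<n}" using i by force
    then show ?thesis
    proof cases
      case 4
      then have "t i < t (Suc i)" by (intro strict_mono_onD[OF assms(4)]) auto
      then show ?thesis using assms(8) 4 by simp
    next
      case 3
      then have "t n < 0" using assms(3) by auto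
      then show ?thesis using 3 assms(12,15,19) by simp
    qed (use assms(1,3,12,14,15,18,19) in auto)
  qed
  have mu_step: "mu (Suc j) \<subseteq> mu j \<and> s j \<le> s (Suc j)" if j: "j \<le> m" for j
  proof -
    consider "j = 0" "m = 0" | "j = 0" "0 < m" | "j = m" "0 < m" | "j \<in> {1..<m}" using j by force
    then show ?thesis
    proof cases
      case 4
      then have "s j < s (Suc j)" by (intro strict_mono_onD[OF assms(6)]) auto
      then show ?thesis using assms(10) 4 by simp
    next
      case 2
      then have "0 < s 1" using assms(5) by auto
      then show ?thesis using 2 assms(13,16,20) by simp
    qed (use assms(1,5,13,16,17,20,21) in auto)
  qed
  have K_step: "K j \<subseteq> K (Suc j) \<and> c j \<le> c (Suc j)" if "j < Suc m" for j
    using mu_step[of "m - j"] that by (simp add: K_def c_def Suc_diff_le)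
  have ends: "lam 0 = {}" "lam (Suc n) = nu" "K 0 = {}" "K (Suc m) = nu"
    using assms(14-17) by (simp_all add: K_def)
  have grids: "grid \<theta> c (Suc m)" "grid \<theta> d (Suc n)"
    using K_step lam_step assms(18-21) by (auto simp: grid_def c_def d_def less_Suc_eq_le)
  have fin: "finite (lam i)" if "i \<le> Suc n" for i using lam_young[OF that] by (rule finite_young_diagram)
  have finK: "finite (K j)" for j using K_young by (rule finite_young_diagram)
  have B_diff: "card (lam (Suc i) - lam i) = B (Suc i) - B i" "B i \<le> B (Suc i)" if "i < Suc n" for i
    using lam_step[of i] fin[of i] fin[of "Suc i"] that by (auto simp: B_def card_Diff_subset card_mono)
  have A_diff: "card (K (Suc j) - K j) = A (Suc j) - A j" "A j \<le> A (Suc j)" if "j < Suc m" for j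
    using K_step[OF that] finK by (auto simp: A_def card_Diff_subset card_mono)
  define CL where "CL = chain_tableaux lam (Suc n)"
  define CR where "CR = chain_tableaux K (Suc m)"
  have sub: "CL \<subseteq> standard_tableaux nu" "CR \<subseteq> standard_tableaux nu"
    using ends by (auto simp: CL_def CR_def chain_tableaux_def)
  define G where "G = {\<sigma>. \<sigma> permutes {1..k} \<and> shape (fst (RS \<sigma> k)) = nu \<and>
      filling (fst (RS \<sigma> k)) \<in> CL \<and> filling (snd (RS \<sigma> k)) \<in> CR}"
  have cardG: "card G = (\<Prod>i<Suc n. skew_dim (lam (Suc i) - lam i)) * (\<Prod>j<Suc m. skew_dim (K (Suc j) - K j))"
  proof -
    have "card CL = (\<Prod>i<Suc n. skew_dim (lam (Suc i) - lam i))"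
      unfolding CL_def by (rule card_chain_tableaux) (use lam_young lam_step ends in auto)
    moreover have "card CR = (\<Prod>j<Suc m. skew_dim (K (Suc j) - K j))"
      unfolding CR_def by (rule card_chain_tableaux) (use K_young K_step ends in auto)
    ultimately show ?thesis
      unfolding G_def k_def card_permutations_by_RS[OF assms(11) sub] by simp
  qed
  have finG: "finite G" unfolding G_def by (rule finite_subset[OF _ finite_permutations[of "{1..k}"]]) auto
  have se: "strip_event \<theta> \<sigma> k c d (Suc m) (Suc n) A B" if "\<sigma> \<in> G" for \<sigma>
  proof
    show "A 0 = 0" "A (Suc m) = k" "B 0 = 0" "B (Suc n) = k"
      using ends by (simp_all add: A_def B_def k_def)
    show "\<sigma> permutes {1..k}" using that by (simp add: G_def)
  qed (use grids A_diff B_diff in auto)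
  let ?ev = "\<lambda>P. \<exists>\<sigma>\<in>G. strip_event.event \<theta> \<sigma> c d (Suc m) (Suc n) A B P"
  let ?path = "\<lambda>P. (\<forall>i\<in>{1..n}. diagram_process \<theta> P (t i) = lam i) \<and> diagram_process \<theta> P 0 = nu \<and>
      (\<forall>j\<in>{1..m}. diagram_process \<theta> P (s j) = mu j)"
  have iff: "?path P \<longleftrightarrow> ?ev P" if P: "P \<in> configurations \<theta>" for P
  proof -
    define \<sigma> where "\<sigma> = config_perm P"
    obtain L R where LR: "RS \<sigma> (card P) = (L, R)" by fastforce
    note proc = diagram_process_eq[OF P LR[unfolded \<sigma>_def]]
    have perm: "\<sigma> permutes {1..card P}" unfolding \<sigma>_def by (rule config_perm_graph(1)[OF P])
    note sh = RS_shapes[OF perm LR]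
    have all: "{z \<in> P. snd z \<le> \<theta>} = P" "{z \<in> P. fst z \<le> \<theta>} = P" using P by (auto simp: configurations_def)
    have fill: "filling L \<in> standard_tableaux (shape L)" "filling R \<in> standard_tableaux (shape L)"
      using filling_in_standard_tableaux[of L] filling_in_standard_tableaux[of R] sh by auto
    have proc0: "diagram_process \<theta> P 0 = shape L"
    proof -
      have "filling L b \<le> card P" if "b \<in> shape L" for b
        using bij_betwE[OF standard_tableauxD(1)[OF fill(1)]] that sh by auto
      then show ?thesis using proc(1)[of 0] all by auto
    qed
    define a where "a i = card {z \<in> P. snd z \<le> d i}" for i
    define a' where "a' j = card {z \<in> P. fst z \<le> c j}" for j
    have ev: "?ev P \<longleftrightarrow> \<sigma> \<in> G \<and> (\<forall>j\<in>{1..Suc m}. a' j = A j) \<and> (\<forall>i\<in>{1..Suc n}. a i = B i)"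
      using P by (auto simp: strip_event.event_def[OF se] \<sigma>_def a_def a'_def)
    have last: "a (Suc n) = card P" "a' (Suc m) = card P"
      using all assms(19,20) by (simp_all add: a_def a'_def d_def c_def)
    have AB: "A (Suc m) = k" "B (Suc n) = k" using ends by (simp_all add: A_def B_def k_def)
    show ?thesis
    proof (cases "shape L = nu")
      \<comment> \<open>Time 0 shows the whole shape, so a shape other than \<open>nu\<close> rules
        out the path. It also rules out the strip events: their last count gives
        \<open>card P = k\<close>, and \<open>G\<close> then demands the shape
        \<open>nu\<close>.\<close>
      case False
      then have "\<not> ?path P" using proc0 by simp
      moreover have "\<not> ?ev P"
      proof
        assume "?ev P"
        then have e: "\<sigma> \<in> G" "a' (Suc m) = A (Suc m)" unfolding ev by auto
        then have "card P = k" using last AB by simp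
        then show False using e(1) LR False by (simp add: G_def)
      qed
      ultimately show ?thesis by blast
    next
      case True
      then have k: "card P = k" using sh unfolding k_def True[symmetric] by metis
      have finP: "finite P" using P by (simp add: configurations_def)
      have le: "a i \<le> card (lam (Suc n))" "a' i \<le> card (K (Suc m))" for i
        unfolding ends k_def[symmetric] k[symmetric] a_def a'_def by (auto intro: card_mono[OF finP])
      have L: "(\<forall>i\<in>{1..n}. diagram_process \<theta> P (t i) = lam i) \<longleftrightarrow>
          (\<forall>i\<in>{1..n}. a i = B i) \<and> filling L \<in> CL"
      proof -
        have "diagram_process \<theta> P (t i) = {b \<in> lam (Suc n). filling L b \<le> a i}" if "i \<in> {1..n}" for i
        proof -
          have "t i < 0" using assms(3) that by auto
          then show ?thesis using proc(1)[of "t i"] by (simp add: ends True a_def d_def)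
        qed
        then show ?thesis
          using sublevels_iff_chain_tableaux[OF _ ends(1) le(1), of "filling L"] fill(1) True ends
          by (simp add: CL_def B_def)
      qed
      have "(\<forall>j\<in>{1..m}. diagram_process \<theta> P (s j) = mu j) \<longleftrightarrow>
          (\<forall>j\<in>{1..m}. {b \<in> K (Suc m). filling R b \<le> a' j} = K j)"
      proof -
        have *: "diagram_process \<theta> P (s j) = {b \<in> K (Suc m). filling R b \<le> a' (Suc m - j)} \<and>
            K (Suc m - j) = mu j" if "j \<in> {1..m}" for j
        proof -
          have "0 < s j" using assms(5) that by auto
          then show ?thesis using proc(2)[of "s j"] that by (simp add: assms(16) True a'_def c_def K_def)
        qed
        \<comment> \<open>Reversal of the index range, to pass from the decreasing list
          \<open>mu\<close> to the increasing list \<open>K\<close>.\<close>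
        have "(\<forall>j\<in>{1..m}. Q j) \<longleftrightarrow> (\<forall>j\<in>{1..m}. Q (Suc m - j))" for Q
        proof
          assume Q: "\<forall>j\<in>{1..m}. Q (Suc m - j)"
          show "\<forall>j\<in>{1..m}. Q j"
          proof
            fix j assume "j \<in> {1..m}"
            then have "Suc m - j \<in> {1..m}" "Suc m - (Suc m - j) = j" by auto
            then show "Q j" using bspec[OF Q, of "Suc m - j"] by simp
          qed
        next
          assume Q: "\<forall>j\<in>{1..m}. Q j"
          show "\<forall>j\<in>{1..m}. Q (Suc m - j)"
          proof
            fix j assume "j \<in> {1..m}"
            then have "Suc m - j \<in> {1..m}" by auto
            with Q show "Q (Suc m - j)" ..
          qed
        qed
        from this[of "\<lambda>j. {b \<in> K (Suc m). filling R b \<le> a' j} = K j"] * show ?thesis by simp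
      qed
      also have "\<dots> \<longleftrightarrow> (\<forall>j\<in>{1..m}. a' j = A j) \<and> filling R \<in> CR"
        using sublevels_iff_chain_tableaux[OF _ ends(3) le(2), of "filling R"] fill(2) True ends
        by (simp add: CR_def A_def)
      finally have R: "(\<forall>j\<in>{1..m}. diagram_process \<theta> P (s j) = mu j) \<longleftrightarrow>
          (\<forall>j\<in>{1..m}. a' j = A j) \<and> filling R \<in> CR" .
      have "\<sigma> \<in> G \<longleftrightarrow> filling L \<in> CL \<and> filling R \<in> CR"
        using perm LR k True by (simp add: G_def)
      moreover have "(\<forall>j\<in>{1..Suc m}. a' j = A j) \<longleftrightarrow> (\<forall>j\<in>{1..m}. a' j = A j)"
        "(\<forall>i\<in>{1..Suc n}. a i = B i) \<longleftrightarrow> (\<forall>i\<in>{1..n}. a i = B i)"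
        using last AB k by (simp_all add: atLeastAtMostSuc_conv)
      ultimately show ?thesis unfolding ev L R proc0 using True by blast
    qed
  qed
  define F where "F = {\<omega> \<in> space M. ?ev (X \<omega>)}"
  \<comment> \<open>On degenerate realisations the process is constantly empty, so they lie in
    \<open>E\<close> precisely when every prescribed diagram is empty. Describing \<open>E\<close>
    exactly, and not just up to a null set, also gives its measurability.\<close>
  define Z where "Z = (if (\<forall>i\<in>{1..n}. {} = lam i) \<and> {} = nu \<and> (\<forall>j\<in>{1..m}. {} = mu j)
    then {\<omega> \<in> space M. X \<omega> \<notin> configurations \<theta>} else {})"
  have nonconf: "diagram_process \<theta> P u = {}" if "P \<notin> configurations \<theta>" for P u
    using that by (simp add: diagram_process_def)
  have ev_conf: "P \<in> configurations \<theta>" if "?ev P" for P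
    using that by (auto simp: strip_event.event_def[OF se])
  have EFZ: "E = F \<union> Z"
  proof (intro set_eqI)
    fix \<omega>
    show "\<omega> \<in> E \<longleftrightarrow> \<omega> \<in> F \<union> Z"
    proof (cases "X \<omega> \<in> configurations \<theta>")
      case True
      then show ?thesis using iff[OF True] by (simp add: E_def F_def Z_def)
    next
      case False
      then have "\<not> ?ev (X \<omega>)" using ev_conf by blast
      then show ?thesis using False by (simp add: E_def F_def Z_def nonconf)
    qed
  qed
  have Z: "Z \<in> null_sets M"
    using almost_surely_configuration[OF _ assms(2)] assms(1) by (simp add: Z_def)
  note F = prob_event_Union[OF assms(2) finG se, folded F_def]
  have "prob E = prob F" unfolding EFZ by (rule measure_Un_null_set[OF F(1) Z])
  also have "\<dots> = exp (- (\<theta>\<^sup>2)) *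
      (\<Prod>i<Suc n. skew_dim (lam (Suc i) - lam i) *
        ((t (Suc i) - t i) ^ card (lam (Suc i) - lam i) / fact (card (lam (Suc i) - lam i)))) *
      (\<Prod>j<Suc m. skew_dim (K (Suc j) - K j) *
        ((c (Suc j) - c j) ^ card (K (Suc j) - K j) / fact (card (K (Suc j) - K j))))"
  proof -
    have lam_prod: "(\<Prod>i<Suc n. skew_dim (lam (Suc i) - lam i) *
        ((t (Suc i) - t i) ^ card (lam (Suc i) - lam i) / fact (card (lam (Suc i) - lam i)))) =
        real (\<Prod>i<Suc n. skew_dim (lam (Suc i) - lam i)) *
        (\<Prod>i<Suc n. (d (Suc i) - d i) ^ (B (Suc i) - B i) / fact (B (Suc i) - B i))"
      unfolding of_nat_prod prod.distrib[symmetric] by (rule prod.cong) (simp_all add: B_diff(1) d_def)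
    have K_prod: "(\<Prod>j<Suc m. skew_dim (K (Suc j) - K j) *
        ((c (Suc j) - c j) ^ card (K (Suc j) - K j) / fact (card (K (Suc j) - K j)))) =
        real (\<Prod>j<Suc m. skew_dim (K (Suc j) - K j)) *
        (\<Prod>j<Suc m. (c (Suc j) - c j) ^ (A (Suc j) - A j) / fact (A (Suc j) - A j))"
      unfolding of_nat_prod prod.distrib[symmetric] by (rule prod.cong) (simp_all add: A_diff(1))
    \<comment> \<open>The strip events list the abscissas first, the claim the ordinates; each
      product of skew dimensions joins the strips of its own side.\<close>
    have "real (card G) * (e * x * y) = e * (real a * y) * (real b * x)" if "card G = a * b" for a b e x y
      using that by simp
    from F(2)[unfolded this[OF cardG]] show ?thesis unfolding lam_prod K_prod .
  qed
  also have "(\<Prod>i<Suc n. skew_dim (lam (Suc i) - lam i) *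
        ((t (Suc i) - t i) ^ card (lam (Suc i) - lam i) / fact (card (lam (Suc i) - lam i)))) =
      (\<Prod>i=0..n. skew_dim (lam (i + 1) - lam i) *
        ((t (i + 1) - t i) ^ card (lam (i + 1) - lam i) / fact (card (lam (i + 1) - lam i))))"
    by (simp add: lessThan_Suc_atMost atLeast0AtMost)
  also have "(\<Prod>j<Suc m. skew_dim (K (Suc j) - K j) *
        ((c (Suc j) - c j) ^ card (K (Suc j) - K j) / fact (card (K (Suc j) - K j)))) =
      (\<Prod>j=0..m. skew_dim (mu j - mu (j + 1)) *
        ((s (j + 1) - s j) ^ card (mu j - mu (j + 1)) / fact (card (mu j - mu (j + 1)))))"
    (is "_ = (\<Prod>j=0..m. ?g j)")
  proof -
    \<comment> \<open>The reversal of time is undone: factor \<open>j\<close> for \<open>K\<close>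
      is factor \<open>m - j\<close> for \<open>mu\<close>.\<close>
    have "(\<Prod>j<Suc m. ?g (Suc m - Suc j)) = (\<Prod>j<Suc m. ?g j)" by (rule prod.nat_diff_reindex)
    moreover have "K (Suc j) = mu (m - j) \<and> K j = mu (m - j + 1) \<and> c (Suc j) - c j = s (m - j + 1) - s (m - j)"
      if "j < Suc m" for j using that by (simp add: K_def c_def Suc_diff_le)
    ultimately show ?thesis by (simp add: lessThan_Suc_atMost atLeast0AtMost)
  qed
  finally have "prob E = exp (- (\<theta>\<^sup>2)) *
      (\<Prod>i=0..n. skew_dim (lam (i + 1) - lam i) *
         ((t (i + 1) - t i) ^ card (lam (i + 1) - lam i) / fact (card (lam (i + 1) - lam i)))) *
      (\<Prod>j=0..m. skew_dim (mu j - mu (j + 1)) *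
         ((s (j + 1) - s j) ^ card (mu j - mu (j + 1)) / fact (card (mu j - mu (j + 1)))))" .
  moreover have "E \<in> sets M" unfolding EFZ using F(1) null_setsD2[OF Z] by (rule sets.Un)
  ultimately show ?thesis by blast
qed

end
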